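(* It is decidable whether a permutation class given by a finite basis contains infinitely many simple permutations. That is, there is an algorithm which takes as input a finite antichain $B$ of permutations (with respect to pattern containment), always terminates, and correctly answers whether the class $\operatorname{Av}(B)$ contains infinitely many simple permutations.
   Context: A permutation of length $n$ is a bijection $\pi$ of $[n]=\{1,\dots,n\}$, written as the sequence $\pi(1)\cdots\pi(n)$. A permutation $\pi$ contains $\sigma$ (written $\sigma\le\pi$) if $\pi(1),\dots,\pi(n)$ has a subsequence that is order isomorphic to $\sigma$, i.e. has the same relative comparisons; otherwise $\pi$ avoids $\sigma$. A permutation class is a set of permutations closed downward under $\le$. For a set $B$ of permutations, $\operatorname{Av}(B)=\{\pi : \beta\not\le\pi \text{ for all } \beta\in B\}$. Every permutation class equals $\operatorname{Av}(B)$ for a unique antichain $B$ (with respect to $\le$), called its basis. An interval of a permutation $\pi$ of length $n$ is a set of contiguous indices $I=[a,b]$ such that $\{\pi(i): i\in I\}$ is also a set of consecutive integers. Every permutation of length $n$ has intervals of sizes $0$, $1$ and $n$; $\pi$ is simple if it has no other intervals. *)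

theory Defs
  imports Main "HOL-Library.Sublist" "HOL-Library.Nat_Bijection"
    "HOL-Combinatorics.Multiset_Permutations"
begin

section \<open>Permutations\<close>

text \<open>
  A permutation \<open>\<pi>\<close> of length \<open>n\<close> is the list \<open>[\<pi>(1), \<dots>, \<pi>(n)]\<close>. Its values are
  \<open>1, \<dots>, n\<close>; positions are those of the list, that is, \<open>0, \<dots>, n - 1\<close>.
\<close>

definition perms :: "nat list set" where
  "perms = (\<Union>n. permutations_of_set {1..n})"

definition order_isomorphic :: "nat list \<Rightarrow> nat list \<Rightarrow> bool" where
  "order_isomorphic xs ys \<longleftrightarrow>
     length xs = length ys \<and>
     (\<forall>i<length xs. \<forall>j<length xs. xs ! i < xs ! j \<longleftrightarrow> ys ! i < ys ! j)"

definition perm_contained :: "nat list \<Rightarrow> nat list \<Rightarrow> bool" (infix "\<preceq>" 50) where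
  "\<sigma> \<preceq> \<pi> \<longleftrightarrow> (\<exists>\<tau>. subseq \<tau> \<pi> \<and> order_isomorphic \<tau> \<sigma>)"

definition Av :: "nat list set \<Rightarrow> nat list set" where
  "Av B = {\<pi> \<in> perms. \<forall>\<beta>\<in>B. \<not> \<beta> \<preceq> \<pi>}"

definition perm_antichain :: "nat list set \<Rightarrow> bool" where
  "perm_antichain B \<longleftrightarrow> (\<forall>\<sigma>\<in>B. \<forall>\<tau>\<in>B. \<sigma> \<preceq> \<tau> \<longrightarrow> \<sigma> = \<tau>)"

text \<open>The empty interval is \<open>{a..b}\<close> with \<open>b < a\<close>.\<close>

definition perm_interval :: "nat list \<Rightarrow> nat set \<Rightarrow> bool" where
  "perm_interval \<pi> I \<longleftrightarrow>
     I \<subseteq> {..<length \<pi>} \<and> (\<exists>a b. I = {a..b}) \<and> (\<exists>c d. (!) \<pi> ` I = {c..d})"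

definition simple_perm :: "nat list \<Rightarrow> bool" where
  "simple_perm \<pi> \<longleftrightarrow>
     \<pi> \<in> perms \<and> (\<forall>I. perm_interval \<pi> I \<longrightarrow> card I \<in> {0, 1, length \<pi>})"

section \<open>Algorithms\<close>

text \<open>
  Algorithms are partial recursive functions. \<open>computes f xs y\<close> means that \<open>f\<close>, run on the
  arguments \<open>xs\<close>, terminates with value \<open>y\<close>; if there is no such \<open>y\<close>, then \<open>f\<close> is undefined
  at \<open>xs\<close>. Arities are not part of the syntax: an instruction applied to arguments that no
  rule matches is undefined. Minimisation is over the first argument and requires \<open>f\<close> to be
  defined and nonzero at all smaller values.
\<close>

datatype recf =
    Zero
  | Succ
  | Proj nat
  | Comp recf "recf list"
  | PrimRec recf recf
  | Mu recf

inductive computes :: "recf \<Rightarrow> nat list \<Rightarrow> nat \<Rightarrow> bool" where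
  Zero: "computes Zero xs 0"
| Succ: "computes Succ [x] (Suc x)"
| Proj: "i < length xs \<Longrightarrow> computes (Proj i) xs (xs ! i)"
| Comp: "length ys = length gs \<Longrightarrow> \<forall>i<length gs. computes (gs ! i) xs (ys ! i) \<Longrightarrow>
         computes f ys y \<Longrightarrow> computes (Comp f gs) xs y"
| PrimRec_0: "computes f xs y \<Longrightarrow> computes (PrimRec f g) (0 # xs) y"
| PrimRec_Suc: "computes (PrimRec f g) (n # xs) r \<Longrightarrow> computes g (n # r # xs) y \<Longrightarrow>
         computes (PrimRec f g) (Suc n # xs) y"
| Mu: "computes f (y # xs) 0 \<Longrightarrow> \<forall>z<y. \<exists>v. v \<noteq> 0 \<and> computes f (z # xs) v \<Longrightarrow>
         computes (Mu f) xs y"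

inductive_cases computes_ZeroE: "computes Zero xs y"
inductive_cases computes_SuccE: "computes Succ xs y"
inductive_cases computes_ProjE: "computes (Proj i) xs y"
inductive_cases computes_CompE: "computes (Comp f gs) xs y"
inductive_cases computes_PrimRec_0E: "computes (PrimRec f g) (0 # xs) y"
inductive_cases computes_PrimRec_SucE: "computes (PrimRec f g) (Suc n # xs) y"
inductive_cases computes_MuE: "computes (Mu f) xs y"

lemma computes_deterministic: "computes f xs y \<Longrightarrow> computes f xs y' \<Longrightarrow> y = y'"
proof (induction arbitrary: y' rule: computes.induct)
  case (Comp ys gs xs f y)
  from Comp.prems obtain ys' where ys': "length ys' = length gs"
      "\<forall>i<length gs. computes (gs ! i) xs (ys' ! i)" "computes f ys' y'"
    by (rule computes_CompE)
  have "ys = ys'"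
    using Comp.hyps Comp.IH(1) ys' by (intro nth_equalityI) auto
  then show ?case
    using Comp.IH(2)[of y'] ys'(3) by simp
next
  case (PrimRec_Suc f g n xs r y)
  from PrimRec_Suc.prems obtain r' where
      "computes (PrimRec f g) (n # xs) r'" "computes g (n # r' # xs) y'"
    by (rule computes_PrimRec_SucE)
  then show ?case
    using PrimRec_Suc.IH by blast
next
  case (Mu f y xs)
  from Mu.prems have y': "computes f (y' # xs) 0"
      "\<forall>z<y'. \<exists>v>0. computes f (z # xs) v"
    by - (erule computes_MuE, assumption)+
  show ?case
  proof (cases y y' rule: linorder_cases)
    case less
    then show ?thesis using Mu.IH(1) y'(2) by (metis less_irrefl)
  next
    case greater
    then show ?thesis using Mu.IH(2) y'(1) by (metis less_irrefl)
  qed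
qed (blast elim: computes_ZeroE computes_SuccE computes_ProjE computes_PrimRec_0E)+

text \<open>
  The problem ``given \<open>x \<in> D\<close>, does \<open>P x\<close> hold?'', where the input \<open>x\<close> is presented to the
  algorithm as the number \<open>enc x\<close>. The answers are 1 (yes) and 0 (no).
\<close>

definition decidable_on :: "('a \<Rightarrow> nat) \<Rightarrow> 'a set \<Rightarrow> ('a \<Rightarrow> bool) \<Rightarrow> bool" where
  "decidable_on enc D P \<longleftrightarrow>
     (\<exists>f. \<forall>x\<in>D. computes f [enc x] (if P x then 1 else 0))"

text \<open>
  The code of a finite set of lists; \<open>list_encode\<close> and \<open>set_encode\<close> are the library's
  bijections from lists, respectively finite sets, of natural numbers to natural numbers.
\<close>

definition encode_lists :: "nat list set \<Rightarrow> nat" where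
  "encode_lists B = set_encode (list_encode ` B)"

lemma inj_on_encode_lists: "inj_on encode_lists {B. finite B}"
proof (rule inj_onI)
  fix B C assume "B \<in> {B. finite B}" "C \<in> {B. finite B}" "encode_lists B = encode_lists C"
  then have "list_encode ` B = list_encode ` C"
    by (metis encode_lists_def finite_imageI mem_Collect_eq set_encode_inverse)
  then show "B = C"
    by (simp add: inj_image_eq_iff[OF inj_list_encode])
qed

end

theory Submission
  imports Defs
begin

text \<open>
  A large simple permutation contains a long member of one of a few families of nearly simple
  permutations: a chain in which every point separates its predecessor from all earlier points, a
  parallel alternation, or a wedge alternation with additional points that separate its tip. Indeed,
  if there are no long chains, cut a long monotone subsequence into pairs and let each pair grow along
  a short chain towards a common point. Since disjoint sets cannot all reach this point, at some step
  many of them reach far beyond their neighbours, and the points responsible for this form an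
  alternation.

  In all families the points are the letters of a word, and the relative position of two points
  depends only on their letters and on whether they are adjacent in the word. Hence such words can be
  pumped: a word that is long in terms of the lengths of the basis elements and avoids the basis
  yields arbitrarily long such words. The length of a simple permutation in the class that forces this
  is an elementary function \<open>N\<close> of the code of the basis. So the class contains infinitely many simple
  permutations if and only if it contains one of length between \<open>N\<close> and \<open>N + 2\<close>, a condition that is
  checked by bounded search.
\<close>

section \<open>Intervals, simplicity and chains\<close>

text \<open>Pumping has to preserve three things, and each is a condition on few letters. A word
  belongs to its family by its first letter and its pairs of adjacent letters; its comparisons come
  from points because they are transitive, a condition on triples; it avoids the basis because an
  occurrence of a basis element involves only boundedly many points. So it suffices that all tuples
  of at most \<open>m\<close> letters of the new word, with their adjacencies, occur in the old one,
  for \<open>m\<close> at least 3 and at least the length of every basis element. A finite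
  pigeonhole argument achieves this for all families at once.

  The families must contain large simple permutations for whatever word is pumped. A bare wedge
  fails, since its last two points form an interval; this is why extra points are attached. A chain
  need not be simple either, but it is so after removal of at most two points; this loss is the
  reason for a window of three lengths instead of a single one.

  Bounds are crude closed forms built from sums, products and powers, so that their computability is
  immediate.\<close>

definition separates :: "('a \<Rightarrow> int) \<Rightarrow> ('a \<Rightarrow> int) \<Rightarrow> 'a \<Rightarrow> 'a set \<Rightarrow> bool" where
  "separates x y v A \<longleftrightarrow>
     (\<exists>a\<in>A. \<exists>b\<in>A. x a < x v \<and> x v < x b) \<or> (\<exists>a\<in>A. \<exists>b\<in>A. y a < y v \<and> y v < y b)"

definition interval_in :: "'a set \<Rightarrow> ('a \<Rightarrow> int) \<Rightarrow> ('a \<Rightarrow> int) \<Rightarrow> 'a set \<Rightarrow> bool" where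
  "interval_in V x y I \<longleftrightarrow> I \<subseteq> V \<and> (\<forall>v\<in>V - I. \<not> separates x y v I)"

definition simple_on :: "'a set \<Rightarrow> ('a \<Rightarrow> int) \<Rightarrow> ('a \<Rightarrow> int) \<Rightarrow> bool" where
  "simple_on V x y \<longleftrightarrow> (\<forall>I. interval_in V x y I \<longrightarrow> (\<exists>a\<in>I. \<exists>b\<in>I. a \<noteq> b) \<longrightarrow> I = V)"

text \<open>Points carry two integer coordinates instead of being entries of a list, so that the
  symmetries of the square become negation and exchange of coordinates. Later arguments are then
  given in one orientation only.\<close>

lemma separates_uminus:
  "separates (\<lambda>a. - x a) y = separates x y" "separates x (\<lambda>a. - y a) = separates x y"
  by (auto simp: separates_def fun_eq_iff)

lemma separates_swap: "separates y x = separates x y"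
  by (auto simp: separates_def fun_eq_iff)

lemma simple_on_uminus:
  "simple_on V (\<lambda>a. - x a) y = simple_on V x y" "simple_on V x (\<lambda>a. - y a) = simple_on V x y"
  by (simp_all add: simple_on_def interval_in_def separates_uminus)

lemma simple_on_swap: "simple_on V y x = simple_on V x y"
  by (simp add: simple_on_def interval_in_def separates_swap[of y x])

lemma interval_inD:
  assumes "interval_in V x y I" "inj_on x V" "inj_on y V" "v \<in> V" "v \<notin> I" "a \<in> I" "b \<in> I"
  shows "(x a < x v) = (x b < x v)" "(y a < y v) = (y b < y v)"
proof -
  have *: "\<not> separates x y v I" "I \<subseteq> V" using assms by (auto simp: interval_in_def)
  have "x a \<noteq> x v" "x b \<noteq> x v" "y a \<noteq> y v" "y b \<noteq> y v"
    using assms * by (metis inj_onD subsetD)+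
  with * assms show "(x a < x v) = (x b < x v)" "(y a < y v) = (y b < y v)"
    unfolding separates_def by (metis linorder_less_linear)+
qed

lemma interval_in_between:
  assumes "interval_in V x y I" "v \<in> V" "a \<in> I" "b \<in> I"
    and "(x a < x v \<and> x v < x b) \<or> (y a < y v \<and> y v < y b)"
  shows "v \<in> I"
  using assms by (auto simp: interval_in_def separates_def)

text \<open>A smallest interval with two points is simple, because an interval of an interval is an
  interval of the whole set.\<close>

lemma simple_subset_of_large_intervals:
  assumes "finite V" "a \<in> V" "b \<in> V" "a \<noteq> b"
    and large: "\<And>I a b. interval_in V x y I \<Longrightarrow> a \<in> I \<Longrightarrow> b \<in> I \<Longrightarrow> a \<noteq> b \<Longrightarrow> c \<le> card I"
  shows "\<exists>U\<subseteq>V. c \<le> card U \<and> simple_on U x y"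
proof -
  let ?P = "\<lambda>I. interval_in V x y I \<and> (\<exists>a\<in>I. \<exists>b\<in>I. a \<noteq> b)"
  have "?P V" using assms by (auto simp: interval_in_def)
  then obtain U where U: "?P U" "\<And>I. ?P I \<Longrightarrow> card U \<le> card I"
    using ex_has_least_nat[of ?P V card] by blast
  have UV: "U \<subseteq> V" using U by (auto simp: interval_in_def)
  have "I = U" if I: "interval_in U x y I" "\<exists>a\<in>I. \<exists>b\<in>I. a \<noteq> b" for I
  proof -
    have "interval_in V x y I" unfolding interval_in_def
    proof (intro conjI ballI)
      show "I \<subseteq> V" using I UV by (auto simp: interval_in_def)
      fix v assume v: "v \<in> V - I"
      show "\<not> separates x y v I"
      proof (cases "v \<in> U")
        case True then show ?thesis using I v by (auto simp: interval_in_def)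
      next
        case False
        then have "\<not> separates x y v U" using U(1) v by (auto simp: interval_in_def)
        then show ?thesis using I(1) unfolding separates_def interval_in_def by blast
      qed
    qed
    then have "card U \<le> card I" using U(2) I by blast
    moreover have "I \<subseteq> U" using I by (auto simp: interval_in_def)
    ultimately show "I = U" using UV assms(1) by (meson card_seteq finite_subset)
  qed
  then have "simple_on U x y" by (auto simp: simple_on_def)
  moreover have "c \<le> card U" using U(1) large by blast
  ultimately show ?thesis using UV by blast
qed

section \<open>Growing a pair of points along separating chains\<close>

primrec grow :: "'a set \<Rightarrow> ('a \<Rightarrow> int) \<Rightarrow> ('a \<Rightarrow> int) \<Rightarrow> 'a set \<Rightarrow> nat \<Rightarrow> 'a set" where
  "grow V x y A 0 = A"
| "grow V x y A (Suc n) = grow V x y A n \<union> {v \<in> V. separates x y v (grow V x y A n)}"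

text \<open>Essentially the proper pin sequences of Brignall, Huczynska and Vatter.\<close>

definition separating_chain :: "('a \<Rightarrow> int) \<Rightarrow> ('a \<Rightarrow> int) \<Rightarrow> (nat \<Rightarrow> 'a) \<Rightarrow> nat \<Rightarrow> bool" where
  "separating_chain x y c n \<longleftrightarrow> inj_on c {..<n} \<and>
     (\<forall>j. Suc (Suc j) < n \<longrightarrow>
       (\<forall>i\<le>j. (x (c i) < x (c (Suc (Suc j)))) = (x (c 0) < x (c (Suc (Suc j)))) \<and>
              (y (c i) < y (c (Suc (Suc j)))) = (y (c 0) < y (c (Suc (Suc j))))) \<and>
       ((x (c (Suc j)) < x (c (Suc (Suc j)))) \<noteq> (x (c 0) < x (c (Suc (Suc j)))) \<or>
        (y (c (Suc j)) < y (c (Suc (Suc j)))) \<noteq> (y (c 0) < y (c (Suc (Suc j))))))"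

lemma chain_prefix: "separating_chain x y c n \<Longrightarrow> m \<le> n \<Longrightarrow> separating_chain x y c m"
  unfolding separating_chain_def by (meson inj_on_subset lessThan_subset_iff order_less_le_trans)

lemma grow_mono: "m \<le> n \<Longrightarrow> grow V x y A m \<subseteq> grow V x y A n"
  by (rule lift_Suc_mono_le[of "grow V x y A"]) auto

lemma grow_subset: "A \<subseteq> V \<Longrightarrow> grow V x y A n \<subseteq> V"
  by (induction n) auto

text \<open>A point that first appears in some round does not separate the set of two rounds before,
  so in each coordinate all those points are on one side of it. What it separates from them is a
  point new in the preceding round. Tracing these points back gives the chain.\<close>

lemma grow_chain:
  assumes inj: "inj_on x V" "inj_on y V" and ab: "a \<in> V" "b \<in> V" "a \<noteq> b"
  shows "v \<in> grow V x y {a, b} (Suc r) \<Longrightarrow> v \<notin> grow V x y {a, b} r \<Longrightarrow>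
    \<exists>c. c 0 = a \<and> c 1 = b \<and> c (Suc (Suc r)) = v \<and> separating_chain x y c (Suc (Suc (Suc r))) \<and>
      (\<forall>i\<le>Suc r. c (Suc i) \<in> grow V x y {a, b} i)"
proof (induction r arbitrary: v)
  case 0
  then have v: "v \<in> V" "separates x y v {a, b}" "v \<noteq> a" "v \<noteq> b" by auto
  let ?c = "\<lambda>i::nat. if i = 0 then a else if i = 1 then b else v"
  have "separating_chain x y ?c 3" using v ab
    by (auto simp: separating_chain_def separates_def inj_on_def less_Suc_eq numeral_3_eq_3)
  moreover have "\<forall>i\<le>Suc 0. ?c (Suc i) \<in> grow V x y {a, b} i"
    using v by (auto simp: le_Suc_eq)
  ultimately show ?case by (intro exI[of _ ?c]) (simp add: numeral_3_eq_3)
next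
  case (Suc r)
  let ?G = "grow V x y {a, b}"
  have GV: "?G n \<subseteq> V" for n using ab by (intro grow_subset) auto
  have v: "v \<in> V" "separates x y v (?G (Suc r))" "v \<notin> ?G (Suc r)" "\<not> separates x y v (?G r)"
    using Suc.prems by auto
  have aG: "a \<in> ?G r" using grow_mono[of 0 r V x y "{a, b}"] by auto
  have ne: "x p \<noteq> x v" "y p \<noteq> y v" if "p \<in> ?G (Suc r)" for p
    using that v inj GV by (metis inj_onD subsetD)+
  have GG: "?G r \<subseteq> ?G (Suc r)" by auto
  have unif: "(x p < x v) = (x a < x v)" "(y p < y v) = (y a < y v)" if "p \<in> ?G r" for p
    using v(4) that aG ne GG unfolding separates_def by (meson linorder_less_linear subsetD)+
  obtain u where u: "u \<in> ?G (Suc r)" "u \<notin> ?G r"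
    "(x u < x v) \<noteq> (x a < x v) \<or> (y u < y v) \<noteq> (y a < y v)"
  proof -
    have "\<exists>u\<in>?G (Suc r). (x u < x v) \<noteq> (x a < x v) \<or> (y u < y v) \<noteq> (y a < y v)"
      using v(2) unfolding separates_def by (metis less_asym)
    then show ?thesis using that unif by blast
  qed
  from Suc.IH[OF u(1,2)] obtain c where c: "c 0 = a" "c 1 = b" "c (Suc (Suc r)) = u"
    "separating_chain x y c (Suc (Suc (Suc r)))" "\<forall>i\<le>Suc r. c (Suc i) \<in> ?G i" by blast
  let ?c = "c(Suc (Suc (Suc r)) := v)"
  have cG: "c i \<in> ?G (i - 1)" if "i \<le> Suc (Suc r)" for i
    using that c by (cases i) auto
  have cG': "c i \<in> ?G r" if "i \<le> Suc r" for i
    using cG[of i] that grow_mono[of "i - 1" r V x y "{a, b}"] by (cases i) auto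
  have "v \<notin> c ` {..<Suc (Suc (Suc r))}"
    using cG' c(3) u(1) v(3) GG by (auto simp: less_Suc_eq)
  then have "inj_on ?c {..<Suc (Suc (Suc (Suc r)))}"
    using c(4) by (auto simp: separating_chain_def lessThan_Suc inj_on_def)
  then have "separating_chain x y ?c (Suc (Suc (Suc (Suc r))))"
    unfolding separating_chain_def
  proof (intro conjI allI impI)
    fix j assume j: "Suc (Suc j) < Suc (Suc (Suc (Suc r)))"
    show "(x (?c (Suc j)) < x (?c (Suc (Suc j)))) \<noteq> (x (?c 0) < x (?c (Suc (Suc j)))) \<or>
        (y (?c (Suc j)) < y (?c (Suc (Suc j)))) \<noteq> (y (?c 0) < y (?c (Suc (Suc j))))"
      using c(4) u(3) c(1,3) j by (cases "j = Suc r") (auto simp: separating_chain_def)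
    fix i assume "i \<le> j"
    then show "(x (?c i) < x (?c (Suc (Suc j)))) = (x (?c 0) < x (?c (Suc (Suc j))))"
      "(y (?c i) < y (?c (Suc (Suc j)))) = (y (?c 0) < y (?c (Suc (Suc j))))"
      using c(4) unif cG' c(1) j by (cases "j = Suc r"; auto simp: separating_chain_def)+
  qed
  moreover have "\<forall>i\<le>Suc (Suc r). ?c (Suc i) \<in> ?G i"
    using c(5) Suc.prems(1) by (auto simp: le_Suc_eq)
  moreover have "?c 0 = a" "?c 1 = b" "?c (Suc (Suc (Suc r))) = v" using c(1,2) by auto
  ultimately show ?case by blast
qed

text \<open>The union of all rounds of \<open>grow\<close> is the interval generated by
  \<open>a\<close> and \<open>b\<close>, hence all of \<open>V\<close> by simplicity. The chain
  comes from the first round that contains \<open>z\<close>.\<close>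

lemma chain_reaches:
  assumes "simple_on V x y" "inj_on x V" "inj_on y V" "a \<in> V" "b \<in> V" "a \<noteq> b" "z \<in> V" "z \<noteq> a" "z \<noteq> b"
  obtains c n where "c 0 = a" "c 1 = b" "c n = z" "2 \<le> n" "separating_chain x y c (Suc n)" "c ` {..n} \<subseteq> V"
proof -
  let ?G = "grow V x y {a, b}" let ?A = "\<Union>n. ?G n"
  have GV: "?G n \<subseteq> V" for n using assms by (intro grow_subset) auto
  have "interval_in V x y ?A" unfolding interval_in_def
  proof (intro conjI ballI notI)
    show "?A \<subseteq> V" using GV by blast
    fix v assume v: "v \<in> V - ?A" "separates x y v ?A"
    then obtain s t where st: "s \<in> ?A" "t \<in> ?A" "(x s < x v \<and> x v < x t) \<or> (y s < y v \<and> y v < y t)"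
      unfolding separates_def by blast
    then obtain m n where "s \<in> ?G m" "t \<in> ?G n" by auto
    then have "s \<in> ?G (max m n)" "t \<in> ?G (max m n)"
      using grow_mono[of m "max m n" V x y "{a, b}"] grow_mono[of n "max m n" V x y "{a, b}"] by auto
    then have "v \<in> ?G (Suc (max m n))" using st v unfolding grow.simps separates_def by blast
    then show False using v by blast
  qed
  moreover have "a \<in> ?A" "b \<in> ?A" using UN_I[of 0 UNIV _ ?G] by auto
  ultimately have "?A = V" using assms unfolding simple_on_def by blast
  then obtain n where "z \<in> ?G n" using assms by blast
  then obtain n where n: "z \<in> ?G n" "\<forall>m<n. z \<notin> ?G m"
    using exists_least_iff[of "\<lambda>n. z \<in> ?G n"] by auto
  then obtain r where r: "n = Suc r" using assms by (cases n) auto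
  obtain c where c: "c 0 = a" "c 1 = b" "c (Suc (Suc r)) = z" "separating_chain x y c (Suc (Suc (Suc r)))"
    "\<forall>i\<le>Suc r. c (Suc i) \<in> ?G i"
    using grow_chain[OF assms(2-6), of z r] n(1) n(2)[rule_format, of r] unfolding r by blast
  have "c i \<in> V" if "i \<le> Suc (Suc r)" for i
    using that c assms GV by (cases i) auto
  then show ?thesis using that[of c "Suc (Suc r)"] c by auto
qed

lemma chain_separates:
  assumes "separating_chain x y c n" "Suc (Suc j) < n" "c ` {..<n} \<subseteq> V" "inj_on x V" "inj_on y V"
  shows "separates x y (c (Suc (Suc j))) (c ` {..<Suc (Suc j)})"
proof -
  let ?v = "c (Suc (Suc j))"
  have "c 0 \<noteq> ?v" "c (Suc j) \<noteq> ?v"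
    using assms unfolding separating_chain_def by (auto dest: inj_onD)
  then have "x (c 0) \<noteq> x ?v" "x (c (Suc j)) \<noteq> x ?v" "y (c 0) \<noteq> y ?v" "y (c (Suc j)) \<noteq> y ?v"
    using assms by (auto dest!: inj_onD)
  moreover have "(x (c (Suc j)) < x ?v) \<noteq> (x (c 0) < x ?v) \<or> (y (c (Suc j)) < y ?v) \<noteq> (y (c 0) < y ?v)"
    using assms(1,2) unfolding separating_chain_def by blast
  ultimately have "(x (c (Suc j)) < x ?v \<and> x ?v < x (c 0)) \<or> (x (c 0) < x ?v \<and> x ?v < x (c (Suc j))) \<or>
      (y (c (Suc j)) < y ?v \<and> y ?v < y (c 0)) \<or> (y (c 0) < y ?v \<and> y ?v < y (c (Suc j)))"
    unfolding linorder_neq_iff[where 'a = int] by blast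
  moreover have "c 0 \<in> c ` {..<Suc (Suc j)}" "c (Suc j) \<in> c ` {..<Suc (Suc j)}" by auto
  ultimately show ?thesis unfolding separates_def by blast
qed

lemma chain_uniform:
  assumes "separating_chain x y c n" "j < n" "2 \<le> j" "i \<le> j - 2" "i' \<le> j - 2"
  shows "(x (c i) < x (c j)) = (x (c i') < x (c j))" "(y (c i) < y (c j)) = (y (c i') < y (c j))"
proof -
  obtain l where l: "j = Suc (Suc l)" using assms by (intro that[of "j - 2"]) auto
  have u: "(x (c i) < x (c j)) = (x (c 0) < x (c j)) \<and> (y (c i) < y (c j)) = (y (c 0) < y (c j))"
    if "i \<le> l" for i
    using assms(1,2) that unfolding separating_chain_def l by blast
  have "i \<le> l" "i' \<le> l" using assms l by auto
  from u[OF this(1)] u[OF this(2)]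
  show "(x (c i) < x (c j)) = (x (c i') < x (c j))" "(y (c i) < y (c j)) = (y (c i') < y (c j))"
    by simp_all
qed

lemma chain_sep:
  assumes "separating_chain x y c n" "j < n" "2 \<le> j" "i \<le> j - 2"
  shows "(x (c (j - 1)) < x (c j)) \<noteq> (x (c i) < x (c j)) \<or> (y (c (j - 1)) < y (c j)) \<noteq> (y (c i) < y (c j))"
proof -
  obtain l where l: "j = Suc (Suc l)" using assms by (intro that[of "j - 2"]) auto
  have "(x (c (j - 1)) < x (c j)) \<noteq> (x (c 0) < x (c j)) \<or> (y (c (j - 1)) < y (c j)) \<noteq> (y (c 0) < y (c j))"
    using assms(1,2) unfolding separating_chain_def l diff_Suc_1 by blast
  then show ?thesis using chain_uniform[OF assms(1-4), of 0] by simp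
qed

text \<open>Each \<open>Suc l\<close> distinguishes its predecessor \<open>l\<close> from the
  earlier point \<open>i\<close>, so an interval containing both contains \<open>Suc l\<close>. The
  set \<open>V\<close> may lack the first or the second point of the chain because one of them will
  be deleted.\<close>

lemma chain_interval_forward:
  assumes ch: "separating_chain x y id L" and inj: "inj_on x V" "inj_on y V" and V: "V \<subseteq> {..<L}" "{2..<L} \<subseteq> V"
    and I: "interval_in V x y I" "i \<in> I" "j \<in> I" "i < j" and "j \<le> l" "l < L"
  shows "l \<in> I"
  using assms(10,11)
proof (induction l rule: dec_induct)
  case base then show ?case using I by simp
next
  case (step l)
  have "Suc l \<in> V" using V step I by auto
  have "(x l < x (Suc l)) \<noteq> (x i < x (Suc l)) \<or> (y l < y (Suc l)) \<noteq> (y i < y (Suc l))"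
    using chain_sep[OF ch, of "Suc l" i] step I by auto
  moreover have "l \<in> I" using step by simp
  ultimately show ?case
    using interval_inD[OF I(1) inj \<open>Suc l \<in> V\<close> _ I(2), of l] by blast
qed

text \<open>The last point of a chain sees the points \<open>0, \<dots>, L - 3\<close> uniformly, the \<open>i\<close>-th one does not.\<close>

lemma chain_interval_min:
  assumes ch: "separating_chain x y id L" and inj: "inj_on x V" "inj_on y V" and V: "V \<subseteq> {..<L}" "{2..<L} \<subseteq> V"
    and I: "interval_in V x y I" "i \<in> I" "L - 1 \<in> I" "i < L - 1" "2 \<le> i"
    and t: "t \<in> V" "t \<le> i - 2" "t \<notin> I" "i - 1 \<in> V" "i - 1 \<notin> I"
  shows False
proof -
  let ?n = "L - 1"
  have "x v \<noteq> x w" "y v \<noteq> y w" if "v \<in> I" "w \<in> V" "w \<notin> I" for v w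
    using that inj I(1) by (metis inj_onD interval_in_def subsetD)+
  then have ne: "x v \<noteq> x w" "y v \<noteq> y w" if "v \<in> {i, ?n}" "w \<in> {i - 1, t}" for v w
    using that I t by blast+
  have flip: "(x v < x w) = (\<not> x w < x v)" "(y v < y w) = (\<not> y w < y v)" if "v \<in> {i, ?n}" "w \<in> {i - 1, t}" for v w
    using ne[OF that] by linarith+
  \<comment> \<open>Being outside the interval, \<open>i - 1\<close> and \<open>t\<close> each see
    \<open>i\<close> and the last point on the same side. But \<open>i\<close> separates
    \<open>i - 1\<close> from \<open>t\<close>, and the last point does not.\<close>
  have "(x (i - 1) < x i) \<noteq> (x t < x i) \<or> (y (i - 1) < y i) \<noteq> (y t < y i)"
    using chain_sep[OF ch, of i t] I t by auto
  moreover have "(x (i - 1) < x ?n) = (x t < x ?n)" "(y (i - 1) < y ?n) = (y t < y ?n)"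
    using chain_uniform[OF ch, of ?n "i - 1" t] I t by auto
  moreover note interval_inD[OF I(1) inj t(4,5) I(2,3)] interval_inD[OF I(1) inj t(1,3) I(2,3)]
  ultimately show False using flip[of i "i - 1"] flip[of i t] flip[of ?n "i - 1"] flip[of ?n t] by simp
qed

text \<open>An interval with two points that misses several points contains exactly one of the points
  \<open>0\<close> and \<open>1\<close>, and deleting this point destroys all such intervals.\<close>

lemma chain_simple_subset:
  assumes ch: "separating_chain x y id L" and inj: "inj_on x {..<L}" "inj_on y {..<L}" and L: "6 \<le> L"
  shows "\<exists>U\<subseteq>{..<L}. L - 2 \<le> card U \<and> simple_on U x y"
proof -
  let ?V = "{..<L}"
  have last: "L - 1 \<in> I" if "interval_in V x y I" "a \<in> I" "b \<in> I" "a \<noteq> b" "V \<subseteq> {..<L}" "{2..<L} \<subseteq> V" for I V a b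
  proof -
    have *: "inj_on x V" "inj_on y V" "I \<subseteq> V" using inj that by (auto intro: inj_on_subset simp: interval_in_def)
    have "max a b \<in> I" "min a b \<in> I" "min a b < max a b" "max a b \<le> L - 1" "L - 1 < L"
      using that * L by (auto simp: max_def min_def)
    then show ?thesis using chain_interval_forward[OF ch *(1,2) that(5,6,1)] by blast
  qed
  have minI: "\<exists>i\<in>I. (\<forall>v<i. v \<notin> I) \<and> i < L - 1"
    if I: "interval_in V x y I" "a \<in> I" "b \<in> I" "a \<noteq> b" "V \<subseteq> {..<L}" "{2..<L} \<subseteq> V" for I V a b
  proof -
    obtain i where i: "i \<in> I" "\<forall>v<i. v \<notin> I"
      using exists_least_iff[of "\<lambda>i. i \<in> I"] I(2) by blast
    then have "i \<le> a" "i \<le> b" using I(2,3) not_le by blast+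
    moreover have "a < L" "b < L" using I by (auto simp: interval_in_def)
    ultimately have "i < L - 1" using I(4) by linarith
    then show ?thesis using i by blast
  qed
  \<comment> \<open>All points from 3 on and one earlier point: this is where the number
    \<open>L - 2\<close> comes from.\<close>
  have big: "L - 2 \<le> card I" if "{3..<L} \<subseteq> I" "i \<in> I" "i < 3" "finite I" for i I
  proof -
    have "card (insert i {3..<L}) \<le> card I" using that by (intro card_mono) auto
    then show ?thesis using that L by auto
  qed
  \<comment> \<open>By \<open>chain_interval_min\<close> a small interval contains 0 or 1. It misses
    3, since otherwise it is large by \<open>big\<close>; then by
    \<open>chain_interval_forward\<close> it has no second point up to 3.\<close>
  have bad: "\<exists>s t. s \<in> I \<and> L - 1 \<in> I \<and> {s, t} = {0, 1::nat} \<and> t \<notin> I \<and> 2 \<notin> I \<and> 3 \<notin> I"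
    if I: "interval_in ?V x y I" "a \<in> I" "b \<in> I" "a \<noteq> b" and small: "\<not> L - 2 \<le> card I" for I a b
  proof -
      have V: "?V \<subseteq> {..<L}" "{2..<L} \<subseteq> ?V" by auto
      obtain i where i: "i \<in> I" "\<forall>v<i. v \<notin> I" "i < L - 1" using minI[OF I V] by blast
      have n: "L - 1 \<in> I" using last[OF I V] .
      have fin: "finite I" using I by (auto simp: interval_in_def intro: finite_subset)
      have "i < 2"
      proof (rule ccontr)
        assume "\<not> i < 2"
        moreover have "i - 1 < L" "0 < L" using i(3) by auto
        ultimately show False
          using chain_interval_min[OF ch inj V I(1) i(1) n i(3), of 0] i(2) by simp
      qed
      have fw: "l \<in> I" if "j \<in> I" "i < j" "j \<le> l" "l < L" for j l
        using chain_interval_forward[OF ch inj V I(1) i(1)] that by blast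
      have "3 \<notin> I"
      proof
        assume "3 \<in> I"
        then have "{3..<L} \<subseteq> I" using fw[of 3] \<open>i < 2\<close> by auto
        then show False using big[of I i] i fin small \<open>i < 2\<close> by auto
      qed
      moreover from this have "2 \<notin> I" using fw[of 2 3] \<open>i < 2\<close> L by auto
      moreover have "1 - i \<notin> I" using fw[of 1 3] i \<open>i < 2\<close> \<open>3 \<notin> I\<close> L by (cases i) auto
      ultimately show ?thesis using i n \<open>i < 2\<close>
        by (intro exI[of _ i] exI[of _ "1 - i"]) auto
  qed
  show ?thesis
  proof (cases "\<forall>I a b. interval_in ?V x y I \<longrightarrow> a \<in> I \<longrightarrow> b \<in> I \<longrightarrow> a \<noteq> b \<longrightarrow> L - 2 \<le> card I")
    case True
    then show ?thesis using simple_subset_of_large_intervals[of ?V 0 1 x y "L - 2"] L by auto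
  next
    case False
    then obtain I where I0: "\<exists>s t. interval_in ?V x y I \<and> s \<in> I \<and> L - 1 \<in> I \<and> {s, t} = {0, 1::nat} \<and> t \<notin> I \<and> 2 \<notin> I \<and> 3 \<notin> I"
      using bad by meson
    then obtain s t where bad: "interval_in ?V x y I" "s \<in> I" "L - 1 \<in> I" "{s, t} = {0, 1::nat}" "t \<notin> I" "2 \<notin> I" "3 \<notin> I"
      by blast
    let ?W = "?V - {s}"
    have st: "s < 2" "t < 2" "s \<noteq> t" "t \<in> ?W" using bad(4) L by (auto simp: doubleton_eq_iff)
    have W: "?W \<subseteq> {..<L}" "{2..<L} \<subseteq> ?W" using st by auto
    have injW: "inj_on x ?W" "inj_on y ?W" using inj by (auto intro: inj_on_subset)
    have "L - 2 \<le> card J" if J: "interval_in ?W x y J" "a \<in> J" "b \<in> J" "a \<noteq> b" for J a b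
    proof -
      obtain i where i: "i \<in> J" "\<forall>v<i. v \<notin> J" "i < L - 1" using minI[OF J W] by blast
      have n: "L - 1 \<in> J" using last[OF J W] .
      have fin: "finite J" and "J \<subseteq> ?W" using J by (auto simp: interval_in_def intro: finite_subset)
      have fw: "l \<in> J" if "j \<in> J" "i < j" "j \<le> l" "l < L" for j l
        using chain_interval_forward[OF ch injW W J(1) i(1)] that by blast
      have sep2: "(x 1 < x 2) \<noteq> (x 0 < x 2) \<or> (y 1 < y 2) \<noteq> (y 0 < y 2)"
        and sep3: "(x 2 < x 3) \<noteq> (x s < x 3) \<or> (y 2 < y 3) \<noteq> (y s < y 3)"
        using chain_sep[OF ch, of 2 0] chain_sep[OF ch, of 3 s] L st by auto
      have "i < 3"
      proof (rule ccontr)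
        assume "\<not> i < 3"
        moreover have "i - 1 < L" using i(3) by auto
        moreover have "t \<le> i - 2" "t < i" "2 \<le> i" "i - 1 < i" "i - 1 \<noteq> s" using st \<open>\<not> i < 3\<close> by auto
        ultimately show False
          using chain_interval_min[OF ch injW W J(1) i(1) n i(3), of t] i(2) st by simp
      qed
      moreover have "i \<noteq> s" using \<open>J \<subseteq> ?W\<close> i by auto
      ultimately consider "i = t" | "i = 2" using bad(4) st by (auto simp: doubleton_eq_iff less_Suc_eq numeral_3_eq_3 numeral_2_eq_2)
      then have "{3..<L} \<subseteq> J"
      proof cases
        case 1
        \<comment> \<open>If 2 were outside \<open>J\<close>, it would see \<open>t\<close> as it
          sees the last point. Being outside \<open>I\<close>, it sees \<open>s\<close> in this way
          too, although 2 separates 0 from 1.\<close>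
        have "2 \<in> J"
        proof (rule ccontr)
          assume "2 \<notin> J"
          then have "(x t < x 2) = (x (L - 1) < x 2)" "(y t < y 2) = (y (L - 1) < y 2)"
            using interval_inD[OF J(1) injW _ _ i(1) n, of 2] L st 1 by auto
          moreover have "(x s < x 2) = (x (L - 1) < x 2)" "(y s < y 2) = (y (L - 1) < y 2)"
            using interval_inD[OF bad(1) inj _ bad(6,2,3)] L by auto
          ultimately show False using sep2 bad(4) by (auto simp: doubleton_eq_iff)
        qed
        then show ?thesis using fw[of 2] 1 st by auto
      next
        case 2
        \<comment> \<open>The same argument with 3, which separates 2 from \<open>s\<close>.\<close>
        have "3 \<in> J"
        proof (rule ccontr)
          assume "3 \<notin> J"
          then have "(x 2 < x 3) = (x (L - 1) < x 3)" "(y 2 < y 3) = (y (L - 1) < y 3)"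
            using interval_inD[OF J(1) injW _ _ i(1) n, of 3] L st 2 by auto
          moreover have "(x s < x 3) = (x (L - 1) < x 3)" "(y s < y 3) = (y (L - 1) < y 3)"
            using interval_inD[OF bad(1) inj _ bad(7,2,3)] L by auto
          ultimately show False using sep3 by auto
        qed
        then show ?thesis using fw[of 3] 2 by auto
      qed
      then show ?thesis using big[of J i] i \<open>i < 3\<close> fin by auto
    qed
    then have "\<exists>U\<subseteq>?W. L - 2 \<le> card U \<and> simple_on U x y"
      using simple_subset_of_large_intervals[of ?W t 2 x y "L - 2"] st L by auto
    then show ?thesis by blast
  qed
qed

section \<open>Families of words\<close>

text \<open>One alphabet serves all families, so that \<open>has_family_word\<close> can quantify
  over them. Chains need all four bits.\<close>

type_synonym letter = "bool \<times> bool \<times> bool \<times> bool"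

type_synonym word_rel = "letter \<Rightarrow> letter \<Rightarrow> bool \<Rightarrow> bool"

text \<open>Adjacency is the only positional information used, which makes pumping possible.\<close>

definition realizes ::
  "word_rel \<Rightarrow> word_rel \<Rightarrow> letter list \<Rightarrow> ('a \<Rightarrow> int) \<Rightarrow> ('a \<Rightarrow> int) \<Rightarrow> (nat \<Rightarrow> 'a) \<Rightarrow> bool" where
  "realizes RX RY w x y p \<longleftrightarrow> (\<forall>j<length w. \<forall>i<j.
     (x (p i) < x (p j)) = RX (w ! i) (w ! j) (j = Suc i) \<and>
     (y (p i) < y (p j)) = RY (w ! i) (w ! j) (j = Suc i))"

text \<open>Membership is decided by the first letter and by adjacent letters, which pumping
  preserves.\<close>

definition local_word :: "letter \<Rightarrow> (letter \<times> letter) set \<Rightarrow> letter list \<Rightarrow> bool" where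
  "local_word l0 E w \<longleftrightarrow> w \<noteq> [] \<and> w ! 0 = l0 \<and> (\<forall>i. Suc i < length w \<longrightarrow> (w ! i, w ! Suc i) \<in> E)"

text \<open>The loss of two points and the bound 6 are those of
  \<open>chain_simple_subset\<close>.\<close>

definition nearly_simple_family :: "word_rel \<Rightarrow> word_rel \<Rightarrow> letter \<Rightarrow> (letter \<times> letter) set \<Rightarrow> bool" where
  "nearly_simple_family RX RY l0 E \<longleftrightarrow> (\<forall>w (x :: nat \<Rightarrow> int) y.
     6 \<le> length w \<longrightarrow> local_word l0 E w \<longrightarrow> inj_on x {..<length w} \<longrightarrow> inj_on y {..<length w} \<longrightarrow>
     realizes RX RY w x y id \<longrightarrow> (\<exists>U\<subseteq>{..<length w}. length w - 2 \<le> card U \<and> simple_on U x y))"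

text \<open>Since the family is quantified existentially, the symmetric images of the basic families
  need not be listed.\<close>

definition has_family_word :: "nat \<Rightarrow> 'a set \<Rightarrow> ('a \<Rightarrow> int) \<Rightarrow> ('a \<Rightarrow> int) \<Rightarrow> bool" where
  "has_family_word k V x y \<longleftrightarrow> (\<exists>RX RY l0 E w p. nearly_simple_family RX RY l0 E \<and> length w = k \<and>
     local_word l0 E w \<and> p ` {..<k} \<subseteq> V \<and> inj_on p {..<k} \<and> realizes RX RY w x y p)"

lemma has_family_wordI:
  assumes "nearly_simple_family RX RY l0 E" "length w = k" "local_word l0 E w" "p ` {..<k} \<subseteq> V"
    "inj_on p {..<k}" "realizes RX RY w x y p"
  shows "has_family_word k V x y"
  unfolding has_family_word_def
  by (rule exI[of _ RX], rule exI[of _ RY], rule exI[of _ l0], rule exI[of _ E], rule exI[of _ w],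
      rule exI[of _ p]) (intro conjI assms)

section \<open>Symmetric images of families\<close>

lemma inj_on_uminus: "inj_on f A \<Longrightarrow> inj_on (\<lambda>a. - f a :: int) A"
  by (auto simp: inj_on_def)

text \<open>Only distinct points are compared, so reversing a coordinate complements its
  relation.\<close>

lemma realizes_uminus:
  assumes "inj_on x V" "p ` {..<length w} \<subseteq> V" "inj_on p {..<length w}" "realizes RX RY w x y p"
  shows "realizes (\<lambda>a b c. \<not> RX a b c) RY w (\<lambda>a. - x a) y p"
proof -
  have "x (p i) \<noteq> x (p j)" if "i < j" "j < length w" for i j
  proof -
    have "p i \<in> V" "p j \<in> V" "p i \<noteq> p j"
      using assms(2,3) that inj_onD[OF assms(3), of i j] by force+
    then show ?thesis using assms(1) by (auto dest: inj_onD)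
  qed
  then show ?thesis using assms(4) unfolding realizes_def
    by (smt (verit, best))
qed

lemma realizes_swap: "realizes RX RY w x y p \<Longrightarrow> realizes RY RX w y x p"
  by (simp add: realizes_def)

lemma nearly_simple_family_swap: 
  assumes "nearly_simple_family RX RY l0 E" shows "nearly_simple_family RY RX l0 E"
  unfolding nearly_simple_family_def
proof (intro allI impI)
  fix w and x y :: "nat \<Rightarrow> int"
  assume "6 \<le> length w" "local_word l0 E w" "inj_on x {..<length w}" "inj_on y {..<length w}"
    "realizes RY RX w x y id"
  then show "\<exists>U\<subseteq>{..<length w}. length w - 2 \<le> card U \<and> simple_on U x y"
    using assms realizes_swap[of RY RX w x y id] unfolding nearly_simple_family_def simple_on_swap[of _ x y] by blast
qed

lemma nearly_simple_family_not:
  assumes "nearly_simple_family RX RY l0 E" shows "nearly_simple_family (\<lambda>a b c. \<not> RX a b c) RY l0 E"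
  unfolding nearly_simple_family_def
proof (intro allI impI)
  fix w and x y :: "nat \<Rightarrow> int"
  assume *: "6 \<le> length w" "local_word l0 E w" "inj_on x {..<length w}" "inj_on y {..<length w}"
    "realizes (\<lambda>a b c. \<not> RX a b c) RY w x y id"
  then have "realizes RX RY w (\<lambda>a. - x a) y id"
    using realizes_uminus[of x "{..<length w}" id w "\<lambda>a b c. \<not> RX a b c" RY y] by simp
  then have "\<exists>U\<subseteq>{..<length w}. length w - 2 \<le> card U \<and> simple_on U (\<lambda>a. - x a) y"
    using assms * inj_on_uminus[of x] unfolding nearly_simple_family_def by blast
  then show "\<exists>U\<subseteq>{..<length w}. length w - 2 \<le> card U \<and> simple_on U x y"
    by (simp add: simple_on_uminus)
qed

lemma has_family_word_swap: "has_family_word k V x y \<Longrightarrow> has_family_word k V y x"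
  unfolding has_family_word_def[of k V x y]
  by (elim exE conjE) (rule has_family_wordI[OF nearly_simple_family_swap _ _ _ _ realizes_swap])

lemma has_family_word_uminus1:
  assumes "inj_on x V" "has_family_word k V (\<lambda>a. - x a) y" shows "has_family_word k V x y"
proof -
  obtain RX RY l0 E w p where *: "nearly_simple_family RX RY l0 E" "length w = k"
     "local_word l0 E w" "p ` {..<k} \<subseteq> V" "inj_on p {..<k}" "realizes RX RY w (\<lambda>a. - x a) y p"
    using assms(2) unfolding has_family_word_def by (elim exE conjE) (rule that)
  have "realizes (\<lambda>a b c. \<not> RX a b c) RY w x y p"
    using realizes_uminus[OF inj_on_uminus[OF assms(1)], of p w RX RY y] * by simp
  then show ?thesis
    by (rule has_family_wordI[OF nearly_simple_family_not[OF *(1)] *(2-5)])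
qed

lemma has_family_word_uminus2:
  assumes "inj_on y V" "has_family_word k V x (\<lambda>a. - y a)" shows "has_family_word k V x y"
  by (rule has_family_word_swap, rule has_family_word_uminus1[OF assms(1)], rule has_family_word_swap, rule assms(2))

text \<open>A chain letter records the two comparisons with all points up to the last but one, and the two
  comparisons with the last point.\<close>

definition chain_X :: word_rel where
  "chain_X l l' adj = (case l' of (fx, fy, ax, ay) \<Rightarrow> if adj then ax else fx)"

definition chain_Y :: word_rel where
  "chain_Y l l' adj = (case l' of (fx, fy, ax, ay) \<Rightarrow> if adj then ay else fy)"

definition chain_edges :: "(letter \<times> letter) set" where
  "chain_edges = UNIV \<times> {(fx, fy, ax, ay). fx \<noteq> ax \<or> fy \<noteq> ay}"

lemma chain_family: "nearly_simple_family chain_X chain_Y l0 chain_edges"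
  unfolding nearly_simple_family_def
proof (intro allI impI)
  fix w and x y :: "nat \<Rightarrow> int"
  assume w: "6 \<le> length w" "local_word l0 chain_edges w" and inj: "inj_on x {..<length w}" "inj_on y {..<length w}"
    and r: "realizes chain_X chain_Y w x y id"
  have "separating_chain x y id (length w)"
    unfolding separating_chain_def id_def
  proof (intro conjI allI impI)
    show "inj_on (\<lambda>i. i) {..<length w}" by simp
    fix j assume j: "Suc (Suc j) < length w"
    obtain fx fy ax ay where l: "w ! Suc (Suc j) = (fx, fy, ax, ay)" by (metis prod.exhaust)
    have X: "x i < x (Suc (Suc j)) \<longleftrightarrow> fx" "y i < y (Suc (Suc j)) \<longleftrightarrow> fy" if "i \<le> j" for i
      using r that j l unfolding realizes_def by (auto simp: chain_X_def chain_Y_def)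
    have A: "x (Suc j) < x (Suc (Suc j)) \<longleftrightarrow> ax" "y (Suc j) < y (Suc (Suc j)) \<longleftrightarrow> ay"
      using r j l unfolding realizes_def by (auto simp: chain_X_def chain_Y_def)
    have "fx \<noteq> ax \<or> fy \<noteq> ay" using w(2) j l by (force simp: local_word_def chain_edges_def)
    then show "(x (Suc j) < x (Suc (Suc j))) \<noteq> (x 0 < x (Suc (Suc j))) \<or>
       (y (Suc j) < y (Suc (Suc j))) \<noteq> (y 0 < y (Suc (Suc j)))"
      using A X[of 0] by auto
    show "(x i < x (Suc (Suc j))) = (x 0 < x (Suc (Suc j)))" "(y i < y (Suc (Suc j))) = (y 0 < y (Suc (Suc j)))"
      if "i \<le> j" for i using X[of 0] X[OF that] by simp_all
  qed
  then show "\<exists>U\<subseteq>{..<length w}. length w - 2 \<le> card U \<and> simple_on U x y"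
    using chain_simple_subset inj w by blast
qed

lemma chain_has_family_word:
  assumes ch: "separating_chain x y c k" and V: "c ` {..<k} \<subseteq> V" and k: "0 < k"
  shows "has_family_word k V x y"
proof -
  \<comment> \<open>The first two points have only adjacent predecessors, if any, so the far
    comparisons of their letters are free. They are chosen opposite to the adjacent ones, which
    satisfies the condition on edges.\<close>
  define lt where "lt j = (if j < 2 then (\<not> x (c 0) < x (c 1), \<not> y (c 0) < y (c 1), x (c 0) < x (c 1), y (c 0) < y (c 1))
    else (x (c 0) < x (c j), y (c 0) < y (c j), x (c (j - 1)) < x (c j), y (c (j - 1)) < y (c j)))" for j :: nat
  define w where "w = map lt [0..<k]"
  have "lt (Suc i) \<in> {(fx, fy, ax, ay). fx \<noteq> ax \<or> fy \<noteq> ay}" if "Suc i < k" for i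
  proof (cases "i = 0")
    case True then show ?thesis by (simp add: lt_def)
  next
    case False
    then show ?thesis using chain_sep[OF ch that, of 0] by (simp add: lt_def, blast)
  qed
  then have "local_word (lt 0) chain_edges w" using k
    by (auto simp: local_word_def w_def chain_edges_def)
  moreover have "realizes chain_X chain_Y w x y c"
    unfolding realizes_def
  proof (intro allI impI)
    fix j i assume "j < length w" and i: "i < j"
    then have j: "j < k" by (simp add: w_def)
    show "(x (c i) < x (c j)) = chain_X (w ! i) (w ! j) (j = Suc i) \<and>
             (y (c i) < y (c j)) = chain_Y (w ! i) (w ! j) (j = Suc i)"
    proof (cases "j < 2 \<or> j = Suc i")
      case True
      then have "j = Suc i" using i by auto
      then show ?thesis using j i by (auto simp: w_def lt_def chain_X_def chain_Y_def less_Suc_eq numeral_2_eq_2)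
    next
      case False
      then have "i \<le> j - 2" using i by auto
      then show ?thesis using False chain_uniform[OF ch j, of i 0] j i
        by (simp add: w_def lt_def chain_X_def chain_Y_def)
    qed
  qed
  ultimately show ?thesis
    using has_family_wordI[OF chain_family, of w k "lt 0" c V x y] V ch by (simp add: w_def separating_chain_def)
qed

text \<open>In the letters of alternations, the first component marks the additional points of wedges, the
  second component the type of the point.\<close>

abbreviation pt :: "bool \<Rightarrow> letter" where "pt b \<equiv> (False, b, False, False)"

abbreviation extra :: "bool \<Rightarrow> bool \<Rightarrow> letter" where "extra b b' \<equiv> (True, b, b', False)"

abbreviation alternate :: "(letter \<times> letter) set" where
  "alternate \<equiv> {(pt False, pt True), (pt True, pt False)}"

text \<open>With positions ordered from left to right, \<open>pt False\<close> marks the upper row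
  and \<open>pt True\<close> the lower one; both rows increase.\<close>

definition parallel_Y :: word_rel where
  "parallel_Y l l' _ \<longleftrightarrow> l = pt True \<or> l' = pt False"

lemma interval_in_convex:
  assumes "interval_in V x y I" "i \<in> I" "j \<in> I" "l \<in> V" "x i \<le> x l" "x l \<le> x j" "inj_on x V"
  shows "l \<in> I"
proof -
  have "i \<in> V" "j \<in> V" using assms by (auto simp: interval_in_def)
  then show ?thesis
    using interval_in_between[OF assms(1,4,2,3)] assms by (metis inj_onD order_le_less)
qed

lemma parallel_family: "nearly_simple_family (\<lambda>_ _ _. True) parallel_Y (pt False) alternate"
  unfolding nearly_simple_family_def
proof (intro allI impI)
  fix w and x y :: "nat \<Rightarrow> int"
  assume w: "6 \<le> length w" "local_word (pt False) alternate w" and inj: "inj_on x {..<length w}" "inj_on y {..<length w}"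
    and r: "realizes (\<lambda>_ _ _. True) parallel_Y w x y id"
  \<comment> \<open>An odd number of points would end with a point of the upper row that is both
    rightmost and topmost, and the others would form an interval. It is left out.\<close>
  define L where "L = 2 * (length w div 2)"
  let ?V = "{..<L}"
  have L: "even L" "6 \<le> L" "L \<le> length w" "length w - 1 \<le> L" using w(1) unfolding L_def by presburger+
  have inj': "inj_on x ?V" "inj_on y ?V" using inj L by (auto intro: inj_on_subset)
  have lt: "i < length w \<Longrightarrow> w ! i = pt (odd i)" for i
  proof (induction i)
    case (Suc i)
    then have "(w ! i, w ! Suc i) \<in> alternate" "w ! i = pt (odd i)" using w(2) by (auto simp: local_word_def)
    then show ?case by auto
  qed (use w in \<open>auto simp: local_word_def\<close>)
  have X: "x i < x j" if "i < j" "j < L" for i j using r that L by (auto simp: realizes_def)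
  have Y: "(y i < y j) = (odd i \<or> even j)" if "i < j" "j < L" for i j
    using r that L lt by (auto simp: realizes_def parallel_Y_def)
  have all: "I = ?V" if I: "interval_in ?V x y I" "a \<in> I" "b \<in> I" "a < b" for I a b
  proof -
    have IV: "I \<subseteq> ?V" using I by (auto simp: interval_in_def)
    have cvx: "l \<in> I" if "i \<in> I" "j \<in> I" "i \<le> l" "l \<le> j" for i j l
      using interval_in_convex[OF I(1) that(1,2), of l] X[of i l] X[of l j] that IV inj'
      by (cases "i = l"; cases "l = j") auto
    have a: "a \<in> I" "Suc a \<in> I" using I cvx[of a b] by auto
    then have "Suc a < L" using IV by auto
    \<comment> \<open>Neighbours lie in different rows. The first point is the lowest of the upper
      row and the last one the highest of the lower row, so neither can escape an interval that
      meets both rows.\<close>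
    obtain e d where ed: "e \<in> I" "d \<in> I" "even e" "odd d" using a by (cases "even a") auto
    have le: "e < L" "d < L" using ed IV by auto
    have "0 \<in> I"
    proof (cases "e = 0")
      case False
      then have "y 0 < y e" "\<not> y 0 < y d" using Y[of 0 e] Y[of 0 d] ed le by (auto intro: Nat.gr0I)
      moreover have "y 0 \<noteq> y d" using inj'(2) ed le by (metis inj_onD lessThan_iff odd_pos less_irrefl order_less_trans)
      ultimately show ?thesis using interval_in_between[OF I(1) _ ed(2,1), of 0] le by auto
    qed (use ed in auto)
    moreover have "L - 1 \<in> I"
    proof (cases "d = L - 1")
      case False
      have "odd (L - 1)" using L by auto
      then have ne: "d < L - 1" "e < L - 1" "L - 1 < L" using False le ed by (auto simp: less_Suc_eq order_less_le)
      then have "y d < y (L - 1)" "\<not> y e < y (L - 1)" using Y[of d "L - 1"] Y[of e "L - 1"] ed \<open>odd (L - 1)\<close> by auto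
      moreover have "y e \<noteq> y (L - 1)" using inj'(2) ne le by (metis inj_onD lessThan_iff less_irrefl)
      ultimately show ?thesis using interval_in_between[OF I(1) _ ed(2,1), of "L - 1"] ne by auto
    qed (use ed in auto)
    ultimately show ?thesis using cvx[of 0 "L - 1"] IV by auto
  qed
  have "simple_on ?V x y" unfolding simple_on_def
    using all by (metis linorder_neqE_nat)
  then show "\<exists>U\<subseteq>{..<length w}. length w - 2 \<le> card U \<and> simple_on U x y"
    using L by (intro exI[of _ ?V]) auto
qed

text \<open>The first branch places the additional point vertically between the two sides of the
  wedge.\<close>

definition wedge_Y :: word_rel where
  "wedge_Y l l' _ \<longleftrightarrow> (if fst l then \<not> fst (snd l') else fst (snd l))"

text \<open>Wedges whose tip is separated by a point on the left. A point of type \<open>True\<close> is below all later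
  ones, a point of type \<open>False\<close> is above them.\<close>

lemma wedge1_family:
  "nearly_simple_family (\<lambda>_ _ _. True) wedge_Y (extra False False) (alternate \<union> {extra False False} \<times> range pt)"
  unfolding nearly_simple_family_def
proof (intro allI impI)
  fix w and x y :: "nat \<Rightarrow> int"
  assume w: "6 \<le> length w" "local_word (extra False False) (alternate \<union> {extra False False} \<times> range pt) w"
    and inj: "inj_on x {..<length w}" "inj_on y {..<length w}"
    and r: "realizes (\<lambda>_ _ _. True) wedge_Y w x y id"
  let ?V = "{..<length w}"
  define A where "A i = fst (snd (w ! i))" for i
  have wne: "w \<noteq> []" using w(1) by auto
  have w0: "w ! 0 = extra False False" using w by (auto simp: local_word_def)
  have E: "Suc i < length w \<Longrightarrow> (w ! i, w ! Suc i) \<in> alternate \<union> {extra False False} \<times> range pt" for i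
    using w(2) by (auto simp: local_word_def)
  have lt: "i < length w \<Longrightarrow> 0 < i \<Longrightarrow> w ! i = pt (A i)" for i
  proof (cases i)
    case (Suc j)
    then show "i < length w \<Longrightarrow> ?thesis" using E[of j] by (auto simp: A_def)
  qed simp
  have alt: "A (Suc i) = (\<not> A i)" if "0 < i" "Suc i < length w" for i
    using E[of i] that lt[of i] lt[of "Suc i"] by auto
  have X: "x i < x j" if "i < j" "j < length w" for i j using r that by (auto simp: realizes_def)
  have Y0: "(y 0 < y j) = (\<not> A j)" if "0 < j" "j < length w" for j
    using r that w0 unfolding realizes_def A_def by (auto simp: wedge_Y_def)
  have Y: "(y i < y j) = A i" if "0 < i" "i < j" "j < length w" for i j
    using r that lt[of i] by (auto simp: realizes_def wedge_Y_def)
  have ne: "y i \<noteq> y j" if "i < length w" "j < length w" "i \<noteq> j" for i j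
    using inj(2) that by (auto dest: inj_onD)
  have all: "I = ?V" if I: "interval_in ?V x y I" "a \<in> I" "b \<in> I" "a < b" for I a b
  proof -
    have IV: "I \<subseteq> ?V" using I by (auto simp: interval_in_def)
    have cvx: "l \<in> I" if "i \<in> I" "j \<in> I" "i \<le> l" "l \<le> j" for i j l
      using interval_in_convex[OF I(1) that(1,2), of l] X[of i l] X[of l j] that IV inj
      by (cases "i = l"; cases "l = j") auto
    have btw: "l \<in> I" if "i \<in> I" "j \<in> I" "(y i < y l) \<noteq> (y j < y l)" "l < length w" for i j l
      using interval_inD(2)[OF I(1) inj, of l i j] that by blast
    \<comment> \<open>Points 1 and 2 are the outermost pair: all others lie vertically between them.
      An interval with 0 also contains 1, and 3 is between these two; one without 0 would contain
      two neighbours on different sides of 0.\<close>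
    have two: "1 \<in> I \<and> 2 \<in> I"
    proof (cases "a = 0")
      case True
      then have "0 \<in> I" "1 \<in> I" using I cvx[of a b 1] by auto
      moreover have "3 \<in> I"
        using btw[of 0 1 3] \<open>0 \<in> I\<close> \<open>1 \<in> I\<close> w Y0[of 3] Y[of 1 3] alt[of 1] alt[of 2] by (auto simp: numeral_2_eq_2 numeral_3_eq_3)
      ultimately show ?thesis using cvx[of 1 3 2] by auto
    next
      case False
      have a: "a \<in> I" "Suc a \<in> I" using I cvx[of a b] by auto
      then have "Suc a < length w" using IV by auto
      then have "(y a < y 0) \<noteq> (y (Suc a) < y 0)"
        using Y0[of a] Y0[of "Suc a"] alt[of a] False ne[of a 0] ne[of "Suc a" 0] wne
        by (auto simp: linorder_neq_iff)
      then have "0 \<in> I" using btw[of a "Suc a" 0] a wne by auto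
      then show ?thesis using cvx[of 0 "Suc a"] a False by auto
    qed
    moreover have "l \<in> I" if "3 \<le> l" "l < length w" for l
      using btw[of 1 2 l] two Y[of 1 l] Y[of 2 l] alt[of 1] that w by (auto simp: numeral_2_eq_2)
    moreover have "0 \<in> I"
      using btw[of 1 2 0] two Y0[of 1] Y0[of 2] alt[of 1] w(1) wne ne[of 0 1] ne[of 0 2] by (auto simp: numeral_2_eq_2 linorder_neq_iff)
    ultimately have "l \<in> I" if "l < length w" for l
      using that by (cases "l = 0 \<or> l = 1 \<or> l = 2") auto
    then show ?thesis using IV by auto
  qed
  have "simple_on ?V x y" unfolding simple_on_def
    using all by (metis linorder_neqE_nat)
  then show "\<exists>U\<subseteq>{..<length w}. length w - 2 \<le> card U \<and> simple_on U x y"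
    by (intro exI[of _ ?V]) auto
qed

definition wedge2_X :: word_rel where
  "wedge2_X l l' _ \<longleftrightarrow> (if fst l then fst l' else True)"

definition wedge2_Y :: "bool \<Rightarrow> word_rel" where
  "wedge2_Y b l l' _ \<longleftrightarrow> (if l = extra True b then \<not> b else if fst l then \<not> fst (snd l') else fst (snd l))"

text \<open>Wedges whose last two points in horizontal order are separated by an outer point \<open>0\<close>: it lies
  above all others if \<open>b\<close>, and below them otherwise. Point \<open>1\<close> is the rightmost one.\<close>

lemma wedge2_family:
  "nearly_simple_family wedge2_X (wedge2_Y b) (extra True b)
     (alternate \<union> {(extra True b, extra False b), (extra False b, pt (\<not> b))})"
  unfolding nearly_simple_family_def
proof (intro allI impI)
  fix w and x y :: "nat \<Rightarrow> int"
  let ?E = "alternate \<union> {(extra True b, extra False b), (extra False b, pt (\<not> b))}"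
  assume w: "6 \<le> length w" "local_word (extra True b) ?E w"
    and inj: "inj_on x {..<length w}" "inj_on y {..<length w}"
    and r: "realizes wedge2_X (wedge2_Y b) w x y id"
  let ?V = "{..<length w}"
  define A where "A i = fst (snd (w ! i))" for i
  have E: "Suc i < length w \<Longrightarrow> (w ! i, w ! Suc i) \<in> ?E" for i
    using w(2) by (auto simp: local_word_def)
  have w0: "w ! 0 = extra True b" using w by (auto simp: local_word_def)
  have w1: "w ! 1 = extra False b" using E[of 0] w w0 by auto
  have w2: "w ! 2 = pt (\<not> b)" using E[of 1] w w1 by (auto simp: numeral_2_eq_2)
  have lt: "Suc (Suc i) < length w \<Longrightarrow> w ! (Suc (Suc i)) = pt (A (Suc (Suc i)))" for i
  proof (induction i)
    case 0 then show ?case using w2 by (simp add: A_def numeral_2_eq_2)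
  next
    case (Suc i) then show ?case using E[of "Suc (Suc i)"] by (auto simp: A_def)
  qed
  have lt: "w ! i = pt (A i)" if "2 \<le> i" "i < length w" for i
  proof -
    have "Suc (Suc (i - 2)) = i" using that by simp
    then show ?thesis using lt[of "i - 2"] that by (metis (no_types))
  qed
  have alt: "A (Suc i) = (\<not> A i)" if "2 \<le> i" "Suc i < length w" for i
    using E[of i] that lt[of i] lt[of "Suc i"] by auto
  have A2: "A 2 = (\<not> b)" using w2 by (simp add: A_def)
  have X: "x i < x j" if "2 \<le> i" "i < j" "j < length w" for i j
    using r that lt[of i] by (auto simp: realizes_def wedge2_X_def)
  have X01: "x 0 < x 1" using r w w0 w1 by (auto simp: realizes_def wedge2_X_def)
  have ne: "x i \<noteq> x j" "y i \<noteq> y j" if "i < length w" "j < length w" "i \<noteq> j" for i j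
    using inj that by (auto dest: inj_onD)
  have wne: "w \<noteq> []" using w(1) by auto
  have X0': "\<not> x 0 < x j" if "2 \<le> j" "j < length w" for j
    using r that w0 lt[of j] unfolding realizes_def by (auto simp: wedge2_X_def)
  have X0: "x j < x 0" if "2 \<le> j" "j < length w" for j
    using ne(1)[of 0 j] that wne X0'[OF that] by (cases "j = 0") auto
  have Y0: "(y 0 < y j) = (\<not> b)" if "0 < j" "j < length w" for j
    using r that w0 unfolding realizes_def by (auto simp: wedge2_Y_def)
  have Y1: "(y 1 < y j) = (\<not> A j)" if "2 \<le> j" "j < length w" for j
    using r that w1 unfolding realizes_def A_def by (auto simp: wedge2_Y_def)
  have Y: "(y i < y j) = A i" if "2 \<le> i" "i < j" "j < length w" for i j
    using r that lt[of i] by (auto simp: realizes_def wedge2_Y_def)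
  have all: "I = ?V" if I: "interval_in ?V x y I" "a \<in> I" "c \<in> I" "a < c" for I a c
  proof -
    have IV: "I \<subseteq> ?V" using I by (auto simp: interval_in_def)
    have btw: "l \<in> I" if "i \<in> I" "j \<in> I" "(y i < y l) \<noteq> (y j < y l)" "l < length w" for i j l
      using interval_inD(2)[OF I(1) inj, of l i j] that by blast
    have btwx: "l \<in> I" if "i \<in> I" "j \<in> I" "x i < x l" "x l < x j" "l < length w" for i j l
      using interval_in_between[OF I(1), of l i j] that by auto
    have flip: "(y i < y j) = (\<not> y j < y i)" if "i < length w" "j < length w" "i \<noteq> j" for i j
      using ne[of i j] that by auto
    \<comment> \<open>Vertically point 2 lies between 0 and 1, and horizontally the rest of the
      wedge lies between 2 and 0. All other cases are reduced to this one.\<close>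
    have 01: ?thesis if "0 \<in> I" "1 \<in> I"
    proof -
      have "2 \<in> I" using btw[of 0 1 2] that Y0[of 2] Y1[of 2] A2 w by auto
      moreover have "j \<in> I" if "2 < j" "j < length w" for j
        using btwx[of 2 0 j] \<open>0 \<in> I\<close> \<open>2 \<in> I\<close> X[of 2 j] X0[of j] that by auto
      ultimately have "j \<in> I" if "j < length w" for j
        using \<open>0 \<in> I\<close> \<open>1 \<in> I\<close> that by (cases "j = 0 \<or> j = 1 \<or> j = 2") auto
      then show ?thesis using IV by auto
    qed
    \<comment> \<open>Consecutive points of the wedge are on different sides of point 1, and point 0
      is horizontally between the wedge and point 1.\<close>
    have qq: ?thesis if "2 \<le> i" "i < j" "i \<in> I" "j \<in> I" for i j
    proof -
      have j: "j < length w" using that IV by auto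
      have s: "Suc i \<in> I"
        using btwx[of i j "Suc i"] X[of i "Suc i"] X[of "Suc i" j] that j by (cases "Suc i = j") auto
      have "1 \<in> I"
        using btw[of i "Suc i" 1] s that j Y1[of i] Y1[of "Suc i"] alt[of i] flip[of i 1] flip[of "Suc i" 1] by auto
      moreover have "0 \<in> I" using btwx[of i 1 0] X0[of i] X01 wne that j \<open>1 \<in> I\<close> by auto
      ultimately show ?thesis using 01 by blast
    qed
    have 0: ?thesis if "0 \<in> I" "j \<in> I" "2 \<le> j" for j
    proof -
      have j: "j < length w" using that IV by auto
      show ?thesis
      proof (cases "Suc j < length w")
        case True
        then have "Suc j \<in> I" using btwx[of j 0 "Suc j"] X[of j "Suc j"] X0[of "Suc j"] that by auto
        then show ?thesis using qq[of j "Suc j"] that by auto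
      next
        case False
        \<comment> \<open>The innermost point has no successor in the wedge. Depending on its side,
          point 1 or point 2 lies vertically between it and point 0.\<close>
        then have "2 < j" using w j by auto
        show ?thesis
        proof (cases "A j = b")
          case True
          then have "1 \<in> I" using btw[of 0 j 1] that j Y0[of 1] Y1[of j] flip[of j 1] w by auto
          then show ?thesis using 01 that by blast
        next
          case False
          then have "2 \<in> I" using btw[of 0 j 2] that j Y0[of 2] Y[of 2 j] A2 flip[of j 2] w \<open>2 < j\<close> by auto
          then show ?thesis using qq[of 2 j] that \<open>2 < j\<close> by auto
        qed
      qed
    qed
    have c: "c < length w" using I IV by auto
    consider "2 \<le> a" | "a = 0" "c = 1" | "a = 0" "2 \<le> c" | "a = 1" "2 \<le> c" using I(4) by linarith
    then show ?thesis
    proof cases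
      case 1 then show ?thesis using qq I by blast
    next
      case 2 then show ?thesis using 01 I by blast
    next
      case 3 then show ?thesis using 0 I by blast
    next
      case 4
      then have "0 \<in> I" using btwx[of c 1 0] X0[of c] X01 wne c I by auto
      then show ?thesis using 01 I 4 by blast
    qed
  qed
  have "simple_on ?V x y" unfolding simple_on_def
    using all by (metis linorder_neqE_nat)
  then show "\<exists>U\<subseteq>{..<length w}. length w - 2 \<le> card U \<and> simple_on U x y"
    by (intro exI[of _ ?V]) auto
qed

section \<open>Wedges\<close>

text \<open>Even points form the lower side and odd points the upper side; the sides approach each
  other towards the tip on the right.\<close>

definition zigzag_wedge :: "nat \<Rightarrow> 'a set \<Rightarrow> ('a \<Rightarrow> int) \<Rightarrow> ('a \<Rightarrow> int) \<Rightarrow> (nat \<Rightarrow> 'a) \<Rightarrow> bool" where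
  "zigzag_wedge N V x y q \<longleftrightarrow> (\<forall>i<N. q i \<in> V) \<and>
     (\<forall>j<N. \<forall>i<j. x (q i) < x (q j) \<and> (y (q i) < y (q j)) = even i)"

definition inside :: "('a \<Rightarrow> int) \<Rightarrow> ('a \<Rightarrow> int) \<Rightarrow> (nat \<Rightarrow> 'a) \<Rightarrow> nat \<Rightarrow> 'a \<Rightarrow> bool" where
  "inside x y q m v \<longleftrightarrow> (\<forall>i<m. x (q i) < x v \<and> (if even i then y (q i) < y v else y v < y (q i)))"

lemma zigzag_wedge_inj:
  assumes "zigzag_wedge N V x y q" "i < N" "j < N" "q i = q j" shows "i = j"
proof (rule ccontr)
  assume "i \<noteq> j"
  then have "x (q i) < x (q j) \<or> x (q j) < x (q i)"
    using assms(1-3) unfolding zigzag_wedge_def by (meson linorder_neqE_nat)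
  then show False using assms(4) by auto
qed

lemma zigzag_wedgeD:
  assumes "zigzag_wedge N V x y q" "inj_on y V" "i < j" "j < N"
  shows "x (q i) < x (q j)" "if even i then y (q i) < y (q j) else y (q j) < y (q i)"
proof -
  show "x (q i) < x (q j)" using assms unfolding zigzag_wedge_def by blast
  have "q i \<noteq> q j" using zigzag_wedge_inj[OF assms(1), of i j] assms(3,4) by auto
  moreover have "q i \<in> V" "q j \<in> V" using assms unfolding zigzag_wedge_def by auto
  ultimately have "y (q i) \<noteq> y (q j)" using assms(2) by (auto dest: inj_onD)
  moreover have "(y (q i) < y (q j)) = even i" using assms unfolding zigzag_wedge_def by blast
  ultimately show "if even i then y (q i) < y (q j) else y (q j) < y (q i)" by auto
qed

text \<open>The point \<open>v\<close> is left of the points from \<open>q i0\<close> on and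
  vertically between their two sides, so with them it spells a word of
  \<open>wedge1_family\<close>.\<close>

lemma wedge_left_escape:
  assumes q: "zigzag_wedge N V x y q" and inj: "inj_on x V" "inj_on y V" and v: "v \<in> V"
    and i0: "i0 + k \<le> m" "m \<le> N" "0 < k"
    and left: "x v \<le> x (q i0)"
    and mid: "\<And>i. i < m \<Longrightarrow> if even i then y (q i) < y v else y v < y (q i)"
  shows "has_family_word k V x y"
proof -
  let ?p = "\<lambda>i. if i = 0 then v else q (i0 + i - 1)"
  define lt where "lt i = (if i = 0 then extra False False else pt (even (i0 + i - 1)))" for i
  let ?w = "map lt [0..<k]"
  have vq: "x v < x (q i)" if "i0 \<le> i" "i < m" for i
  proof -
    have "q i0 \<in> V" using q i0 by (auto simp: zigzag_wedge_def)
    moreover have "v \<noteq> q i0" using mid[of i0] i0 by (auto split: if_splits)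
    ultimately have "x v < x (q i0)" using left inj v by (metis inj_onD order_le_less)
    moreover have "x (q i0) \<le> x (q i)" using zigzag_wedgeD(1)[OF q inj(2), of i0 i] that i0 by (cases "i = i0") auto
    ultimately show ?thesis by simp
  qed
  have "local_word (extra False False) (alternate \<union> {extra False False} \<times> range pt) ?w"
    using i0 by (auto simp: local_word_def lt_def Suc_diff_le)
  moreover have "?p ` {..<k} \<subseteq> V" using v q i0 by (auto simp: zigzag_wedge_def)
  moreover have "inj_on ?p {..<k}"
  proof (rule linorder_inj_onI)
    fix i j assume ij: "i < j" "j \<in> {..<k}" "i \<in> {..<k}"
    then have "i0 \<le> i0 + j - 1" "i0 + j - 1 < m" "i0 + i - 1 < N" "i0 + j - 1 < N" "0 < i \<Longrightarrow> i0 + i - 1 \<noteq> i0 + j - 1"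
      using i0 by auto
    then show "?p i \<noteq> ?p j"
      using ij vq[of "i0 + j - 1"] zigzag_wedge_inj[OF q, of "i0 + i - 1" "i0 + j - 1"] i0 by auto
  qed auto
  moreover have "realizes (\<lambda>_ _ _. True) wedge_Y ?w x y ?p"
    unfolding realizes_def
  proof (intro allI impI)
    fix j i assume "j < length ?w" and ij: "i < j"
    then have j: "j < k" by simp
    have jm: "i0 + j - 1 < m" "i0 \<le> i0 + j - 1" using j i0 ij by auto
    show "(x (?p i) < x (?p j)) = True \<and> (y (?p i) < y (?p j)) = wedge_Y (?w ! i) (?w ! j) (j = Suc i)"
    proof (cases "i = 0")
      case True
      then show ?thesis using vq[OF jm(2,1)] mid[OF jm(1)] ij j
        by (auto simp: lt_def wedge_Y_def split: if_splits)
    next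
      case False
      then have "i0 + i - 1 < i0 + j - 1" "i0 + j - 1 < N" using jm ij i0 by auto
      from zigzag_wedgeD[OF q inj(2) this] False ij j show ?thesis
        by (auto simp: lt_def wedge_Y_def split: if_splits)
    qed
  qed
  ultimately show ?thesis using has_family_wordI[OF wedge1_family, of ?w k ?p V x y] by simp
qed

text \<open>The point \<open>v\<close> is beyond \<open>q i0\<close> vertically, and horizontally it
  separates the wedge from the inner point \<open>u\<close>. So \<open>v\<close>, \<open>u\<close>
  and the points from \<open>q i0\<close> on spell a word of \<open>wedge2_family\<close>.\<close>

lemma wedge_outer_escape:
  assumes q: "zigzag_wedge N V x y q" and inj: "inj_on x V" "inj_on y V" and v: "v \<in> V" and u: "u \<in> V"
    and i0: "i0 + k \<le> m" "m \<le> N" "0 < k"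
    and outer: "if even i0 then y v < y (q i0) else y (q i0) < y v"
    and right: "\<And>i. i < m \<Longrightarrow> x (q i) < x v" "x v < x u" and ins: "inside x y q m u"
  shows "has_family_word k V x y"
proof -
  let ?p = "\<lambda>i. if i = 0 then v else if i = 1 then u else q (i0 + i - 2)"
  let ?b = "odd i0"
  define lt where "lt i = (if i = 0 then extra True ?b else if i = 1 then extra False ?b else pt (even (i0 + i - 2)))" for i
  let ?w = "map lt [0..<k]"
  have vq: "if even i0 then y v < y (q i) else y (q i) < y v" if "i0 \<le> i" "i < m" for i
    using zigzag_wedgeD(2)[OF q inj(2), of i0 i] that i0 outer by (cases "i = i0") (auto split: if_splits)
  have vu: "if even i0 then y v < y u else y u < y v"
    using ins outer i0 unfolding inside_def by (auto split: if_splits dest!: spec[of _ i0])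
  have uq: "x (q i) < x u" "if even i then y (q i) < y u else y u < y (q i)" if "i < m" for i
    using ins that unfolding inside_def by auto
  have "local_word (extra True ?b) (alternate \<union> {(extra True ?b, extra False ?b), (extra False ?b, pt (\<not> ?b))}) ?w"
    using i0 by (auto simp: local_word_def lt_def Suc_diff_le)
  moreover have "?p ` {..<k} \<subseteq> V" using v u q i0 by (auto simp: zigzag_wedge_def)
  moreover have "inj_on ?p {..<k}"
  proof (rule linorder_inj_onI)
    fix i j assume ij: "i < j" "j \<in> {..<k}" "i \<in> {..<k}"
    then have "i0 + j - 2 < m" "i0 + i - 2 < N" "i0 + j - 2 < N" "2 \<le> i \<Longrightarrow> i0 + i - 2 \<noteq> i0 + j - 2"
      using i0 by auto
    then show "?p i \<noteq> ?p j"
      using ij right(1)[of "i0 + j - 2"] right(2) uq(1)[of "i0 + j - 2"] zigzag_wedge_inj[OF q, of "i0 + i - 2" "i0 + j - 2"] i0 by auto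
  qed auto
  moreover have "realizes wedge2_X (wedge2_Y ?b) ?w x y ?p"
    unfolding realizes_def
  proof (intro allI impI)
    fix j i assume "j < length ?w" and ij: "i < j"
    then have j: "j < k" by simp
    have jm: "i0 + j - 2 < m" "2 \<le> j \<Longrightarrow> i0 \<le> i0 + j - 2" using j i0 ij by auto
    consider "i = 0" "j = 1" | "i = 0" "2 \<le> j" | "i = 1" "2 \<le> j" | "2 \<le> i" using ij by linarith
    then show "(x (?p i) < x (?p j)) = wedge2_X (?w ! i) (?w ! j) (j = Suc i) \<and>
      (y (?p i) < y (?p j)) = wedge2_Y ?b (?w ! i) (?w ! j) (j = Suc i)"
    proof cases
      case 1
      then show ?thesis using right(2) vu j by (auto simp: lt_def wedge2_X_def wedge2_Y_def split: if_splits)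
    next
      case 2
      then show ?thesis using right(1)[OF jm(1)] vq[OF jm(2,1)] ij j
        by (auto simp: lt_def wedge2_X_def wedge2_Y_def split: if_splits)
    next
      case 3
      then show ?thesis using uq[OF jm(1)] ij j
        by (auto simp: lt_def wedge2_X_def wedge2_Y_def split: if_splits)
    next
      case 4
      then have "i0 + i - 2 < i0 + j - 2" "i0 + j - 2 < N" using jm ij i0 by auto
      from zigzag_wedgeD[OF q inj(2) this] 4 ij j show ?thesis
        by (auto simp: lt_def wedge2_X_def wedge2_Y_def split: if_splits)
    qed
  qed
  ultimately show ?thesis using has_family_wordI[OF wedge2_family, of ?w k ?b ?p V x y] by simp
qed

text \<open>A point that separates \<open>A\<close> horizontally is to the right of the
  \<open>m\<close> layers and can leave them only vertically; one that separates \<open>A\<close>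
  vertically can leave them only to the left. A violated layer among the first \<open>m - k\<close>
  is followed by enough layers for a word of length \<open>k\<close>.\<close>

lemma wedge_escape:
  assumes q: "zigzag_wedge N V x y q" and inj: "inj_on x V" "inj_on y V" and v: "v \<in> V" "A \<subseteq> V"
    and k: "0 < k" "k \<le> m" "m \<le> N"
    and A: "\<And>a. a \<in> A \<Longrightarrow> inside x y q m a" and sep: "separates x y v A"
    and out: "\<not> inside x y q (m - k) v"
  shows "has_family_word k V x y"
proof -
  obtain i0 where i0: "i0 < m - k"
    "\<not> (x (q i0) < x v \<and> (if even i0 then y (q i0) < y v else y v < y (q i0)))"
    using out unfolding inside_def by blast
  have i0': "i0 + k \<le> m" "i0 < m" "q i0 \<in> V" using i0(1) k q by (auto simp: zigzag_wedge_def)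
  from sep consider (x) a b where "a \<in> A" "b \<in> A" "x a < x v" "x v < x b"
    | (y) a b where "a \<in> A" "b \<in> A" "y a < y v" "y v < y b"
    unfolding separates_def by blast
  then show ?thesis
  proof cases
    case x
    have r: "x (q i) < x v" if "i < m" for i
      using A[OF x(1)] that x(3) unfolding inside_def by fastforce
    have "v \<noteq> q i0" using r[OF i0'(2)] by auto
    then have "y v \<noteq> y (q i0)" using inj v i0' by (auto dest: inj_onD)
    then have "if even i0 then y v < y (q i0) else y (q i0) < y v"
      using i0(2) r[OF i0'(2)] by (auto split: if_splits)
    then show ?thesis
      using wedge_outer_escape[OF q inj v(1) _ i0'(1) k(3,1) _ r x(4) A[OF x(2)]] x(2) v(2) by auto
  next
    case y
    have mid: "if even i then y (q i) < y v else y v < y (q i)" if "i < m" for i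
      using A[OF y(1)] A[OF y(2)] that y(3,4) unfolding inside_def by fastforce
    then have "x v \<le> x (q i0)" using i0(2) i0'(2) by fastforce
    then show ?thesis using wedge_left_escape[OF q inj v(1) i0'(1) k(3,1)] mid by auto
  qed
qed

text \<open>A chain from the tip to the outermost point of the wedge has fewer than \<open>k\<close> steps, so one of them
  crosses \<open>k\<close> layers.\<close>

lemma zigzag_wedge_has_family_word:
  assumes q: "zigzag_wedge N V x y q" and inj: "inj_on x V" "inj_on y V" and simple: "simple_on V x y"
    and no_chain: "\<not> (\<exists>c. separating_chain x y c k \<and> c ` {..<k} \<subseteq> V)" and k: "0 < k" and N: "k * k + 3 \<le> N"
  shows "has_family_word k V x y"
proof (rule ccontr)
  assume contr: "\<not> has_family_word k V x y"
  have ne: "q (N - 2) \<noteq> q (N - 1)" "q 0 \<noteq> q (N - 2)" "q 0 \<noteq> q (N - 1)"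
    using zigzag_wedge_inj[OF q, of "N - 2" "N - 1"] zigzag_wedge_inj[OF q, of 0 "N - 2"]
      zigzag_wedge_inj[OF q, of 0 "N - 1"] N by fastforce+
  have "q (N - 2) \<in> V" "q (N - 1) \<in> V" "q 0 \<in> V" using q N by (auto simp: zigzag_wedge_def)
  then obtain c n where c: "c 0 = q (N - 2)" "c 1 = q (N - 1)" "c n = q 0" "2 \<le> n" "separating_chain x y c (Suc n)" "c ` {..n} \<subseteq> V"
    using chain_reaches[OF simple inj, of "q (N - 2)" "q (N - 1)" "q 0"] ne by metis
  have "n < k"
  proof (rule ccontr)
    assume "\<not> n < k"
    then have "separating_chain x y c k" "c ` {..<k} \<subseteq> V" using chain_prefix[OF c(5), of k] c(6) by auto
    then show False using no_chain by blast
  qed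
  have mono: "inside x y q m v \<Longrightarrow> m' \<le> m \<Longrightarrow> inside x y q m' v" for m m' v
    unfolding inside_def by auto
  have nk: "j * k \<le> k * k" if "j \<le> n" for j using that \<open>n < k\<close> by (intro mult_right_mono) auto
  have tip: "inside x y q (N - 2) (q j)" if "N - 2 \<le> j" "j < N" for j
    unfolding inside_def using zigzag_wedgeD[OF q inj(2)] that by auto
  have "j \<le> n \<longrightarrow> inside x y q (N - 2 - j * k) (c j)" for j
  proof (induction j rule: less_induct)
    case (less j)
    show ?case
    proof
      assume jn: "j \<le> n"
      consider "j = 0" | "j = 1" | i where "j = Suc (Suc i)" by (metis One_nat_def not0_implies_Suc)
      then show "inside x y q (N - 2 - j * k) (c j)"
      proof cases
        case 1 then show ?thesis using tip[of "N - 2"] c N by simp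
      next
        case 2 then show ?thesis using mono[OF tip[of "N - 1"]] c N by simp
      next
        case (3 i)
        let ?m = "N - 2 - Suc i * k"
        have km: "k \<le> ?m" using nk[OF jn] N 3 by simp
        have "c ` {..<Suc n} \<subseteq> V" using c(6) by auto
        then have sep: "separates x y (c j) (c ` {..<j})"
          using chain_separates[OF c(5), of i] 3 jn inj by auto
        have "inside x y q ?m a" if "a \<in> c ` {..<j}" for a
        proof -
          obtain l where l: "l < j" "a = c l" using \<open>a \<in> c ` {..<j}\<close> by auto
          have "l * k \<le> Suc i * k" using l 3 by (intro mult_right_mono) auto
          then show ?thesis using less[OF l(1)] l 3 jn by (auto intro: mono)
        qed
        moreover have "c j \<in> V" "c ` {..<j} \<subseteq> V" using c(6) jn by auto
        ultimately have "inside x y q (?m - k) (c j)"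
          using wedge_escape[OF q inj _ _ k km _ _ sep] contr by auto
        moreover have "?m - k = N - 2 - j * k" using 3 by simp
        ultimately show ?thesis by simp
      qed
    qed
  qed
  \<comment> \<open>At most \<open>k * k\<close> of the \<open>N - 2\<close> layers are lost along
    the chain, so some layer would remain around \<open>q 0\<close>. But \<open>q 0\<close> belongs
    to the outermost layer itself.\<close>
  then have "inside x y q (N - 2 - n * k) (c n)" by blast
  then have "inside x y q (N - 2 - n * k) (q 0)" using c(3) by simp
  moreover have "n * k \<le> k * k" by (rule nk) simp
  then have "0 < N - 2 - n * k" using N by linarith
  ultimately show False unfolding inside_def by blast
qed

section \<open>Alternations\<close>

text \<open>A weak form of the Erdos-Szekeres theorem. The leftmost point is below or above at least
  half of the others, and it extends a monotone subset of that half.\<close>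

lemma monotone_subset:
  fixes x y :: "'a \<Rightarrow> int"
  assumes "finite S" "inj_on x S" "inj_on y S" "2 ^ (a + b) \<le> card S"
  shows "(\<exists>I\<subseteq>S. card I = a \<and> (\<forall>p\<in>I. \<forall>r\<in>I. x p < x r \<longrightarrow> y p < y r)) \<or>
    (\<exists>I\<subseteq>S. card I = b \<and> (\<forall>p\<in>I. \<forall>r\<in>I. x p < x r \<longrightarrow> y r < y p))"
  using assms
proof (induction "a + b" arbitrary: a b S)
  case 0
  then show ?case by (intro disjI1 exI[of _ "{}"]) auto
next
  case (Suc n)
  show ?case
  proof (cases "a = 0 \<or> b = 0")
    case True
    then show ?thesis
    proof
      assume "a = 0" then show ?thesis by (intro disjI1 exI[of _ "{}"]) auto
    next
      assume "b = 0" then show ?thesis by (intro disjI2 exI[of _ "{}"]) auto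
    qed
  next
    case False
    have "S \<noteq> {}" using Suc.prems by auto
    then have "Min (x ` S) \<in> x ` S" using Suc.prems(1) by (intro Min_in) auto
    then obtain m where m: "m \<in> S" "x m = Min (x ` S)" by (metis imageE)
    then have m: "m \<in> S" "\<forall>p\<in>S. x m \<le> x p" using Suc.prems(1) by auto
    have xm: "x m < x p" if "p \<in> S" "p \<noteq> m" for p
    proof -
      have "x p \<noteq> x m" using Suc.prems(2) m(1) that by (auto dest: inj_onD)
      then show ?thesis using m(2) that by force
    qed
    define G where "G = {p \<in> S - {m}. y m < y p}"
    define D where "D = {p \<in> S - {m}. y p < y m}"
    have "p \<in> G \<union> D" if "p \<in> S - {m}" for p
    proof -
      have "y p \<noteq> y m" using Suc.prems(3) m(1) that by (auto dest: inj_onD)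
      then show ?thesis using that linorder_less_linear[of "y p" "y m"] by (auto simp: G_def D_def)
    qed
    then have "S - {m} = G \<union> D" by (auto simp: G_def D_def)
    then have "card S - 1 \<le> card G + card D"
      using card_Un_le[of G D] card_Diff_singleton[OF m(1)] by simp
    moreover have pow: "2 ^ (a + b) = 2 * (2 :: nat) ^ n" using Suc.hyps(2)[symmetric] by simp
    ultimately have "2 ^ n \<le> card G \<or> 2 ^ n \<le> card D" using Suc.prems(4) by linarith
    moreover have sub: "finite G" "finite D" "G \<subseteq> S" "D \<subseteq> S" "m \<notin> G" "m \<notin> D"
      unfolding G_def D_def using Suc.prems(1) by auto
    have injs: "inj_on x G" "inj_on y G" "inj_on x D" "inj_on y D"
      using Suc.prems(2,3) sub by (auto intro: inj_on_subset)
    ultimately show ?thesis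
    proof (elim disjE)
      assume "2 ^ n \<le> card G"
      moreover obtain a' where a': "a = Suc a'" using False by (cases a) auto
      ultimately have "(\<exists>I\<subseteq>G. card I = a' \<and> (\<forall>p\<in>I. \<forall>r\<in>I. x p < x r \<longrightarrow> y p < y r)) \<or>
        (\<exists>I\<subseteq>G. card I = b \<and> (\<forall>p\<in>I. \<forall>r\<in>I. x p < x r \<longrightarrow> y r < y p))"
        using Suc.hyps(1)[of a' b G] Suc.hyps(2) sub injs by simp
      then show ?thesis
      proof (elim disjE exE conjE)
        fix I assume I: "I \<subseteq> G" "card I = a'" "\<forall>p\<in>I. \<forall>r\<in>I. x p < x r \<longrightarrow> y p < y r"
        have "finite I" using I(1) sub(1) by (rule finite_subset)
        moreover have "m \<notin> I" using I sub by auto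
        ultimately have "card (insert m I) = a" using I a' by simp
        moreover have "y p < y r" if "p \<in> insert m I" "r \<in> insert m I" "x p < x r" for p r
        proof -
          have "r \<noteq> m" using that m(2) I(1) sub(3) m(1) by (metis insert_iff leD subsetD)
          then show ?thesis using that I(1,3) by (auto simp: G_def)
        qed
        moreover have "insert m I \<subseteq> S" using I(1) sub(3) m(1) by auto
        ultimately show ?thesis by (intro disjI1 exI[of _ "insert m I"] conjI ballI impI)
      next
        fix I assume "I \<subseteq> G" "card I = b" "\<forall>p\<in>I. \<forall>r\<in>I. x p < x r \<longrightarrow> y r < y p"
        moreover from this have "I \<subseteq> S" using sub(3) by (meson subset_trans)
        ultimately show ?thesis by (intro disjI2 exI[of _ I] conjI)
      qed
    next
      assume "2 ^ n \<le> card D"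
      moreover obtain b' where b': "b = Suc b'" using False by (cases b) auto
      ultimately have "(\<exists>I\<subseteq>D. card I = a \<and> (\<forall>p\<in>I. \<forall>r\<in>I. x p < x r \<longrightarrow> y p < y r)) \<or>
        (\<exists>I\<subseteq>D. card I = b' \<and> (\<forall>p\<in>I. \<forall>r\<in>I. x p < x r \<longrightarrow> y r < y p))"
        using Suc.hyps(1)[of a b' D] Suc.hyps(2) sub injs by simp
      then show ?thesis
      proof (elim disjE exE conjE)
        fix I assume I: "I \<subseteq> D" "card I = b'" "\<forall>p\<in>I. \<forall>r\<in>I. x p < x r \<longrightarrow> y r < y p"
        have "finite I" using I(1) sub(2) by (rule finite_subset)
        moreover have "m \<notin> I" using I sub by auto
        ultimately have "card (insert m I) = b" using I b' by simp
        moreover have "y r < y p" if "p \<in> insert m I" "r \<in> insert m I" "x p < x r" for p r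
        proof -
          have "r \<noteq> m" using that m(2) I(1) sub(4) m(1) by (metis insert_iff leD subsetD)
          then show ?thesis using that I(1,3) by (auto simp: D_def)
        qed
        moreover have "insert m I \<subseteq> S" using I(1) sub(4) m(1) by auto
        ultimately show ?thesis by (intro disjI2 exI[of _ "insert m I"] conjI ballI impI)
      next
        fix I assume "I \<subseteq> D" "card I = a" "\<forall>p\<in>I. \<forall>r\<in>I. x p < x r \<longrightarrow> y p < y r"
        moreover from this have "I \<subseteq> S" using sub(4) by (meson subset_trans)
        ultimately show ?thesis by (intro disjI1 exI[of _ I] conjI)
      qed
    qed
  qed
qed

lemma enumerate_by:
  fixes x :: "'a \<Rightarrow> int"
  assumes "finite S" "inj_on x S"
  obtains e where "bij_betw e {..<card S} S" "\<And>i j. i < j \<Longrightarrow> j < card S \<Longrightarrow> x (e i) < x (e j)"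
proof -
  define xs where "xs = sorted_list_of_set (x ` S)"
  define e where "e i = the_inv_into S x (xs ! i)" for i
  have len: "length xs = card S" using assms by (simp add: xs_def card_image)
  have set: "set xs = x ` S" using assms by (simp add: xs_def)
  have xs: "xs ! i \<in> x ` S" if "i < card S" for i using set len nth_mem[of i xs] that by auto
  have e: "e i \<in> S" "x (e i) = xs ! i" if "i < card S" for i
    using xs[OF that] assms(2) unfolding e_def
    by (auto intro: the_inv_into_into f_the_inv_into_f)
  have lt: "x (e i) < x (e j)" if "i < j" "j < card S" for i j
    using that e len unfolding xs_def by (simp add: strict_sorted_iff sorted_wrt_nth_less[OF strict_sorted_list_of_set])
  have inj: "inj_on e {..<card S}"
    using lt by (intro linorder_inj_onI) (auto, metis less_irrefl)
  then have "e ` {..<card S} = S" using e assms(1) by (intro card_subset_eq) (auto simp: card_image)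
  then show ?thesis using that lt inj by (auto simp: bij_betw_def)
qed

text \<open>The order of the points \<open>u i\<close> among themselves is left open. It decides
  later whether the alternation becomes parallel or a wedge.\<close>

definition alternation :: "nat \<Rightarrow> 'a set \<Rightarrow> ('a \<Rightarrow> int) \<Rightarrow> ('a \<Rightarrow> int) \<Rightarrow> (nat \<Rightarrow> 'a) \<Rightarrow> (nat \<Rightarrow> 'a) \<Rightarrow> bool" where
  "alternation T V x y p u \<longleftrightarrow> (\<forall>i<T. p i \<in> V \<and> u i \<in> V \<and> x (p i) < x (u i)) \<and>
     (\<forall>j<T. \<forall>i<j. x (u i) < x (p j) \<and> y (p i) < y (p j)) \<and> (\<forall>i<T. \<forall>j<T. y (p i) < y (u j))"

lemma alternation_subseq:
  assumes "alternation T V x y p u" "\<And>i j. i < j \<Longrightarrow> j < n \<Longrightarrow> h i < h j" "\<And>i. i < n \<Longrightarrow> h i < T"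
  shows "alternation n V x y (p \<circ> h) (u \<circ> h)"
  using assms unfolding alternation_def by auto

lemma parallel_alternation_has_family_word:
  assumes a: "alternation T V x y p u" and T: "k < T" and k: "0 < k"
    and up: "\<And>i j. i < j \<Longrightarrow> j < T \<Longrightarrow> y (u i) < y (u j)"
  shows "has_family_word k V x y"
proof -
  \<comment> \<open>The words of \<open>parallel_family\<close> start in the upper row, so
    \<open>p 0\<close> is skipped and the order is \<open>u 0\<close>, \<open>p 1\<close>,
    \<open>u 1\<close>, \<open>p 2\<close> and so on.\<close>
  define q where "q i = (if even i then u (i div 2) else p (Suc (i div 2)))" for i
  let ?w = "map (\<lambda>i. pt (odd i)) [0..<k]"
  have pu: "x (p i) < x (u i)" if "i < T" for i using a that by (auto simp: alternation_def)
  have up': "x (u i) < x (p j)" if "i < j" "j < T" for i j using a that by (auto simp: alternation_def)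
  have xuu: "x (u i) < x (u j)" if "i < j" "j < T" for i j using up'[OF that] pu[of j] that by auto
  have xpp: "x (p i) < x (p j)" if "i < j" "j < T" for i j using up'[OF that] pu[of i] that by auto
  have ypp: "y (p i) < y (p j)" if "i < j" "j < T" for i j using a that by (auto simp: alternation_def)
  have ypu: "y (p i) < y (u j)" if "i < T" "j < T" for i j using a that by (auto simp: alternation_def)
  have ord: "x (q i) < x (q j) \<and> (y (q i) < y (q j)) = (odd i \<or> even j)" if ij: "i < j" "j < k" for i j
  proof -
    have jT: "Suc (j div 2) < T" "j div 2 < T" using ij T by auto
    have "even i \<and> even j \<and> i div 2 < j div 2 \<or> even i \<and> odd j \<and> i div 2 < Suc (j div 2) \<or>
      odd i \<and> odd j \<and> Suc (i div 2) < Suc (j div 2) \<or> odd i \<and> even j \<and> Suc (i div 2) = j div 2 \<or>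
      odd i \<and> even j \<and> Suc (i div 2) < j div 2"
      using ij(1) by presburger
    then consider "even i" "even j" "i div 2 < j div 2" | "even i" "odd j" "i div 2 < Suc (j div 2)"
      | "odd i" "odd j" "Suc (i div 2) < Suc (j div 2)" | "odd i" "even j" "Suc (i div 2) = j div 2"
      | "odd i" "even j" "Suc (i div 2) < j div 2"
      by blast
    then show ?thesis
    proof cases
      case 1 then show ?thesis using xuu[OF 1(3)] up[OF 1(3)] jT by (simp add: q_def)
    next
      case 2
      then have "y (p (Suc (j div 2))) < y (u (i div 2))" using ypu[of "Suc (j div 2)" "i div 2"] jT by simp
      then show ?thesis using 2(1,2) up'[OF 2(3)] jT by (simp add: q_def)
    next
      case 3 then show ?thesis using xpp[OF 3(3)] ypp[OF 3(3)] jT by (simp add: q_def)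
    next
      case 4 then show ?thesis using pu[of "j div 2"] ypu[of "j div 2" "j div 2"] jT by (simp add: q_def)
    next
      case 5
      then show ?thesis
        using pu[of "j div 2"] xpp[OF 5(3)] ypu[of "Suc (i div 2)" "j div 2"] jT by (simp add: q_def)
    qed
  qed
  have "local_word (pt False) alternate ?w"
    using k by (auto simp: local_word_def)
  moreover have "q ` {..<k} \<subseteq> V" using a T by (auto simp: alternation_def q_def)
  moreover have "inj_on q {..<k}"
  proof (rule linorder_inj_onI)
    fix i j assume "i < j" "j \<in> {..<k}"
    then show "q i \<noteq> q j" using ord[of i j] by auto
  qed auto
  moreover have "realizes (\<lambda>_ _ _. True) parallel_Y ?w x y q"
    unfolding realizes_def
  proof (intro allI impI)
    fix j i assume "j < length ?w" "i < j"
    then show "(x (q i) < x (q j)) = True \<and> (y (q i) < y (q j)) = parallel_Y (?w ! i) (?w ! j) (j = Suc i)"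
      using ord[of i j] by (simp add: parallel_Y_def)
  qed
  ultimately show ?thesis using has_family_wordI[OF parallel_family, of ?w k q V x y] by simp
qed

text \<open>By \<open>monotone_subset\<close>, there are \<open>N\<close> pairs whose upper points
  increase, giving a parallel alternation, or decrease, giving a wedge.\<close>

lemma alternation_has_family_word:
  assumes a: "alternation (2 ^ (2 * N)) V x y p u" and inj: "inj_on x V" "inj_on y V" and simple: "simple_on V x y"
    and no_chain: "\<not> (\<exists>c. separating_chain x y c k \<and> c ` {..<k} \<subseteq> V)" and k: "0 < k" and N: "k * k + 3 \<le> N"
  shows "has_family_word k V x y"
proof -
  let ?T = "2 ^ (2 * N) :: nat"
  have "k \<le> k * k" by simp
  then have kN: "k < N" using N by linarith
  have u: "x (u i) < x (u j)" if "i < j" "j < ?T" for i j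
  proof -
    have "x (u i) < x (p j)" "x (p j) < x (u j)" using a that by (auto simp: alternation_def)
    then show ?thesis by simp
  qed
  have uV: "u i \<in> V" if "i < ?T" for i using a that by (auto simp: alternation_def)
  have neu: "u i \<noteq> u j" if "i < ?T" "j < ?T" "i \<noteq> j" for i j
    using u[of i j] u[of j i] that by (metis less_irrefl linorder_neqE_nat)
  have injy: "inj_on (\<lambda>i. y (u i)) {..<?T}"
    using neu uV inj(2) by (auto simp: inj_on_def) (metis)
  have "(\<exists>I\<subseteq>{..<?T}. card I = N \<and> (\<forall>i\<in>I. \<forall>j\<in>I. int i < int j \<longrightarrow> y (u i) < y (u j))) \<or>
    (\<exists>I\<subseteq>{..<?T}. card I = N \<and> (\<forall>i\<in>I. \<forall>j\<in>I. int i < int j \<longrightarrow> y (u j) < y (u i)))"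
    using injy by (intro monotone_subset) (auto simp: mult_2 inj_on_def)
  then show ?thesis
  proof (elim disjE exE conjE)
    fix I assume I: "I \<subseteq> {..<?T}" "card I = N" "\<forall>i\<in>I. \<forall>j\<in>I. int i < int j \<longrightarrow> y (u i) < y (u j)"
    have "finite I" using I(1) finite_subset by blast
    then obtain h where h: "bij_betw h {..<N} I" "\<And>i j. i < j \<Longrightarrow> j < N \<Longrightarrow> int (h i) < int (h j)"
      using enumerate_by[of I int] I(2) by (auto simp: inj_on_def)
    have hI: "h i \<in> I" if "i < N" for i using h(1) that by (auto simp: bij_betw_def)
    have "alternation N V x y (p \<circ> h) (u \<circ> h)" using h hI I(1) by (intro alternation_subseq[OF a]) auto
    then show ?thesis
      by (rule parallel_alternation_has_family_word[OF _ kN k]) (use I(3) hI h(2) in auto)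
  next
    fix I assume I: "I \<subseteq> {..<?T}" "card I = N" "\<forall>i\<in>I. \<forall>j\<in>I. int i < int j \<longrightarrow> y (u j) < y (u i)"
    have "finite I" using I(1) finite_subset by blast
    then obtain h where h: "bij_betw h {..<N} I" "\<And>i j. i < j \<Longrightarrow> j < N \<Longrightarrow> int (h i) < int (h j)"
      using enumerate_by[of I int] I(2) by (auto simp: inj_on_def)
    have hI: "h i \<in> I" if "i < N" for i using h(1) that by (auto simp: bij_betw_def)
    have hT: "h i < ?T" if "i < N" for i using hI[OF that] I(1) by auto
    have al: "alternation N V x y (p \<circ> h) (u \<circ> h)" using h hI I(1) by (intro alternation_subseq[OF a]) auto
    define q where "q i = (if even i then p (h (i div 2)) else u (h (i div 2)))" for i
    have "zigzag_wedge N V x y q"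
      unfolding zigzag_wedge_def
    proof (intro conjI allI impI)
      fix i assume "i < N" then show "q i \<in> V" using a hT[of "i div 2"] by (auto simp: alternation_def q_def)
    next
      fix i j assume ij: "i < j" "j < N"
      have ij2: "i div 2 < j div 2 \<or> (even i \<and> j div 2 = i div 2 \<and> odd j)" using ij by presburger
      have N2: "j div 2 < N" "i div 2 < N" using ij by auto
      have pu: "x (p (h i')) < x (u (h i'))" if "i' < N" for i' using al that by (auto simp: alternation_def)
      have *: "x (u (h i')) < x (p (h j'))" "y (p (h i')) < y (p (h j'))" if "i' < j'" "j' < N" for i' j' using al that by (auto simp: alternation_def)
      have **: "y (p (h i')) < y (u (h j'))" if "i' < N" "j' < N" for i' j' using al that by (auto simp: alternation_def)
      have ***: "y (u (h j')) < y (u (h i'))" if "i' < j'" "j' < N" for i' j'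
        using I(3) hI h(2) that by (meson order_less_trans)
      show "x (q i) < x (q j)"
      proof (cases "i div 2 < j div 2")
        case True
        from pu[OF N2(1)] pu[OF N2(2)] *(1)[OF True N2(1)] show ?thesis by (simp add: q_def)
      next
        case False
        then show ?thesis using ij2 pu[OF N2(1)] by (auto simp: q_def)
      qed
      show "(y (q i) < y (q j)) = even i"
      proof (cases "even i"; cases "even j")
        assume "even i" "even j"
        then show ?thesis using ij2 *(2)[OF _ N2(1)] by (auto simp: q_def)
      next
        assume "even i" "odd j"
        then show ?thesis using **[OF N2(2,1)] by (simp add: q_def)
      next
        assume "odd i" "even j"
        then show ?thesis using **[OF N2(1,2)] by (simp add: q_def)
      next
        assume "odd i" "odd j"
        then have "i div 2 < j div 2" using ij2 by auto
        from ***[OF this N2(1)] \<open>odd i\<close> \<open>odd j\<close> show ?thesis by (simp add: q_def)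
      qed
    qed
    then show ?thesis using zigzag_wedge_has_family_word inj simple no_chain k N by blast
  qed
qed

section \<open>Unavoidable substructures\<close>

definition below :: "('a \<Rightarrow> int) \<Rightarrow> ('a \<Rightarrow> int) \<Rightarrow> 'a set \<Rightarrow> 'a set \<Rightarrow> bool" where
  "below x y A B \<longleftrightarrow> (\<forall>p\<in>A. \<forall>q\<in>B. x p < x q \<and> y p < y q)"

definition increasing_sets :: "('a \<Rightarrow> int) \<Rightarrow> ('a \<Rightarrow> int) \<Rightarrow> nat set \<Rightarrow> (nat \<Rightarrow> 'a set) \<Rightarrow> bool" where
  "increasing_sets x y J C \<longleftrightarrow> (\<forall>i\<in>J. \<forall>j\<in>J. i \<noteq> j \<longrightarrow> below x y (C i) (C j) \<or> below x y (C j) (C i))"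

lemma increasing_sets_swap: "increasing_sets y x J C = increasing_sets x y J C"
  by (auto simp: increasing_sets_def below_def)

lemma increasing_sets_uminus: "increasing_sets (\<lambda>a. - x a) (\<lambda>a. - y a) J C = increasing_sets x y J C"
  by (auto simp: increasing_sets_def below_def)

lemma increasing_sets_subset: "increasing_sets x y J C \<Longrightarrow> I \<subseteq> J \<Longrightarrow> increasing_sets x y I C"
  unfolding increasing_sets_def by blast

lemma increasing_sets_disjoint:
  assumes "increasing_sets x y J C" "i \<in> J" "j \<in> J" "i \<noteq> j" "z \<in> C i" "z \<in> C j" shows False
proof -
  have "below x y (C i) (C j) \<or> below x y (C j) (C i)"
    using assms(1-4) unfolding increasing_sets_def by blast
  then show False using assms(5,6) unfolding below_def by blast
qed

lemma increasing_sets_cong: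
  "J = J' \<Longrightarrow> (\<And>i. i \<in> J' \<Longrightarrow> C i = D i) \<Longrightarrow> increasing_sets x y J C = increasing_sets x y J' D"
  by (simp add: increasing_sets_def)

text \<open>By \<open>separates_cases\<close> this is the only way to separate a set up to four
  symmetries, namely those that respect \<open>increasing_sets\<close>.\<close>

definition up_separated :: "('a \<Rightarrow> int) \<Rightarrow> ('a \<Rightarrow> int) \<Rightarrow> 'a \<Rightarrow> 'a set \<Rightarrow> bool" where
  "up_separated x y v A \<longleftrightarrow> (\<exists>p\<in>A. \<exists>q\<in>A. x p < x v \<and> x v < x q) \<and> (\<exists>p\<in>A. y p < y v)"

lemma separates_cases:
  assumes "separates x y v A" "v \<notin> A" "v \<in> V" "A \<subseteq> V" "inj_on x V" "inj_on y V"
  shows "up_separated x y v A \<or> up_separated (\<lambda>a. - x a) (\<lambda>a. - y a) v A \<or>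
    up_separated y x v A \<or> up_separated (\<lambda>a. - y a) (\<lambda>a. - x a) v A"
proof -
  have ne: "x p \<noteq> x v" "y p \<noteq> y v" if "p \<in> A" for p
  proof -
    have "p \<in> V" "p \<noteq> v" using that assms by auto
    then show "x p \<noteq> x v" "y p \<noteq> y v" using assms(3,5,6) by (auto dest: inj_onD)
  qed
  from assms(1) consider (x) p q where "p \<in> A" "q \<in> A" "x p < x v" "x v < x q"
    | (y) p q where "p \<in> A" "q \<in> A" "y p < y v" "y v < y q"
    unfolding separates_def by blast
  then show ?thesis
  proof cases
    case x
    show ?thesis
    proof (cases "y p < y v")
      case True
      then have "up_separated x y v A" unfolding up_separated_def using x by blast
      then show ?thesis by blast
    next
      case False
      then have "- y p < - y v" "- x q < - x v" "- x v < - x p" using ne[OF x(1)] x by auto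
      then have "up_separated (\<lambda>a. - x a) (\<lambda>a. - y a) v A" unfolding up_separated_def using x(1,2) by blast
      then show ?thesis by blast
    qed
  next
    case y
    show ?thesis
    proof (cases "x p < x v")
      case True
      then have "up_separated y x v A" unfolding up_separated_def using y by blast
      then show ?thesis by blast
    next
      case False
      then have "- x p < - x v" "- y q < - y v" "- y v < - y p" using ne[OF y(1)] y by auto
      then have "up_separated (\<lambda>a. - y a) (\<lambda>a. - x a) v A" unfolding up_separated_def using y(1,2) by blast
      then show ?thesis by blast
    qed
  qed
qed

lemma enumerate_increasing_sets:
  assumes "increasing_sets x y J C" "finite J" "\<And>i. i \<in> J \<Longrightarrow> C i \<noteq> {}"
  obtains e where "bij_betw e {..<card J} J"
    "\<And>i j. i < j \<Longrightarrow> j < card J \<Longrightarrow> below x y (C (e i)) (C (e j))"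
proof -
  define k where "k i = x (SOME p. p \<in> C i)" for i
  have k: "\<exists>p\<in>C i. k i = x p" if "i \<in> J" for i
    unfolding k_def using assms(3)[OF that] by (metis some_in_eq)
  have lt: "below x y (C i) (C j)" if "i \<in> J" "j \<in> J" "k i < k j" for i j
  proof -
    have "\<not> below x y (C j) (C i)" using k[OF that(1)] k[OF that(2)] that(3) unfolding below_def by force
    moreover have "i \<noteq> j" using that by auto
    ultimately show ?thesis using assms(1) that unfolding increasing_sets_def by blast
  qed
  have "inj_on k J"
  proof (rule inj_onI, rule ccontr)
    fix i j assume ij: "i \<in> J" "j \<in> J" "k i = k j" "i \<noteq> j"
    then have "below x y (C i) (C j) \<or> below x y (C j) (C i)"
      using assms(1) unfolding increasing_sets_def by blast
    then show False using k[OF ij(1)] k[OF ij(2)] ij(3) unfolding below_def by force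
  qed
  then obtain e where e: "bij_betw e {..<card J} J" "\<And>i j. i < j \<Longrightarrow> j < card J \<Longrightarrow> k (e i) < k (e j)"
    using enumerate_by assms(2) by blast
  have "e i \<in> J" if "i < card J" for i using e(1) that by (auto simp: bij_betw_def)
  then show ?thesis using that e lt by (meson order_less_trans)
qed

text \<open>Cut the sets into blocks of \<open>T + 1\<close> consecutive ones. Either every block contains a separating
  point that stays below the last set of its block, and one set from each block can be extended, or
  all separating points of some block go beyond its last set.\<close>

lemma extend_or_alternation_up:
  assumes inc: "increasing_sets x y J C" and fin: "finite J" and card: "Suc T * M \<le> card J"
    and u: "\<And>i. i \<in> J \<Longrightarrow> up_separated x y (u i) (C i)" and V: "\<And>i. i \<in> J \<Longrightarrow> insert (u i) (C i) \<subseteq> V"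
  shows "(\<exists>I\<subseteq>J. card I = M \<and> increasing_sets x y I (\<lambda>i. insert (u i) (C i))) \<or>
    (\<exists>p u'. alternation T V x y p u')"
proof -
  have ne: "C i \<noteq> {}" if "i \<in> J" for i using u[OF that] by (auto simp: up_separated_def)
  then obtain e where e: "bij_betw e {..<card J} J"
    and lt: "\<And>i j. i < j \<Longrightarrow> j < card J \<Longrightarrow> below x y (C (e i)) (C (e j))"
    using enumerate_increasing_sets[OF inc fin] by blast
  have eJ: "e i \<in> J" if "i < card J" for i using e that by (auto simp: bij_betw_def)
  have block: "l * Suc T + T < card J" if "l < M" for l
  proof -
    have "Suc l * Suc T \<le> M * Suc T" using that by (intro mult_right_mono) auto
    then show ?thesis using card by (simp add: algebra_simps)
  qed
  show ?thesis
  proof (cases "\<forall>l<M. \<exists>i<T. \<forall>q\<in>C (e (l * Suc T + T)). y (u (e (l * Suc T + i))) < y q")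
    case True
    then obtain f where f: "\<And>l. l < M \<Longrightarrow> f l < T"
      "\<And>l q. l < M \<Longrightarrow> q \<in> C (e (l * Suc T + T)) \<Longrightarrow> y (u (e (l * Suc T + f l))) < y q"
      by metis
    define h where "h l = l * Suc T + f l" for l
    have h: "h l < l * Suc T + T" "h l < card J" if "l < M" for l
      using f(1)[OF that] block[OF that] by (auto simp: h_def)
    have h': "l * Suc T + T < h l'" if "l < l'" for l l'
    proof -
      have "Suc l * Suc T \<le> l' * Suc T" using that by (intro mult_right_mono) auto
      then show ?thesis by (simp add: h_def)
    qed
    have blw: "below x y (insert (u (e (h l))) (C (e (h l)))) (insert (u (e (h l'))) (C (e (h l'))))"
      if l: "l < l'" "l' < M" for l l'
    proof -
      let ?A = "C (e (h l))" and ?B = "C (e (h l'))" and ?D = "C (e (l * Suc T + T))"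
      have hl: "h l < l * Suc T + T" "l * Suc T + T < h l'" "h l' < card J" "h l < h l'"
        using h[of l] h[of l'] h'[OF l(1)] l by auto
      have AB: "below x y ?A ?B" and DB: "below x y ?D ?B" using lt hl by auto
      obtain d where d: "d \<in> ?D" using ne[OF eJ[OF block[of l]]] l by auto
      have *: "y (u (e (h l))) < y d" using f(2)[OF _ d] l by (auto simp: h_def)
      have JJ: "e (h l) \<in> J" "e (h l') \<in> J" using eJ hl by auto
      obtain a a' where a: "a \<in> ?A" "a' \<in> ?A" "x (u (e (h l))) < x a'"
        using u[OF JJ(1)] unfolding up_separated_def by blast
      obtain b b' where b: "b \<in> ?B" "b' \<in> ?B" "x b < x (u (e (h l')))" "y b' < y (u (e (h l')))"
        using u[OF JJ(2)] unfolding up_separated_def by blast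
      \<comment> \<open>Horizontally the separating point is confined by its own set; vertically it
        is below the point \<open>d\<close> of the last set of its block, and this set is below
        \<open>?B\<close>.\<close>
      have uB: "x (u (e (h l))) < x q \<and> y (u (e (h l))) < y q" if "q \<in> ?B" for q
        using a(2,3) AB DB d * that unfolding below_def by force
      have Au: "x p < x (u (e (h l'))) \<and> y p < y (u (e (h l')))" if "p \<in> ?A" for p
        using b AB that unfolding below_def by force
      have "x (u (e (h l))) < x (u (e (h l'))) \<and> y (u (e (h l))) < y (u (e (h l')))"
        using uB[OF b(1)] uB[OF b(2)] b(3,4) by simp
      then show ?thesis using AB uB Au unfolding below_def by blast
    qed
    let ?I = "(\<lambda>l. e (h l)) ` {..<M}"
    have hmono: "h l < h l'" if "l < l'" "l' < M" for l l' using h(1)[of l] h'[OF that(1)] that by auto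
    have "inj_on (\<lambda>l. e (h l)) {..<M}"
    proof (rule linorder_inj_onI)
      fix l l' assume "l < l'" "l' \<in> {..<M}"
      then show "e (h l) \<noteq> e (h l')" using e hmono[of l l'] h(2)[of l'] h(2)[of l]
        by (auto simp: bij_betw_def dest: inj_onD)
    qed auto
    then have "card ?I = M" by (simp add: card_image)
    moreover have "?I \<subseteq> J" using eJ h(2) by auto
    moreover have "increasing_sets x y ?I (\<lambda>i. insert (u i) (C i))"
      unfolding increasing_sets_def
    proof (intro ballI impI)
      fix i j assume "i \<in> ?I" "j \<in> ?I" "i \<noteq> j"
      then obtain l l' where l: "l < M" "l' < M" "i = e (h l)" "j = e (h l')" "l \<noteq> l'" by auto
      then show "below x y (insert (u i) (C i)) (insert (u j) (C j)) \<or>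
          below x y (insert (u j) (C j)) (insert (u i) (C i))"
        using blw[of l l'] blw[of l' l] by (cases "l < l'") auto
    qed
    ultimately show ?thesis by blast
  next
    case False
    then obtain l where l: "l < M" "\<forall>i<T. \<exists>q\<in>C (e (l * Suc T + T)). \<not> y (u (e (l * Suc T + i))) < y q"
      by blast
    then have l: "l < M" "\<And>i. i < T \<Longrightarrow> \<exists>q\<in>C (e (l * Suc T + T)). y q \<le> y (u (e (l * Suc T + i)))"
      by (simp_all add: not_less del: mult_Suc_right)
    define g where "g i = e (l * Suc T + i)" for i
    have gJ: "g i \<in> J" if "i \<le> T" for i using eJ block[OF l(1)] that by (simp add: g_def)
    have blw: "below x y (C (g i)) (C (g j))" if "i < j" "j \<le> T" for i j
      unfolding g_def using block[OF l(1)] that by (intro lt) auto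
    have "\<forall>i\<le>T. \<exists>p\<in>C (g i). x p < x (u (g i))" using u gJ unfolding up_separated_def by blast
    then obtain p where p: "\<And>i. i \<le> T \<Longrightarrow> p i \<in> C (g i)" "\<And>i. i \<le> T \<Longrightarrow> x (p i) < x (u (g i))" by metis
    have "alternation T V x y p (u \<circ> g)"
      unfolding alternation_def
    proof (intro conjI allI impI)
      fix i assume i: "i < T"
      then show "p i \<in> V" "(u \<circ> g) i \<in> V" "x (p i) < x ((u \<circ> g) i)"
        using p[of i] V[OF gJ[of i]] by auto
      fix j assume j: "j < T"
      \<comment> \<open>A point of the last set of the block mediates: it lies above
        \<open>p i\<close> and not above \<open>u (g j)\<close>.\<close>
      obtain q where q: "q \<in> C (g T)" "y q \<le> y (u (g j))" using l(2)[OF j] by (auto simp: g_def)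
      have "y (p i) < y q" using blw[OF i] p(1)[of i] q(1) i unfolding below_def by auto
      then show "y (p i) < y ((u \<circ> g) j)" using q(2) by simp
    next
      fix i j assume ij: "j < T" "i < j"
      have b: "below x y (C (g i)) (C (g j))" using blw ij by auto
      have pp: "p i \<in> C (g i)" "p j \<in> C (g j)" using p(1) ij by auto
      then show "y (p i) < y (p j)" using b unfolding below_def by auto
      obtain a where "a \<in> C (g i)" "x (u (g i)) < x a"
        using u[OF gJ[of i]] ij unfolding up_separated_def by auto
      moreover from this have "x a < x (p j)" using b pp unfolding below_def by auto
      ultimately show "x ((u \<circ> g) i) < x (p j)" by simp
    qed
    then show ?thesis by blast
  qed
qed

text \<open>The factor 4 pays for restricting to the most frequent of the four kinds in
  \<open>separates_cases\<close>.\<close>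

lemma extend_or_alternation:
  assumes inc: "increasing_sets x y J C" and fin: "finite J" and card: "4 * (Suc T * M) \<le> card J"
    and inj: "inj_on x V" "inj_on y V"
    and u: "\<And>i. i \<in> J \<Longrightarrow> separates x y (u i) (C i)" "\<And>i. i \<in> J \<Longrightarrow> u i \<notin> C i"
    and V: "\<And>i. i \<in> J \<Longrightarrow> insert (u i) (C i) \<subseteq> V"
  shows "(\<exists>I\<subseteq>J. card I = M \<and> increasing_sets x y I (\<lambda>i. insert (u i) (C i))) \<or>
    (\<exists>p u'. alternation T V x y p u' \<or> alternation T V (\<lambda>a. - x a) (\<lambda>a. - y a) p u' \<or>
      alternation T V y x p u' \<or> alternation T V (\<lambda>a. - y a) (\<lambda>a. - x a) p u')"
proof -
  define S where "S x y = {i \<in> J. up_separated x y (u i) (C i)}" for x y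
  have "J \<subseteq> S x y \<union> S (\<lambda>a. - x a) (\<lambda>a. - y a) \<union> S y x \<union> S (\<lambda>a. - y a) (\<lambda>a. - x a)"
  proof
    fix i assume "i \<in> J"
    then show "i \<in> S x y \<union> S (\<lambda>a. - x a) (\<lambda>a. - y a) \<union> S y x \<union> S (\<lambda>a. - y a) (\<lambda>a. - x a)"
      using separates_cases[OF u(1,2) _ _ inj, of i] V[of i] unfolding S_def by auto
  qed
  moreover have fin': "finite (S x y)" for x y using fin by (auto simp: S_def)
  ultimately have "card J \<le> card (S x y \<union> S (\<lambda>a. - x a) (\<lambda>a. - y a) \<union> S y x \<union> S (\<lambda>a. - y a) (\<lambda>a. - x a))"
    by (intro card_mono) auto
  also have "\<dots> \<le> card (S x y) + card (S (\<lambda>a. - x a) (\<lambda>a. - y a)) + card (S y x) + card (S (\<lambda>a. - y a) (\<lambda>a. - x a))"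
    by (meson add_le_cancel_right card_Un_le order_trans)
  finally have "Suc T * M \<le> card (S x y) \<or> Suc T * M \<le> card (S (\<lambda>a. - x a) (\<lambda>a. - y a)) \<or>
    Suc T * M \<le> card (S y x) \<or> Suc T * M \<le> card (S (\<lambda>a. - y a) (\<lambda>a. - x a))"
    using card by linarith
  moreover define Q where "Q \<longleftrightarrow> (\<exists>I\<subseteq>J. card I = M \<and> increasing_sets x y I (\<lambda>i. insert (u i) (C i)))"
  have *: "Q \<or> (\<exists>p u'. alternation T V x' y' p u')"
    if "Suc T * M \<le> card (S x' y')" "\<And>I C. increasing_sets x' y' I C = increasing_sets x y I C" for x' y'
  proof -
    have sub: "S x' y' \<subseteq> J" by (auto simp: S_def)
    then have "increasing_sets x' y' (S x' y') C" using increasing_sets_subset[OF inc] that(2) by blast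
    from extend_or_alternation_up[OF this fin' that(1), of u V]
    have "(\<exists>I\<subseteq>S x' y'. card I = M \<and> increasing_sets x y I (\<lambda>i. insert (u i) (C i))) \<or>
      (\<exists>p u'. alternation T V x' y' p u')"
      using V by (simp add: S_def that(2))
    then show ?thesis
    proof (elim disjE exE conjE)
      fix I assume "I \<subseteq> S x' y'" "card I = M" "increasing_sets x y I (\<lambda>i. insert (u i) (C i))"
      then have Q unfolding Q_def using sub by (intro exI[of _ I]) auto
      then show ?thesis by blast
    next
      fix p u' assume "alternation T V x' y' p u'"
      then show ?thesis by (intro disjI2 exI)
    qed
  qed
  ultimately show ?thesis
    using *[of x y] *[of "\<lambda>a. - x a" "\<lambda>a. - y a"] *[of y x] *[of "\<lambda>a. - y a" "\<lambda>a. - x a"]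
    unfolding Q_def[symmetric] increasing_sets_uminus increasing_sets_swap[of y x]
    by blast
qed

text \<open>After \<open>k\<close> steps all sets would contain \<open>z\<close>.\<close>

lemma increasing_chains_have_family_word:
  assumes inj: "inj_on x V" "inj_on y V" and simple: "simple_on V x y"
    and k: "0 < k" and N: "k * k + 3 \<le> N"
    and no_word: "\<not> has_family_word k V x y"
    and c: "\<And>i. i \<in> J0 \<Longrightarrow> separating_chain x y (c i) (Suc (n i))" "\<And>i. i \<in> J0 \<Longrightarrow> c i (n i) = z"
      "\<And>i. i \<in> J0 \<Longrightarrow> c i ` {..n i} \<subseteq> V" "\<And>i. i \<in> J0 \<Longrightarrow> n i < k"
  shows "k \<le> j + r \<Longrightarrow> J \<subseteq> J0 \<Longrightarrow> finite J \<Longrightarrow> (4 * (2 ^ (2 * N) + 3)) ^ Suc r \<le> card J \<Longrightarrow>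
    \<not> increasing_sets x y J (\<lambda>i. c i ` {l. l < j + 2 \<and> l \<le> n i})"
proof (induction r arbitrary: j J)
  let ?C = "\<lambda>j i. c i ` {l. l < j + 2 \<and> l \<le> n i}"
  case 0
  show ?case
  proof
    assume inc: "increasing_sets x y J (?C j)"
    have "(1::nat) \<le> 2 ^ (2 * N)" by simp
    then have "2 \<le> card J" using 0(4) by simp
    then have "\<not> card J \<le> Suc 0" by simp
    then obtain a b where ab: "a \<in> J" "b \<in> J" "a \<noteq> b"
      using card_le_Suc0_iff_eq[OF 0(3)] by blast
    \<comment> \<open>Chains have fewer than \<open>k\<close> steps, so by now each of them lies
      completely in its set.\<close>
    have "z \<in> ?C j i" if "i \<in> J" for i
    proof -
      have "i \<in> J0" using that 0 by auto
      then have "n i \<in> {l. l < j + 2 \<and> l \<le> n i}" "z = c i (n i)" using c(4)[of i] c(2)[of i] 0(1) by simp_all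
      then show ?thesis by blast
    qed
    then have "z \<in> ?C j a" "z \<in> ?C j b" using ab by blast+
    then show False using increasing_sets_disjoint[OF inc _ _ ab(3)] ab by blast
  qed
next
  let ?C = "\<lambda>j i. c i ` {l. l < j + 2 \<and> l \<le> n i}"
  let ?T = "2 ^ (2 * N) :: nat"
  case (Suc r)
  show ?case
  proof
    assume inc: "increasing_sets x y J (?C j)"
    let ?J = "{i \<in> J. j + 2 \<le> n i}" and ?D = "{i \<in> J. n i < j + 2}"
    \<comment> \<open>A chain that has ended has brought \<open>z\<close> into its set. The sets are
      disjoint, so this happened at most once.\<close>
    have "card ?D \<le> 1"
    proof (rule ccontr)
      assume "\<not> card ?D \<le> 1"
      moreover have "finite ?D" using Suc.prems(3) by simp
      ultimately obtain a b where ab: "a \<in> ?D" "b \<in> ?D" "a \<noteq> b"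
        using card_le_Suc0_iff_eq[of ?D] by (metis (no_types, lifting) One_nat_def)
      have "z \<in> ?C j i" if "i \<in> ?D" for i
      proof -
        have "n i \<in> {l. l < j + 2 \<and> l \<le> n i}" "z = c i (n i)" using that c(2)[of i] Suc.prems(2) by auto
        then show ?thesis by blast
      qed
      then have "z \<in> ?C j a" "z \<in> ?C j b" using ab by blast+
      then show False using increasing_sets_disjoint[OF inc _ _ ab(3)] ab by blast
    qed
    moreover have "card J \<le> card ?J + card ?D"
    proof -
      have "J = ?J \<union> ?D" by auto
      then show ?thesis by (metis (no_types, lifting) card_Un_le)
    qed
    ultimately have cJ: "card J \<le> card ?J + 1" by linarith
    let ?M = "(4 * (?T + 3)) ^ Suc r"
    have "1 \<le> ?M" by (rule one_le_power) simp
    \<comment> \<open>The summand 3, where extending needs only 1, compensates for the chain that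
      has ended.\<close>
    moreover have "4 * (?T + 3) * ?M \<le> card J" using Suc.prems(4) by simp
    then have "4 * (Suc ?T * ?M) + 8 * ?M \<le> card J" by (simp only: algebra_simps) simp
    ultimately have card: "4 * (Suc ?T * ?M) \<le> card ?J" using cJ by linarith
    define u where "u i = c i (j + 2)" for i
    have C: "?C j i = c i ` {..<Suc (Suc j)}" if "i \<in> ?J" for i
    proof -
      have "{l. l < j + 2 \<and> l \<le> n i} = {..<Suc (Suc j)}" using that by auto
      then show ?thesis by simp
    qed
    have C': "insert (u i) (?C j i) = ?C (Suc j) i" if "i \<in> ?J" for i
    proof -
      have "{l. l < Suc j + 2 \<and> l \<le> n i} = insert (j + 2) {l. l < j + 2 \<and> l \<le> n i}" using that by auto
      then show ?thesis by (simp add: u_def)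
    qed
    have J0: "i \<in> J0" if "i \<in> ?J" for i using that Suc.prems(2) by auto
    have sep: "separates x y (u i) (?C j i)" if "i \<in> ?J" for i
    proof -
      have "c i ` {..<Suc (n i)} \<subseteq> V" "Suc (Suc j) < Suc (n i)" using c(3)[OF J0[OF that]] that by (auto simp: lessThan_Suc_atMost)
      then have "separates x y (c i (Suc (Suc j))) (c i ` {..<Suc (Suc j)})"
        using chain_separates[OF c(1)[OF J0[OF that]] _ _ inj] by blast
      then show ?thesis unfolding C[OF that] u_def by simp
    qed
    have notin: "u i \<notin> ?C j i" if "i \<in> ?J" for i
    proof -
      have "inj_on (c i) {..<Suc (n i)}" using c(1)[OF J0[OF that]] by (simp add: separating_chain_def)
      then show ?thesis using that unfolding u_def by (auto dest!: inj_onD)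
    qed
    have sub: "insert (u i) (?C j i) \<subseteq> V" if "i \<in> ?J" for i
      unfolding C'[OF that] using c(3)[OF J0[OF that]] by auto
    have incJ: "increasing_sets x y ?J (?C j)" by (rule increasing_sets_subset[OF inc]) auto
    have finJ: "finite ?J" using Suc.prems(3) by auto
    have no_chain: "\<not> (\<exists>c. separating_chain x y c k \<and> c ` {..<k} \<subseteq> V)"
      using chain_has_family_word k no_word by blast
    have no_alt: "\<not> alternation ?T V x' y' p u'"
      if "inj_on x' V" "inj_on y' V" "simple_on V x' y'" "\<not> has_family_word k V x' y'" for x' y' p u'
      using alternation_has_family_word[OF _ that(1-3) _ k N] that(4) chain_has_family_word k by blast
    have flips: "\<not> has_family_word k V y x" "\<not> has_family_word k V (\<lambda>a. - x a) (\<lambda>a. - y a)"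
      "\<not> has_family_word k V (\<lambda>a. - y a) (\<lambda>a. - x a)"
      using no_word has_family_word_swap has_family_word_uminus1[OF inj(1)] has_family_word_uminus2[OF inj(2)]
      by metis+
    have na: "\<not> alternation ?T V x y p u'" "\<not> alternation ?T V (\<lambda>a. - x a) (\<lambda>a. - y a) p u'"
      "\<not> alternation ?T V y x p u'" "\<not> alternation ?T V (\<lambda>a. - y a) (\<lambda>a. - x a) p u'" for p u'
      using no_alt[OF inj simple no_word] no_alt[OF inj_on_uminus[OF inj(1)] inj_on_uminus[OF inj(2)] _ flips(2)]
        no_alt[OF inj(2,1) _ flips(1)] no_alt[OF inj_on_uminus[OF inj(2)] inj_on_uminus[OF inj(1)] _ flips(3)]
        simple simple_on_swap[of V x y] by (auto simp: simple_on_uminus)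
    from extend_or_alternation[OF incJ finJ card inj sep notin sub]
    have "\<exists>I\<subseteq>?J. card I = ?M \<and> increasing_sets x y I (\<lambda>i. insert (u i) (?C j i))"
      by (simp only: na ex_simps simp_thms)
    then obtain I where I: "I \<subseteq> ?J" "card I = ?M" "increasing_sets x y I (\<lambda>i. insert (u i) (?C j i))"
      by (elim exE conjE)
    have "insert (u i) (?C j i) = ?C (Suc j) i" if "i \<in> I" for i
      using that I(1) C' by (meson subsetD)
    with I(3) have "increasing_sets x y I (?C (Suc j))" by (simp cong: increasing_sets_cong)
    moreover have "\<not> increasing_sets x y I (?C (Suc j))"
    proof (rule Suc.IH)
      show "k \<le> Suc j + r" using Suc.prems(1) by simp
      show "I \<subseteq> J0" using I(1) Suc.prems(2) by auto
      show "finite I" using I(1) finJ finite_subset by blast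
      show "?M \<le> card I" using I(2) by simp
    qed
    ultimately show False by blast
  qed
qed

text \<open>From the inside: \<open>2 ^ (2 * (k * k + 3))\<close> is the length of an alternation
  that suffices, the power with exponent \<open>Suc k\<close> is the number of pairs that are grown
  for \<open>k\<close> rounds, the summand 1 is their common target, and the outer power of 2
  provides a monotone subset of this size.\<close>

definition simple_bound :: "nat \<Rightarrow> nat" where
  "simple_bound k = 2 ^ (2 * (2 * (4 * (2 ^ (2 * (k * k + 3)) + 3)) ^ Suc k + 1))"

lemma increasing_has_family_word:
  assumes inj: "inj_on x V" "inj_on y V" and simple: "simple_on V x y" and k: "0 < k"
    and I: "I \<subseteq> V" "finite I" "card I = 2 * (4 * (2 ^ (2 * (k * k + 3)) + 3)) ^ Suc k + 1"
      "\<forall>p\<in>I. \<forall>r\<in>I. x p < x r \<longrightarrow> y p < y r"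
  shows "has_family_word k V x y"
proof (rule ccontr)
  assume no_word: "\<not> has_family_word k V x y"
  let ?N = "k * k + 3"
  let ?M = "(4 * (2 ^ (2 * ?N) + 3)) ^ Suc k :: nat"
  have "inj_on x I" using inj I by (auto intro: inj_on_subset)
  then obtain e where e: "bij_betw e {..<2 * ?M + 1} I" "\<And>i j. i < j \<Longrightarrow> j < 2 * ?M + 1 \<Longrightarrow> x (e i) < x (e j)"
    using enumerate_by[of I x] I by metis
  have eI: "e i \<in> I" if "i < 2 * ?M + 1" for i using e(1) that by (auto simp: bij_betw_def)
  have ey: "y (e i) < y (e j)" if "i < j" "j < 2 * ?M + 1" for i j
    using e(2)[OF that] I(4) eI that by auto
  define z where "z = e (2 * ?M)"
  have chains: "\<exists>c n. c 0 = e (2 * i) \<and> c 1 = e (2 * i + 1) \<and> c n = z \<and> 2 \<le> n \<and> separating_chain x y c (Suc n) \<and> c ` {..n} \<subseteq> V"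
    if i: "i < ?M" for i
  proof -
    have "2 * i < 2 * i + 1" "2 * i + 1 < 2 * ?M + 1" "2 * i < 2 * ?M" "2 * i + 1 < 2 * ?M" "2 * ?M < 2 * ?M + 1"
      using i by linarith+
    then have "x (e (2 * i)) < x (e (2 * i + 1))" "x (e (2 * i)) < x z" "x (e (2 * i + 1)) < x z"
      using e(2) unfolding z_def by blast+
    then have "e (2 * i) \<noteq> e (2 * i + 1)" "z \<noteq> e (2 * i)" "z \<noteq> e (2 * i + 1)" by auto
    moreover have "e (2 * i) \<in> V" "e (2 * i + 1) \<in> V" "z \<in> V" using eI I(1) i unfolding z_def by auto
    ultimately show ?thesis using chain_reaches[OF simple inj, of "e (2 * i)" "e (2 * i + 1)" z] by metis
  qed
  obtain c n where c: "\<And>i. i < ?M \<Longrightarrow> c i 0 = e (2 * i) \<and> c i 1 = e (2 * i + 1) \<and> c i (n i) = z \<and> 2 \<le> n i \<and>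
      separating_chain x y (c i) (Suc (n i)) \<and> c i ` {..n i} \<subseteq> V"
    using chains by metis
  have nk: "n i < k" if "i < ?M" for i
  proof (rule ccontr)
    assume "\<not> n i < k"
    then have "separating_chain x y (c i) k" "c i ` {..<k} \<subseteq> V"
      using chain_prefix[of x y "c i" "Suc (n i)" k] c[OF that] by auto
    then show False using chain_has_family_word k no_word by blast
  qed
  have C: "c i ` {l. l < 0 + 2 \<and> l \<le> n i} = {e (2 * i), e (2 * i + 1)}" if "i < ?M" for i
  proof -
    have "{l. l < 0 + 2 \<and> l \<le> n i} = {0, 1}" using c[OF that] by auto
    then show ?thesis using c[OF that] by simp
  qed
  have "below x y {e (2 * i), e (2 * i + 1)} {e (2 * j), e (2 * j + 1)}" if "i < j" "j < ?M" for i j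
    using that e(2) ey by (auto simp: below_def)
  then have "increasing_sets x y {..<?M} (\<lambda>i. {e (2 * i), e (2 * i + 1)})"
    unfolding increasing_sets_def by (metis lessThan_iff linorder_neqE_nat)
  then have "increasing_sets x y {..<?M} (\<lambda>i. c i ` {l. l < 0 + 2 \<and> l \<le> n i})"
    using C unfolding increasing_sets_def by simp
  moreover have "\<not> increasing_sets x y {..<?M} (\<lambda>i. c i ` {l. l < 0 + 2 \<and> l \<le> n i})"
    by (rule increasing_chains_have_family_word[OF inj simple k, of ?N "{..<?M}" c n z]) (use c nk no_word in auto)
  ultimately show False by blast
qed

lemma large_simple_has_family_word:
  assumes "finite V" "inj_on x V" "inj_on y V" "simple_on V x y" "0 < k" "simple_bound k \<le> card V"
  shows "has_family_word k V x y"
proof -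
  let ?M = "2 * (4 * (2 ^ (2 * (k * k + 3)) + 3)) ^ Suc k + 1 :: nat"
  have "2 ^ (?M + ?M) \<le> card V" using assms(6) unfolding simple_bound_def by (simp add: mult_2[symmetric])
  from monotone_subset[OF assms(1-3) this]
  show ?thesis
  proof (elim disjE exE conjE)
    fix I assume I: "I \<subseteq> V" "card I = ?M" "\<forall>p\<in>I. \<forall>r\<in>I. x p < x r \<longrightarrow> y p < y r"
    have "finite I" using I(1) assms(1) by (rule finite_subset)
    then show ?thesis using increasing_has_family_word assms(2-5) I by blast
  next
    fix I assume I: "I \<subseteq> V" "card I = ?M" "\<forall>p\<in>I. \<forall>r\<in>I. x p < x r \<longrightarrow> y r < y p"
    have "finite I" using I(1) assms(1) by (rule finite_subset)
    moreover have "\<forall>p\<in>I. \<forall>r\<in>I. x p < x r \<longrightarrow> - y p < - y r" using I(3) by auto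
    moreover have "simple_on V x (\<lambda>a. - y a)" using assms(4) by (simp add: simple_on_uminus)
    ultimately have "has_family_word k V x (\<lambda>a. - y a)"
      using increasing_has_family_word[OF assms(2) inj_on_uminus[OF assms(3)] _ assms(5) I(1) _ I(2)] by blast
    then show ?thesis using has_family_word_uminus2[OF assms(3)] by blast
  qed
qed

section \<open>Pumping\<close>

text \<open>The type of an increasing tuple of indices below \<open>t\<close> records the letters, and for each index whether
  the next one (or \<open>t\<close>, for the last one) is its successor.\<close>

definition tuple_type :: "(nat \<Rightarrow> letter) \<Rightarrow> nat \<Rightarrow> nat list \<Rightarrow> (letter \<times> bool) list" where
  "tuple_type w t js = map (\<lambda>i. (w (js ! i), (js @ [t]) ! Suc i = Suc (js ! i))) [0..<length js]"

definition tuple_types :: "nat \<Rightarrow> (nat \<Rightarrow> letter) \<Rightarrow> nat \<Rightarrow> (letter \<times> bool) list set" where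
  "tuple_types m w t = {tuple_type w t js | js. sorted_wrt (<) js \<and> set js \<subseteq> {..<t} \<and> length js \<le> m}"

text \<open>The effect of lengthening the prefix by an index that is not selected: the last selected
  index is no longer adjacent to the end.\<close>

definition clear_last :: "(letter \<times> bool) list \<Rightarrow> (letter \<times> bool) list" where
  "clear_last \<tau> = map (\<lambda>i. (fst (\<tau> ! i), snd (\<tau> ! i) \<and> Suc i < length \<tau>)) [0..<length \<tau>]"

lemma length_tuple_type [simp]: "length (tuple_type w t js) = length js"
  by (simp add: tuple_type_def)

lemma nth_tuple_type: "i < length js \<Longrightarrow> tuple_type w t js ! i = (w (js ! i), (js @ [t]) ! Suc i = Suc (js ! i))"
  by (simp add: tuple_type_def)

lemma tuple_type_snoc:
  "tuple_type w (Suc t) (js @ [t]) = tuple_type w t js @ [(w t, True)]"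
  by (rule nth_equalityI) (auto simp: nth_tuple_type nth_append less_Suc_eq)

lemma tuple_type_Suc:
  assumes "set js \<subseteq> {..<t}"
  shows "tuple_type w (Suc t) js = clear_last (tuple_type w t js)"
proof (rule nth_equalityI)
  fix i assume "i < length (tuple_type w (Suc t) js)"
  then have i: "i < length js" by simp
  then have "js ! i < t" using assms nth_mem by blast
  then show "tuple_type w (Suc t) js ! i = clear_last (tuple_type w t js) ! i"
    using i by (auto simp: nth_tuple_type clear_last_def nth_append)
qed (simp add: clear_last_def)

text \<open>The set of types of a prefix and the next letter determine the set of types of the
  longer prefix. So these sets act as the states of a finite automaton, with \<open>t\<close>
  entering only through its letter.\<close>

lemma tuple_types_Suc:
  "tuple_types m w (Suc t) =
     {\<tau> @ [(w t, True)] | \<tau>. \<tau> \<in> tuple_types m w t \<and> length \<tau> < m} \<union> clear_last ` tuple_types m w t"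
    (is "_ = ?A \<union> ?B")
proof (intro equalityI subsetI)
  fix \<tau> assume "\<tau> \<in> tuple_types m w (Suc t)"
  then obtain js where js: "\<tau> = tuple_type w (Suc t) js" "sorted_wrt (<) js" "set js \<subseteq> {..<Suc t}" "length js \<le> m"
    by (auto simp: tuple_types_def)
  show "\<tau> \<in> ?A \<union> ?B"
  proof (cases "t \<in> set js")
    case True
    then obtain ks a where ks: "js = ks @ [a]" by (cases js rule: rev_cases) auto
    then have "a = t" "sorted_wrt (<) ks" "set ks \<subseteq> {..<t}"
      using js True by (auto simp: sorted_wrt_append less_Suc_eq)
    then have "tuple_type w t ks \<in> tuple_types m w t" using js ks unfolding tuple_types_def by auto
    then show ?thesis using js ks \<open>a = t\<close> by (auto simp: tuple_type_snoc)
  next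
    case False
    then have "set js \<subseteq> {..<t}" using js(3) by (auto simp: less_Suc_eq)
    then show ?thesis using js tuple_type_Suc[of js t w] by (auto simp: tuple_types_def)
  qed
next
  fix \<tau> assume "\<tau> \<in> ?A \<union> ?B"
  then show "\<tau> \<in> tuple_types m w (Suc t)"
  proof
    assume "\<tau> \<in> ?A"
    then obtain js where js: "\<tau> = tuple_type w t js @ [(w t, True)]" "sorted_wrt (<) js" "set js \<subseteq> {..<t}" "length js < m"
      by (auto simp: tuple_types_def)
    then have "sorted_wrt (<) (js @ [t])" "set (js @ [t]) \<subseteq> {..<Suc t}" "length (js @ [t]) \<le> m"
      by (auto simp: sorted_wrt_append)
    then show ?thesis unfolding tuple_types_def js(1) tuple_type_snoc[symmetric] by blast
  next
    assume "\<tau> \<in> ?B"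
    then obtain js where js: "\<tau> = clear_last (tuple_type w t js)" "sorted_wrt (<) js" "set js \<subseteq> {..<t}" "length js \<le> m"
      by (auto simp: tuple_types_def)
    moreover from this have "set js \<subseteq> {..<Suc t}" by auto
    ultimately show ?thesis unfolding tuple_types_def by (auto simp: tuple_type_Suc[symmetric])
  qed
qed

text \<open>There are 16 letters, thus 32 letters with an adjacency bit. The power of 33 is a closed
  form bounding the geometric sum of powers of 32.\<close>

lemma card_tuple_types: "card (Pow {\<tau> :: (letter \<times> bool) list. length \<tau> \<le> m}) \<le> 2 ^ (33 ^ m)"
  and finite_tuple_types: "finite {\<tau> :: (letter \<times> bool) list. length \<tau> \<le> m}"
proof -
  have eq: "{\<tau> :: (letter \<times> bool) list. length \<tau> \<le> m} = {\<tau>. set \<tau> \<subseteq> UNIV \<and> length \<tau> \<le> m}" by simp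
  show fin: "finite {\<tau> :: (letter \<times> bool) list. length \<tau> \<le> m}"
    unfolding eq by (rule finite_lists_length_le) simp
  have "card (UNIV :: (letter \<times> bool) set) = 32" 
    by (simp add: UNIV_Times_UNIV[symmetric] card_cartesian_product del: UNIV_Times_UNIV)
  then have "card {\<tau> :: (letter \<times> bool) list. length \<tau> \<le> m} = (\<Sum>i\<le>m. 32 ^ i)"
    unfolding eq by (subst card_lists_length_le) simp_all
  also have "\<dots> \<le> 33 ^ m"
  proof (induction m)
    case (Suc m)
    have "(32::nat) ^ Suc m \<le> 32 * 33 ^ m" by (simp add: power_mono)
    then show ?case using Suc by simp
  qed simp
  finally show "card (Pow {\<tau> :: (letter \<times> bool) list. length \<tau> \<le> m}) \<le> 2 ^ (33 ^ m)"
    using fin by (simp add: card_Pow)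
qed

text \<open>One more than the bound for the number of states, for the pigeonhole principle.\<close>

definition word_length :: "nat \<Rightarrow> nat" where
  "word_length m = 2 ^ (33 ^ m) + 1"

text \<open>Among the first prefixes of \<open>w\<close> two have the same types of tuples, and the part between them can be
  repeated forever.\<close>

lemma pumping:
  fixes w :: "nat \<Rightarrow> letter"
  obtains w' where "w' 0 = w 0"
    "\<And>js. sorted_wrt (<) js \<Longrightarrow> length js \<le> m \<Longrightarrow> \<exists>js'. sorted_wrt (<) js' \<and> set js' \<subseteq> {..<word_length m} \<and>
       length js' = length js \<and> (\<forall>i<length js. w' (js ! i) = w (js' ! i)) \<and>
       (\<forall>i j. i < j \<longrightarrow> j < length js \<longrightarrow> (js ! j = Suc (js ! i)) = (js' ! j = Suc (js' ! i)))"
proof -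
  let ?K = "word_length m"
  have "\<not> inj_on (tuple_types m w) {1..?K}"
  proof
    assume "inj_on (tuple_types m w) {1..?K}"
    moreover have "tuple_types m w ` {1..?K} \<subseteq> Pow {\<tau>. length \<tau> \<le> m}" by (auto simp: tuple_types_def)
    ultimately have "card {1..?K} \<le> card (Pow {\<tau> :: (letter \<times> bool) list. length \<tau> \<le> m})"
      by (rule card_inj_on_le) (simp add: finite_tuple_types)
    then show False using card_tuple_types[of m] by (simp add: word_length_def)
  qed
  then have "\<exists>s t. s \<in> {1..?K} \<and> t \<in> {1..?K} \<and> s \<noteq> t \<and> tuple_types m w s = tuple_types m w t"
    unfolding inj_on_def by blast
  then obtain s t where st: "0 < s" "s < t" "t \<le> ?K" "tuple_types m w s = tuple_types m w t"
    by (metis One_nat_def Suc_le_lessD atLeastAtMost_iff linorder_neqE_nat)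
  \<comment> \<open>The path through the automaton: on reaching \<open>t\<close> it returns to the
    equivalent \<open>s\<close>. By \<open>types\<close>, the first \<open>i\<close> letters of the
    new word have the same tuples as the first \<open>\<rho> i\<close> letters of
    \<open>w\<close>.\<close>
  define \<rho> where "\<rho> = rec_nat 0 (\<lambda>_ r. if Suc r = t then s else Suc r)"
  have \<rho>: "\<rho> 0 = 0" "\<rho> (Suc i) = (if Suc (\<rho> i) = t then s else Suc (\<rho> i))" for i by (simp_all add: \<rho>_def)
  have \<rho>t: "\<rho> i < t" for i by (induction i) (use st \<rho> in auto)
  let ?w = "\<lambda>i. w (\<rho> i)"
  have types: "tuple_types m ?w i = tuple_types m w (\<rho> i)" for i
  proof (induction i)
    case 0 then show ?case by (simp add: tuple_types_def \<rho> tuple_type_def)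
  next
    case (Suc i)
    have "tuple_types m w (Suc (\<rho> i)) = tuple_types m w (\<rho> (Suc i))" using st by (simp add: \<rho>)
    then show ?case using Suc by (simp only: tuple_types_Suc)
  qed
  show ?thesis
  proof (rule that[of ?w])
    show "w (\<rho> 0) = w 0" by (simp add: \<rho>)
    fix js :: "nat list" assume js: "sorted_wrt (<) js" "length js \<le> m"
    obtain u where u: "set js \<subseteq> {..<u}" using finite_nat_set_iff_bounded[of "set js"] by auto
    then have "tuple_type ?w u js \<in> tuple_types m w (\<rho> u)" using js types[of u] by (auto simp: tuple_types_def)
    then obtain js' where js': "tuple_type ?w u js = tuple_type w (\<rho> u) js'" "sorted_wrt (<) js'" "set js' \<subseteq> {..<\<rho> u}"
      by (auto simp: tuple_types_def)
    have len: "length js' = length js" using arg_cong[OF js'(1), of length] by simp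
    have nth: "w (\<rho> (js ! i)) = w (js' ! i) \<and> ((js @ [u]) ! Suc i = Suc (js ! i)) = ((js' @ [\<rho> u]) ! Suc i = Suc (js' ! i))"
      if "i < length js" for i
      using arg_cong[OF js'(1), of "\<lambda>l. l ! i"] that len by (simp add: nth_tuple_type)
    have "(js ! j = Suc (js ! i)) = (js' ! j = Suc (js' ! i))" if ij: "i < j" "j < length js" for i j
    proof (cases "j = Suc i")
      case True
      then show ?thesis using nth[of i] ij len by (simp add: nth_append)
    next
      case False
      then have "Suc i < j" using ij by auto
      then have "js ! i < js ! Suc i" "js ! Suc i < js ! j" "js' ! i < js' ! Suc i" "js' ! Suc i < js' ! j"
        using ij len js(1) js'(2) by (auto simp: sorted_wrt_iff_nth_less)
      then show ?thesis by auto
    qed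
    moreover have "set js' \<subseteq> {..<?K}" using js'(3) \<rho>t[of u] st(3) by auto
    ultimately show "\<exists>js'. sorted_wrt (<) js' \<and> set js' \<subseteq> {..<?K} \<and> length js' = length js \<and>
        (\<forall>i<length js. w (\<rho> (js ! i)) = w (js' ! i)) \<and>
        (\<forall>i j. i < j \<longrightarrow> j < length js \<longrightarrow> (js ! j = Suc (js ! i)) = (js' ! j = Suc (js' ! i)))"
      using js'(2) len nth by (intro exI[of _ js'] conjI) auto
  qed
qed

text \<open>The comparison that the letters prescribe for any two positions. For a pumped word it
  must still be shown to be a linear order.\<close>

definition word_less :: "word_rel \<Rightarrow> (nat \<Rightarrow> letter) \<Rightarrow> nat \<Rightarrow> nat \<Rightarrow> bool" where
  "word_less R w i j \<longleftrightarrow> (if i < j then R (w i) (w j) (j = Suc i) else j < i \<and> \<not> R (w j) (w i) (i = Suc j))"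

text \<open>A finite strict linear order is represented by ranks. This supplies integer coordinates
  for pumped words.\<close>

lemma rank_less_iff:
  fixes r :: "nat \<Rightarrow> nat \<Rightarrow> bool"
  assumes irrefl: "\<And>i. \<not> r i i" and total: "\<And>i j. i < L \<Longrightarrow> j < L \<Longrightarrow> i \<noteq> j \<Longrightarrow> r i j \<or> r j i"
    and trans: "\<And>i j k. i < L \<Longrightarrow> j < L \<Longrightarrow> k < L \<Longrightarrow> r i j \<Longrightarrow> r j k \<Longrightarrow> r i k"
    and ij: "i < L" "j < L"
  shows "card {l. l < L \<and> r l i} < card {l. l < L \<and> r l j} \<longleftrightarrow> r i j"
proof -
  have less: "card {l. l < L \<and> r l i} < card {l. l < L \<and> r l j}" if "r i j" "i < L" "j < L" for i j
  proof (rule psubset_card_mono)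
    have "{l. l < L \<and> r l i} \<subseteq> {l. l < L \<and> r l j}" using trans that by blast
    moreover have "i \<in> {l. l < L \<and> r l j}" "i \<notin> {l. l < L \<and> r l i}" using irrefl that by auto
    ultimately show "{l. l < L \<and> r l i} \<subset> {l. l < L \<and> r l j}" by blast
  qed simp
  show ?thesis
  proof
    assume l: "card {l. l < L \<and> r l i} < card {l. l < L \<and> r l j}"
    then have "i \<noteq> j" by auto
    then have "r i j \<or> r j i" using total ij by blast
    moreover have "\<not> r j i" using less[of j i] ij l by auto
    ultimately show "r i j" by blast
  qed (use less ij in blast)
qed

text \<open>All words obtained by pumping are realised by points, since transitivity only concerns
  triples of points.\<close>

lemma amplify:
  assumes word: "has_family_word (word_length m) V x y" and inj: "inj_on x V" "inj_on y V"
    and m: "3 \<le> m" and L: "6 \<le> L"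
  obtains U x' y' where "U \<subseteq> {..<L}" "L - 2 \<le> card U" "simple_on U x' y'" "inj_on x' U" "inj_on y' U"
    "\<And>Z. Z \<subseteq> U \<Longrightarrow> card Z \<le> m \<Longrightarrow> \<exists>f. f ` Z \<subseteq> V \<and>
       (\<forall>i\<in>Z. \<forall>j\<in>Z. (x' i < x' j) = (x (f i) < x (f j)) \<and> (y' i < y' j) = (y (f i) < y (f j)))"
proof -
  let ?K = "word_length m"
  obtain RX RY l0 E ws p where fam: "nearly_simple_family RX RY l0 E" and ws: "length ws = ?K" "local_word l0 E ws"
    and p: "p ` {..<?K} \<subseteq> V" "inj_on p {..<?K}" "realizes RX RY ws x y p"
    using word unfolding has_family_word_def by (elim exE conjE) (rule that)
  define w where "w i = ws ! i" for i
  obtain w' where w'0: "w' 0 = w 0" and pump: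
    "\<And>js. sorted_wrt (<) js \<Longrightarrow> length js \<le> m \<Longrightarrow> \<exists>js'. sorted_wrt (<) js' \<and> set js' \<subseteq> {..<?K} \<and>
       length js' = length js \<and> (\<forall>i<length js. w' (js ! i) = w (js' ! i)) \<and>
       (\<forall>i j. i < j \<longrightarrow> j < length js \<longrightarrow> (js ! j = Suc (js ! i)) = (js' ! j = Suc (js' ! i)))"
    by (rule pumping[of w m]) (rule that)
  have tuple: "\<exists>f. (\<forall>i\<in>Z. f i < ?K \<and> w' i = w (f i)) \<and>
      (\<forall>i\<in>Z. \<forall>j\<in>Z. i < j \<longrightarrow> f i < f j \<and> (j = Suc i) = (f j = Suc (f i)))"
    if Z: "finite Z" "card Z \<le> m" for Z
  proof -
    let ?js = "sorted_list_of_set Z"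
    have js: "sorted_wrt (<) ?js" "length ?js \<le> m" "set ?js = Z"
      using Z by (auto simp: strict_sorted_iff)
    obtain js' where js': "sorted_wrt (<) js'" "set js' \<subseteq> {..<?K}" "length js' = length ?js"
      "\<forall>i<length ?js. w' (?js ! i) = w (js' ! i)"
      "\<forall>i j. i < j \<longrightarrow> j < length ?js \<longrightarrow> (?js ! j = Suc (?js ! i)) = (js' ! j = Suc (js' ! i))"
      using pump[OF js(1,2)] by (elim exE conjE) (rule that)
    have "\<forall>i\<in>Z. \<exists>idx. idx < length ?js \<and> ?js ! idx = i"
      using js(3) by (metis in_set_conv_nth)
    from bchoice[OF this] obtain idx where idx: "\<And>i. i \<in> Z \<Longrightarrow> idx i < length ?js" "\<And>i. i \<in> Z \<Longrightarrow> ?js ! idx i = i"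
      by blast
    let ?f = "\<lambda>i. js' ! idx i"
    have "?f i < ?K \<and> w' i = w (?f i)" if "i \<in> Z" for i
      using idx[OF that] js'(2,3,4) nth_mem[of "idx i" js'] by fastforce
    moreover have "?f i < ?f j \<and> (j = Suc i) = (?f j = Suc (?f i))" if ij: "i \<in> Z" "j \<in> Z" "i < j" for i j
    proof -
      have "\<not> idx j \<le> idx i"
      proof
        assume "idx j \<le> idx i"
        then have "?js ! idx j \<le> ?js ! idx i" using idx(1)[OF ij(1)] by (intro sorted_nth_mono) auto
        then show False using idx(2) ij by auto
      qed
      then have l: "idx i < idx j" "idx j < length ?js" using idx(1) ij by auto
      then have "js' ! idx i < js' ! idx j" using js'(1,3) by (auto simp: sorted_wrt_iff_nth_less)
      moreover have "(?js ! idx j = Suc (?js ! idx i)) = (js' ! idx j = Suc (js' ! idx i))" using js'(5) l by blast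
      ultimately show ?thesis using idx(2) ij by simp
    qed
    ultimately show ?thesis by (intro exI[of _ ?f] conjI ballI impI) blast+
  qed
  have ne: "x (p i) \<noteq> x (p j)" "y (p i) \<noteq> y (p j)" if "i < ?K" "j < ?K" "i \<noteq> j" for i j
  proof -
    have "p i \<in> V" "p j \<in> V" "p i \<noteq> p j" using p(1,2) that by (auto dest: inj_onD)
    then show "x (p i) \<noteq> x (p j)" "y (p i) \<noteq> y (p j)" using inj by (auto dest: inj_onD)
  qed
  have rel: "word_less RX w i j = (x (p i) < x (p j))" "word_less RY w i j = (y (p i) < y (p j))"
    if ij: "i < ?K" "j < ?K" for i j
  proof -
    have r: "(x (p a) < x (p b)) = RX (w a) (w b) (b = Suc a) \<and> (y (p a) < y (p b)) = RY (w a) (w b) (b = Suc a)"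
      if "a < b" "b < ?K" for a b
      using p(3)[unfolded realizes_def, rule_format, of b a] that ws(1) by (simp add: w_def)
    have "word_less RX w i j = (x (p i) < x (p j)) \<and> word_less RY w i j = (y (p i) < y (p j))"
    proof (cases i j rule: linorder_cases)
      case less
      then show ?thesis using r[OF less ij(2)] by (simp add: word_less_def)
    next
      case greater
      then have "x (p i) \<noteq> x (p j)" "y (p i) \<noteq> y (p j)" using ne[OF ij] by auto
      then show ?thesis using r[OF greater ij(1)] greater by (auto simp: word_less_def)
    qed (simp add: word_less_def)
    then show "word_less RX w i j = (x (p i) < x (p j))" "word_less RY w i j = (y (p i) < y (p j))"
      by blast+
  qed
  \<comment> \<open>Few points of the pumped word always look like points of \<open>V\<close>. This
    yields transitivity here and avoidance of the basis later.\<close>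
  have emb: "\<exists>f. f ` Z \<subseteq> V \<and> (\<forall>i\<in>Z. \<forall>j\<in>Z. word_less RX w' i j = (x (f i) < x (f j)) \<and>
      word_less RY w' i j = (y (f i) < y (f j)))" if Z: "finite Z" "card Z \<le> m" for Z
  proof -
    obtain f where f: "\<forall>i\<in>Z. f i < ?K \<and> w' i = w (f i)"
      "\<forall>i\<in>Z. \<forall>j\<in>Z. i < j \<longrightarrow> f i < f j \<and> (j = Suc i) = (f j = Suc (f i))"
      using tuple[OF Z] by (elim exE conjE) (rule that)
    have wl: "word_less R w' i j = word_less R w (f i) (f j)" if "i \<in> Z" "j \<in> Z" for R i j
    proof (cases i j rule: linorder_cases)
      case less
      then have "f i < f j" "(j = Suc i) = (f j = Suc (f i))" using f(2) that by blast+
      then show ?thesis using less f(1) that by (simp add: word_less_def)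
    next
      case greater
      then have "f j < f i" "(i = Suc j) = (f i = Suc (f j))" using f(2) that by blast+
      then show ?thesis using greater f(1) that by (simp add: word_less_def)
    qed (simp add: word_less_def)
    show ?thesis
    proof (intro exI[of _ "p \<circ> f"] conjI ballI)
      show "(p \<circ> f) ` Z \<subseteq> V" using f(1) p(1) by auto
      fix i j assume ij: "i \<in> Z" "j \<in> Z"
      then have "f i < ?K" "f j < ?K" using f(1) by auto
      then show "word_less RX w' i j = (x ((p \<circ> f) i) < x ((p \<circ> f) j))"
        "word_less RY w' i j = (y ((p \<circ> f) i) < y ((p \<circ> f) j))"
        using wl[OF ij] rel[of "f i" "f j"] by simp_all
    qed
  qed
  have irrefl: "\<not> word_less R w' i i" for R i by (simp add: word_less_def)
  have total: "word_less R w' i j \<or> word_less R w' j i" if "i \<noteq> j" for R i j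
    using that by (auto simp: word_less_def)
  have trans: "word_less RX w' i j \<Longrightarrow> word_less RX w' j k \<Longrightarrow> word_less RX w' i k"
    "word_less RY w' i j \<Longrightarrow> word_less RY w' j k \<Longrightarrow> word_less RY w' i k" for i j k
  proof -
    have "card {i, j, k} \<le> 3" by (simp add: card_insert_if)
    then have "card {i, j, k} \<le> m" using m by linarith
    then obtain f where f: "\<forall>i'\<in>{i, j, k}. \<forall>j'\<in>{i, j, k}. word_less RX w' i' j' = (x (f i') < x (f j')) \<and>
      word_less RY w' i' j' = (y (f i') < y (f j'))"
      using emb[of "{i, j, k}"] by (elim meta_impE exE conjE) (simp, assumption, rule that)
    show "word_less RX w' i j \<Longrightarrow> word_less RX w' j k \<Longrightarrow> word_less RX w' i k"
      "word_less RY w' i j \<Longrightarrow> word_less RY w' j k \<Longrightarrow> word_less RY w' i k"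
      using f[rule_format, of i j] f[rule_format, of j k] f[rule_format, of i k] by simp_all
  qed
  define x' where "x' i = int (card {l. l < L \<and> word_less RX w' l i})" for i
  define y' where "y' i = int (card {l. l < L \<and> word_less RY w' l i})" for i
  have x': "(x' i < x' j) = word_less RX w' i j" if "i < L" "j < L" for i j
    unfolding x'_def of_nat_less_iff
    by (rule rank_less_iff) (rule irrefl | erule total | erule (1) trans(1) | rule that)+
  have y': "(y' i < y' j) = word_less RY w' i j" if "i < L" "j < L" for i j
    unfolding y'_def of_nat_less_iff
    by (rule rank_less_iff) (rule irrefl | erule total | erule (1) trans(2) | rule that)+
  have inj': "inj_on x' {..<L}" "inj_on y' {..<L}"
  proof -
    have "x' i \<noteq> x' j \<and> y' i \<noteq> y' j" if "i < L" "j < L" "i \<noteq> j" for i j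
      using total[OF that(3), of RX] total[OF that(3), of RY] x'[OF that(1,2)] x'[OF that(2,1)]
        y'[OF that(1,2)] y'[OF that(2,1)] by auto
    then show "inj_on x' {..<L}" "inj_on y' {..<L}" by (auto intro!: inj_onI)
  qed
  let ?ws = "map w' [0..<L]"
  have "local_word l0 E ?ws"
    unfolding local_word_def
  proof (intro conjI allI impI)
    show "?ws \<noteq> []" using L by auto
    show "?ws ! 0 = l0" using L ws(2) w'0 by (simp add: local_word_def w_def)
    fix i assume "Suc i < length ?ws"
    then have i: "Suc i < L" by simp
    have "card {i, Suc i} \<le> m" "finite {i, Suc i}" using m by simp_all
    then obtain f where f: "\<forall>i'\<in>{i, Suc i}. f i' < ?K \<and> w' i' = w (f i')"
      "\<forall>i'\<in>{i, Suc i}. \<forall>j'\<in>{i, Suc i}. i' < j' \<longrightarrow> f i' < f j' \<and> (j' = Suc i') = (f j' = Suc (f i'))"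
      using tuple[of "{i, Suc i}"] by (elim meta_impE exE conjE) (assumption, assumption, rule that)
    \<comment> \<open>Adjacent positions come from adjacent positions of the original word, also
      where the pumped word jumps back, so their letters form an edge.\<close>
    have s: "f (Suc i) = Suc (f i)" using f(2)[rule_format, of i "Suc i"] by simp
    moreover have "Suc (f i) < ?K" using f(1)[rule_format, of "Suc i"] s by simp
    ultimately have "(w (f i), w (f (Suc i))) \<in> E" using ws by (simp add: local_word_def w_def)
    then show "(?ws ! i, ?ws ! Suc i) \<in> E" using f(1) i by simp
  qed
  moreover have "realizes RX RY ?ws x' y' id"
    using x' y' by (auto simp: realizes_def word_less_def)
  ultimately have "\<exists>U\<subseteq>{..<L}. L - 2 \<le> card U \<and> simple_on U x' y'"
    using fam[unfolded nearly_simple_family_def, rule_format, of ?ws x' y'] L inj' by simp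
  then obtain U where U: "U \<subseteq> {..<L}" "L - 2 \<le> card U" "simple_on U x' y'" by blast
  show ?thesis
  proof (rule that[OF U])
    show "inj_on x' U" "inj_on y' U" using inj' U(1) by (auto intro: inj_on_subset)
    fix Z assume Z: "Z \<subseteq> U" "card Z \<le> m"
    then have ZL: "i < L" if "i \<in> Z" for i using that U(1) by auto
    have "finite Z" using Z(1) U(1) by (meson finite_lessThan finite_subset)
    then obtain f where "f ` Z \<subseteq> V" "\<forall>i\<in>Z. \<forall>j\<in>Z. word_less RX w' i j = (x (f i) < x (f j)) \<and>
      word_less RY w' i j = (y (f i) < y (f j))"
      using emb[OF _ Z(2)] by (elim meta_impE exE conjE) (assumption, rule that)
    then show "\<exists>f. f ` Z \<subseteq> V \<and>
       (\<forall>i\<in>Z. \<forall>j\<in>Z. (x' i < x' j) = (x (f i) < x (f j)) \<and> (y' i < y' j) = (y (f i) < y (f j)))"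
      using x' y' ZL by (intro exI[of _ f]) simp
  qed
qed

section \<open>Permutations\<close>

lemma perms_iff: "\<pi> \<in> perms \<longleftrightarrow> distinct \<pi> \<and> set \<pi> = {1..length \<pi>}"
proof
  assume "\<pi> \<in> perms"
  then obtain n where n: "distinct \<pi>" "set \<pi> = {1..n}" by (auto simp: perms_def permutations_of_set_def)
  then have "length \<pi> = n" using distinct_card[of \<pi>] by simp
  then show "distinct \<pi> \<and> set \<pi> = {1..length \<pi>}" using n by simp
qed (auto simp: perms_def permutations_of_set_def)

lemma finite_perms_length: "finite {\<pi> \<in> perms. length \<pi> \<le> n}"
proof (rule finite_subset)
  show "{\<pi> \<in> perms. length \<pi> \<le> n} \<subseteq> {\<pi>. set \<pi> \<subseteq> {1..n} \<and> length \<pi> \<le> n}"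
    by (auto simp: perms_iff)
qed (rule finite_lists_length_le, simp)

section \<open>Containment in terms of index maps\<close>

lemma subseq_index:
  assumes "subseq \<tau> \<sigma>"
  shows "\<exists>h. (\<forall>i<length \<tau>. h i < length \<sigma> \<and> \<tau> ! i = \<sigma> ! h i) \<and> (\<forall>i j. i < j \<longrightarrow> j < length \<tau> \<longrightarrow> h i < (h j :: nat))"
  using assms
proof (induction rule: list_emb.induct)
  case (list_emb_Nil ys)
  then show ?case by simp
next
  case (list_emb_Cons xs ys y)
  then obtain h where "(\<forall>i<length xs. h i < length ys \<and> xs ! i = ys ! h i) \<and> (\<forall>i j. i < j \<longrightarrow> j < length xs \<longrightarrow> h i < (h j :: nat))"
    by blast
  then show ?case by (intro exI[of _ "\<lambda>i. Suc (h i)"]) auto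
next
  case (list_emb_Cons2 x y xs ys)
  then obtain h where "(\<forall>i<length xs. h i < length ys \<and> xs ! i = ys ! h i) \<and> (\<forall>i j. i < j \<longrightarrow> j < length xs \<longrightarrow> h i < (h j :: nat))"
    by blast
  then show ?case using list_emb_Cons2
    by (intro exI[of _ "\<lambda>i. case i of 0 \<Rightarrow> 0 | Suc l \<Rightarrow> Suc (h l)"]) (auto split: nat.splits simp: less_Suc_eq_0_disj)
qed

lemma subseq_map_nth:
  assumes "sorted_wrt (<) js" "\<forall>j\<in>set js. j < u" "u \<le> length \<sigma>"
  shows "subseq (map ((!) \<sigma>) js) (take u \<sigma>)"
  using assms
proof (induction js arbitrary: u rule: rev_induct)
  case (snoc a js)
  then have "subseq (map ((!) \<sigma>) js) (take a \<sigma>)" by (intro snoc.IH) (auto simp: sorted_wrt_append)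
  then have "subseq (map ((!) \<sigma>) js @ [\<sigma> ! a]) (take a \<sigma> @ [\<sigma> ! a])" by (simp add: list_emb_append_mono)
  also have "take a \<sigma> @ [\<sigma> ! a] = take (Suc a) \<sigma>" using snoc.prems by (simp add: take_Suc_conv_app_nth)
  also have "subseq \<dots> (take u \<sigma>)"
  proof -
    have "take u \<sigma> = take (Suc a) \<sigma> @ drop (Suc a) (take u \<sigma>)"
      using snoc.prems append_take_drop_id[of "Suc a" "take u \<sigma>"] by (simp add: min_def)
    then show ?thesis by (metis subseq_rev_drop_many subseq_order.order_refl)
  qed
  finally show ?case by simp
qed simp

lemma perm_contained_iff:
  "\<beta> \<preceq> \<sigma> \<longleftrightarrow> (\<exists>h. (\<forall>i<length \<beta>. h i < length \<sigma>) \<and> (\<forall>i j. i < j \<longrightarrow> j < length \<beta> \<longrightarrow> h i < h j) \<and>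
     (\<forall>i<length \<beta>. \<forall>j<length \<beta>. (\<beta> ! i < \<beta> ! j) = (\<sigma> ! h i < \<sigma> ! h j)))"
proof
  assume "\<beta> \<preceq> \<sigma>"
  then obtain \<tau> where \<tau>: "subseq \<tau> \<sigma>" "order_isomorphic \<tau> \<beta>" by (auto simp: perm_contained_def)
  obtain h where "(\<forall>i<length \<tau>. h i < length \<sigma> \<and> \<tau> ! i = \<sigma> ! h i) \<and> (\<forall>i j. i < j \<longrightarrow> j < length \<tau> \<longrightarrow> h i < (h j :: nat))"
    using subseq_index[OF \<tau>(1)] by blast
  then show "\<exists>h. (\<forall>i<length \<beta>. h i < length \<sigma>) \<and> (\<forall>i j. i < j \<longrightarrow> j < length \<beta> \<longrightarrow> h i < h j) \<and>
     (\<forall>i<length \<beta>. \<forall>j<length \<beta>. (\<beta> ! i < \<beta> ! j) = (\<sigma> ! h i < \<sigma> ! h j))"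
    using \<tau>(2) by (intro exI[of _ h]) (auto simp: order_isomorphic_def)
next
  assume "\<exists>h. (\<forall>i<length \<beta>. h i < length \<sigma>) \<and> (\<forall>i j. i < j \<longrightarrow> j < length \<beta> \<longrightarrow> h i < h j) \<and>
     (\<forall>i<length \<beta>. \<forall>j<length \<beta>. (\<beta> ! i < \<beta> ! j) = (\<sigma> ! h i < \<sigma> ! h j))"
  then obtain h where h: "\<forall>i<length \<beta>. h i < length \<sigma>" "\<forall>i j. i < j \<longrightarrow> j < length \<beta> \<longrightarrow> h i < h j"
     "\<forall>i<length \<beta>. \<forall>j<length \<beta>. (\<beta> ! i < \<beta> ! j) = (\<sigma> ! h i < \<sigma> ! h j)" by blast
  let ?js = "map h [0..<length \<beta>]"
  have "subseq (map ((!) \<sigma>) ?js) (take (length \<sigma>) \<sigma>)"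
    using h by (intro subseq_map_nth) (auto simp: sorted_wrt_iff_nth_less)
  moreover have "order_isomorphic (map ((!) \<sigma>) ?js) \<beta>" using h(3) by (simp add: order_isomorphic_def)
  ultimately show "\<beta> \<preceq> \<sigma>" by (auto simp: perm_contained_def)
qed

section \<open>Permutations as point sets\<close>

abbreviation perm_y :: "nat list \<Rightarrow> nat \<Rightarrow> int" where "perm_y \<pi> i \<equiv> int (\<pi> ! i)"

lemma inj_on_perm_y: "\<pi> \<in> perms \<Longrightarrow> inj_on (perm_y \<pi>) {..<length \<pi>}"
  by (auto simp: perms_iff inj_on_def nth_eq_iff_index_eq)

text \<open>A set that no outside point separates is convex in positions and among the values that
  occur. Since all of the numbers from 1 to the length occur as values, convex means
  consecutive.\<close>

lemma simple_perm_iff: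
  assumes "\<pi> \<in> perms"
  shows "simple_perm \<pi> \<longleftrightarrow> simple_on {..<length \<pi>} int (perm_y \<pi>)"
proof
  let ?V = "{..<length \<pi>}"
  have \<pi>: "distinct \<pi>" "set \<pi> = {1..length \<pi>}" using assms by (auto simp: perms_iff)
  show "simple_on ?V int (perm_y \<pi>)" if s: "simple_perm \<pi>"
    unfolding simple_on_def
  proof (intro allI impI)
    fix I assume I: "interval_in ?V int (perm_y \<pi>) I" "\<exists>a\<in>I. \<exists>b\<in>I. a \<noteq> b"
    have IV: "I \<subseteq> ?V" using I(1) by (simp add: interval_in_def)
    then have fin: "finite I" using finite_subset by blast
    have ne: "I \<noteq> {}" using I(2) by auto
    have "I = {Min I..Max I}"
    proof (intro equalityI subsetI)
      fix v assume v: "v \<in> {Min I..Max I}"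
      have MM: "Min I \<in> I" "Max I \<in> I" using fin ne by auto
      show "v \<in> I"
      proof (cases "v = Min I \<or> v = Max I")
        case False
        then have "int (Min I) < int v \<and> int v < int (Max I)" using v by auto
        moreover have "v \<in> ?V" using v MM(2) IV by auto
        ultimately show ?thesis using interval_in_between[OF I(1) _ MM] by blast
      qed (use MM in auto)
    qed (use fin in auto)
    moreover have "(!) \<pi> ` I = {Min ((!) \<pi> ` I)..Max ((!) \<pi> ` I)}"
    proof (intro equalityI subsetI)
      let ?Y = "(!) \<pi> ` I"
      fix c assume c: "c \<in> {Min ?Y..Max ?Y}"
      have MM: "Min ?Y \<in> ?Y" "Max ?Y \<in> ?Y" using fin ne by auto
      then obtain a b where ab: "a \<in> I" "b \<in> I" "\<pi> ! a = Min ?Y" "\<pi> ! b = Max ?Y" by (metis imageE)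
      show "c \<in> ?Y"
      proof (cases "c = Min ?Y \<or> c = Max ?Y")
        case False
        have "\<pi> ! a \<in> set \<pi>" "\<pi> ! b \<in> set \<pi>" using ab(1,2) IV by auto
        then have "c \<in> set \<pi>" using c ab(3,4) unfolding \<pi>(2) by auto
        then obtain v where v: "v < length \<pi>" "\<pi> ! v = c" by (auto simp: in_set_conv_nth)
        have "perm_y \<pi> a < perm_y \<pi> v \<and> perm_y \<pi> v < perm_y \<pi> b" using False c ab v by auto
        then have "v \<in> I" using interval_in_between[OF I(1) _ ab(1,2)] v by blast
        then show ?thesis using v by auto
      qed (use MM in auto)
    qed (use fin in auto)
    ultimately have "perm_interval \<pi> I" using IV unfolding perm_interval_def by blast
    then have "card I \<in> {0, 1, length \<pi>}" using s by (auto simp: simple_perm_def)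
    moreover have "card I \<noteq> 0" using fin ne by auto
    moreover have "card I \<noteq> 1" using I(2) by (auto simp: card_1_singleton_iff)
    ultimately have "card I = card ?V" by auto
    then show "I = ?V" using IV by (intro card_subset_eq) auto
  qed
  show "simple_perm \<pi>" if s: "simple_on ?V int (perm_y \<pi>)"
    unfolding simple_perm_def
  proof (intro conjI allI impI)
    fix I assume I: "perm_interval \<pi> I"
    then obtain a b c d where ab: "I = {a..b}" "(!) \<pi> ` I = {c..d}" and IV: "I \<subseteq> ?V"
      unfolding perm_interval_def by blast
    have m: "interval_in ?V int (perm_y \<pi>) I"
      unfolding interval_in_def
    proof (intro conjI ballI notI)
      fix v assume v: "v \<in> ?V - I" "separates int (perm_y \<pi>) v I"
      from v(2) consider p q where "p \<in> I" "q \<in> I" "p < v" "v < q"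
        | p q where "p \<in> I" "q \<in> I" "\<pi> ! p < \<pi> ! v" "\<pi> ! v < \<pi> ! q"
        unfolding separates_def by auto
      then show False
      proof cases
        case 1 then show False using v(1) ab(1) by auto
      next
        case 2
        have "\<pi> ! p \<in> {c..d}" "\<pi> ! q \<in> {c..d}" using 2(1,2) ab(2) by blast+
        then have "\<pi> ! v \<in> {c..d}" using 2(3,4) by auto
        then obtain u where "u \<in> I" "\<pi> ! v = \<pi> ! u" using ab(2) by (metis imageE)
        then have "u = v" using \<pi>(1) v(1) IV by (auto simp: nth_eq_iff_index_eq)
        then show False using \<open>u \<in> I\<close> v(1) by auto
      qed
    qed (use IV in auto)
    show "card I \<in> {0, 1, length \<pi>}"
    proof (rule ccontr)
      assume c: "card I \<notin> {0, 1, length \<pi>}"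
      have fin: "finite I" using IV finite_subset by blast
      have "card I \<noteq> 0" "card I \<noteq> 1" using c by simp_all
      then have "\<not> card I \<le> Suc 0" by linarith
      then have "\<exists>a\<in>I. \<exists>b\<in>I. a \<noteq> b" using card_le_Suc0_iff_eq[OF fin] by blast
      then have "I = ?V" using s m unfolding simple_on_def by blast
      then show False using c by simp
    qed
  qed (rule assms)
qed

text \<open>Standardisation: positions come from the order by \<open>x\<close>, values from the
  ranks by \<open>y\<close>.\<close>

lemma perm_of_points:
  fixes x y :: "'a \<Rightarrow> int"
  assumes "finite U" "inj_on x U" "inj_on y U"
  obtains \<sigma> g where "\<sigma> \<in> perms" "length \<sigma> = card U" "bij_betw g {..<card U} U"
    "\<And>i j. i < card U \<Longrightarrow> j < card U \<Longrightarrow> (i < j) = (x (g i) < x (g j)) \<and> (\<sigma> ! i < \<sigma> ! j) = (y (g i) < y (g j))"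
proof -
  obtain g where g: "bij_betw g {..<card U} U" "\<And>i j. i < j \<Longrightarrow> j < card U \<Longrightarrow> x (g i) < x (g j)"
    by (rule enumerate_by[OF assms(1,2)]) (rule that)
  define r where "r a = card {v \<in> U. y v < y a}" for a
  have r: "r a < r b" if "a \<in> U" "b \<in> U" "y a < y b" for a b
    unfolding r_def using that assms(1) by (intro psubset_card_mono) auto
  have r': "(r a < r b) = (y a < y b)" if ab: "a \<in> U" "b \<in> U" for a b
    using r[OF ab] r[OF ab(2,1)] assms(3) ab by (cases "y a" "y b" rule: linorder_cases) (auto dest: inj_onD)
  have gU: "g i \<in> U" if "i < card U" for i using g(1) that by (auto simp: bij_betw_def)
  define \<sigma> where "\<sigma> = map (\<lambda>i. Suc (r (g i))) [0..<card U]"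
  have len: "length \<sigma> = card U" by (simp add: \<sigma>_def)
  have "inj_on (\<lambda>i. Suc (r (g i))) {..<card U}"
  proof (rule inj_onI)
    fix i j assume ij: "i \<in> {..<card U}" "j \<in> {..<card U}" "Suc (r (g i)) = Suc (r (g j))"
    then have "y (g i) = y (g j)" using r'[of "g i" "g j"] r'[of "g j" "g i"] gU by auto
    then have "g i = g j" using assms(3) gU ij by (auto dest: inj_onD)
    then show "i = j" using g(1) ij by (auto simp: bij_betw_def dest: inj_onD)
  qed
  then have dist: "distinct \<sigma>" by (simp add: \<sigma>_def distinct_map lessThan_atLeast0)
  have "set \<sigma> \<subseteq> {1..card U}"
  proof
    fix v assume "v \<in> set \<sigma>"
    then obtain i where i: "i < card U" "v = Suc (r (g i))" by (auto simp: \<sigma>_def)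
    have "r (g i) < card U" unfolding r_def using gU[OF i(1)] assms(1) by (intro psubset_card_mono) auto
    then show "v \<in> {1..card U}" using i by auto
  qed
  then have "set \<sigma> = {1..card U}" using dist len by (intro card_subset_eq) (auto simp: distinct_card)
  then have "\<sigma> \<in> perms" using dist len by (simp add: perms_iff)
  moreover have "(i < j) = (x (g i) < x (g j)) \<and> (\<sigma> ! i < \<sigma> ! j) = (y (g i) < y (g j))"
    if ij: "i < card U" "j < card U" for i j
  proof -
    have "(i < j) = (x (g i) < x (g j))"
      using g(2)[of i j] g(2)[of j i] ij by (cases i j rule: linorder_cases) auto
    moreover have "(\<sigma> ! i < \<sigma> ! j) = (y (g i) < y (g j))" using ij r'[OF gU[OF ij(1)] gU[OF ij(2)]] by (simp add: \<sigma>_def)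
    ultimately show ?thesis ..
  qed
  ultimately show ?thesis using that len g(1) by blast
qed

lemma simple_on_transfer:
  assumes s: "simple_on U x y" and g: "bij_betw g W U"
    and xy: "\<And>i j. i \<in> W \<Longrightarrow> j \<in> W \<Longrightarrow> (x' i < x' j) = (x (g i) < x (g j)) \<and> (y' i < y' j) = (y (g i) < y (g j))"
  shows "simple_on W x' y'"
  unfolding simple_on_def
proof (intro allI impI)
  fix I assume I: "interval_in W x' y' I" "\<exists>a\<in>I. \<exists>b\<in>I. a \<noteq> b"
  have IW: "I \<subseteq> W" using I(1) by (simp add: interval_in_def)
  have inj: "inj_on g W" and im: "g ` W = U" using g by (auto simp: bij_betw_def)
  have "interval_in U x y (g ` I)"
    unfolding interval_in_def
  proof (intro conjI ballI notI)
    show "g ` I \<subseteq> U" using IW im by auto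
    fix v assume v: "v \<in> U - g ` I" "separates x y v (g ` I)"
    then obtain w where w: "w \<in> W" "w \<notin> I" "v = g w" using im by auto
    have "separates x' y' w I"
      using v(2) xy IW w unfolding separates_def by (auto, blast+)
    then show False using I(1) w by (auto simp: interval_in_def)
  qed
  moreover have "\<exists>a\<in>g ` I. \<exists>b\<in>g ` I. a \<noteq> b" using I(2) inj IW by (metis imageI inj_onD subsetD)
  ultimately have "g ` I = U" using s unfolding simple_on_def by blast
  then show "I = W" using inj IW im inj_on_image_eq_iff[of g W I W] by simp
qed

text \<open>An occurrence of a basis element uses at most \<open>m\<close> points of the pumped
  word, and these look like points of \<open>\<pi>\<close>. Two points of the \<open>L\<close> may
  be lost in passing to a simple subset.\<close>

lemma large_simple_gives_all_lengths:
  assumes B: "\<forall>\<beta>\<in>B. length \<beta> \<le> m" and m: "3 \<le> m"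
    and \<pi>: "\<pi> \<in> Av B" "simple_perm \<pi>" "simple_bound (word_length m) \<le> length \<pi>" and L: "6 \<le> L"
  shows "\<exists>\<sigma>\<in>Av B. simple_perm \<sigma> \<and> L - 2 \<le> length \<sigma> \<and> length \<sigma> \<le> L"
proof -
  let ?V = "{..<length \<pi>}"
  have \<pi>p: "\<pi> \<in> perms" using \<pi>(1) by (simp add: Av_def)
  have inj: "inj_on int ?V" "inj_on (perm_y \<pi>) ?V" using inj_on_perm_y[OF \<pi>p] by auto
  have simple: "simple_on ?V int (perm_y \<pi>)" using simple_perm_iff[OF \<pi>p] \<pi>(2) by simp
  have "0 < word_length m" by (simp add: word_length_def)
  then have word: "has_family_word (word_length m) ?V int (perm_y \<pi>)"
    using large_simple_has_family_word[OF _ inj simple] \<pi>(3) by simp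
  obtain U x y where U: "U \<subseteq> {..<L}" "L - 2 \<le> card U" "simple_on U x y" "inj_on x U" "inj_on y U"
    and emb: "\<And>Z. Z \<subseteq> U \<Longrightarrow> card Z \<le> m \<Longrightarrow> \<exists>f. f ` Z \<subseteq> ?V \<and>
       (\<forall>i\<in>Z. \<forall>j\<in>Z. (x i < x j) = (int (f i) < int (f j)) \<and> (y i < y j) = (perm_y \<pi> (f i) < perm_y \<pi> (f j)))"
    by (rule amplify[OF word inj m L]) (rule that)
  have finU: "finite U" using U(1) finite_subset by blast
  obtain \<sigma> g where \<sigma>: "\<sigma> \<in> perms" "length \<sigma> = card U" "bij_betw g {..<card U} U"
    and ord: "\<And>i j. i < card U \<Longrightarrow> j < card U \<Longrightarrow> (i < j) = (x (g i) < x (g j)) \<and> (\<sigma> ! i < \<sigma> ! j) = (y (g i) < y (g j))"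
    by (rule perm_of_points[OF finU U(4,5)]) (rule that)
  have "simple_on {..<length \<sigma>} int (perm_y \<sigma>)"
    using simple_on_transfer[OF U(3) \<sigma>(3), of int "perm_y \<sigma>"] ord \<sigma>(2) by auto
  then have "simple_perm \<sigma>" using simple_perm_iff[OF \<sigma>(1)] by simp
  moreover have "\<not> \<beta> \<preceq> \<sigma>" if \<beta>: "\<beta> \<in> B" for \<beta>
  proof
    assume "\<beta> \<preceq> \<sigma>"
    then obtain h where h: "\<forall>i<length \<beta>. h i < length \<sigma>" "\<forall>i j. i < j \<longrightarrow> j < length \<beta> \<longrightarrow> h i < h j"
      "\<forall>i<length \<beta>. \<forall>j<length \<beta>. (\<beta> ! i < \<beta> ! j) = (\<sigma> ! h i < \<sigma> ! h j)"
      unfolding perm_contained_iff by blast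
    let ?Z = "(\<lambda>i. g (h i)) ` {..<length \<beta>}"
    have gU: "g i \<in> U" if "i < card U" for i using \<sigma>(3) that by (auto simp: bij_betw_def)
    have "?Z \<subseteq> U" using h(1) gU \<sigma>(2) by auto
    moreover have "card ?Z \<le> m"
      using card_image_le[of "{..<length \<beta>}" "\<lambda>i. g (h i)"] B \<beta> by fastforce
    ultimately obtain f where f: "f ` ?Z \<subseteq> ?V"
      "\<forall>i\<in>?Z. \<forall>j\<in>?Z. (x i < x j) = (int (f i) < int (f j)) \<and> (y i < y j) = (perm_y \<pi> (f i) < perm_y \<pi> (f j))"
      using emb[of ?Z] by (elim meta_impE exE conjE) (assumption, assumption, blast)
    let ?h = "\<lambda>i. f (g (h i))"
    have "\<forall>i<length \<beta>. ?h i < length \<pi>" using f(1) by auto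
    moreover have "?h i < ?h j" if ij: "i < j" "j < length \<beta>" for i j
    proof -
      have "h i < h j" "h i < card U" "h j < card U" using h(1,2) ij \<sigma>(2) by auto
      then have "x (g (h i)) < x (g (h j))" using ord by blast
      moreover have "g (h i) \<in> ?Z" "g (h j) \<in> ?Z" using ij by auto
      ultimately show ?thesis using f(2) by auto
    qed
    moreover have "(\<beta> ! i < \<beta> ! j) = (\<pi> ! ?h i < \<pi> ! ?h j)" if ij: "i < length \<beta>" "j < length \<beta>" for i j
    proof -
      have "h i < card U" "h j < card U" using h(1) ij \<sigma>(2) by auto
      then have "(\<sigma> ! h i < \<sigma> ! h j) = (y (g (h i)) < y (g (h j)))" using ord by blast
      moreover have "g (h i) \<in> ?Z" "g (h j) \<in> ?Z" using ij by auto
      then have "(y (g (h i)) < y (g (h j))) = (perm_y \<pi> (?h i) < perm_y \<pi> (?h j))" using f(2) by blast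
      ultimately show ?thesis using h(3) ij by auto
    qed
    ultimately have "\<beta> \<preceq> \<pi>" unfolding perm_contained_iff by (intro exI[of _ ?h]) blast
    then show False using \<pi>(1) \<beta> by (auto simp: Av_def)
  qed
  moreover have "card U \<le> L" using card_mono[of "{..<L}" U] U(1) by simp
  ultimately show ?thesis using \<sigma>(1,2) U(2) by (intro bexI[of _ \<sigma>]) (auto simp: Av_def)
qed

lemma infinite_simple_iff:
  assumes B: "\<forall>\<beta>\<in>B. length \<beta> \<le> m" and m: "3 \<le> m" and N: "N = simple_bound (word_length m)"
  shows "infinite {\<pi> \<in> Av B. simple_perm \<pi>} \<longleftrightarrow> (\<exists>\<pi>\<in>Av B. simple_perm \<pi> \<and> N \<le> length \<pi> \<and> length \<pi> \<le> N + 2)"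
proof
  assume inf: "infinite {\<pi> \<in> Av B. simple_perm \<pi>}"
  have "\<exists>\<pi>\<in>Av B. simple_perm \<pi> \<and> N < length \<pi>"
  proof (rule ccontr)
    assume "\<not> ?thesis"
    then have "{\<pi> \<in> Av B. simple_perm \<pi>} \<subseteq> {\<pi> \<in> perms. length \<pi> \<le> N}" by (auto simp: Av_def not_less)
    then show False using inf finite_perms_length finite_subset by blast
  qed
  then obtain \<pi> where \<pi>: "\<pi> \<in> Av B" "simple_perm \<pi>" "N \<le> length \<pi>" by auto
  \<comment> \<open>The pumping lemma will be applied with \<open>L = N + 2\<close>, so that its
    window begins at \<open>N\<close>; it requires \<open>6 \<le> L\<close>.\<close>
  have "2 ^ 2 \<le> N" unfolding N simple_bound_def by (intro power_increasing) auto
  then have "6 \<le> N + 2" by simp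
  from large_simple_gives_all_lengths[OF B m \<pi>[unfolded N] this]
  show "\<exists>\<pi>\<in>Av B. simple_perm \<pi> \<and> N \<le> length \<pi> \<and> length \<pi> \<le> N + 2" by simp
next
  assume "\<exists>\<pi>\<in>Av B. simple_perm \<pi> \<and> N \<le> length \<pi> \<and> length \<pi> \<le> N + 2"
  then obtain \<pi> where \<pi>: "\<pi> \<in> Av B" "simple_perm \<pi>" "simple_bound (word_length m) \<le> length \<pi>" using N by auto
  show "infinite {\<pi> \<in> Av B. simple_perm \<pi>}"
  proof
    assume "finite {\<pi> \<in> Av B. simple_perm \<pi>}"
    then have fin: "finite (length ` {\<pi> \<in> Av B. simple_perm \<pi>})" by simp
    let ?b = "Max (length ` {\<pi> \<in> Av B. simple_perm \<pi>})"
    \<comment> \<open>The value \<open>?b + 9\<close> is at least 6 and exceeds \<open>?b\<close>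
      even after the loss of two points.\<close>
    obtain \<sigma> where "\<sigma> \<in> Av B" "simple_perm \<sigma>" "?b + 9 - 2 \<le> length \<sigma>"
      using large_simple_gives_all_lengths[OF B m \<pi>, of "?b + 9"] by auto
    moreover from this have "length \<sigma> \<le> ?b" using fin by (intro Max_ge) auto
    ultimately show False by simp
  qed
qed

section \<open>Recursive functions\<close>

text \<open>Since \<open>recf\<close> carries no arities, the number of arguments is fixed
  here.\<close>

definition recursive_fn :: "nat \<Rightarrow> (nat list \<Rightarrow> nat) \<Rightarrow> bool" where
  "recursive_fn n f \<longleftrightarrow> (\<exists>g. \<forall>xs. length xs = n \<longrightarrow> computes g xs (f xs))"

definition recursive_pred :: "nat \<Rightarrow> (nat list \<Rightarrow> bool) \<Rightarrow> bool" where
  "recursive_pred n P \<longleftrightarrow> recursive_fn n (\<lambda>xs. if P xs then 1 else 0)"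

text \<open>Variables are de Bruijn indices: \<open>arg 0\<close> is the variable bound last. A free variable \<open>i\<close> under one
  more binder is \<open>arg i (tl ys) = arg (Suc i) ys\<close>.\<close>

definition arg :: "nat \<Rightarrow> nat list \<Rightarrow> nat" where
  "arg i xs = (if i < length xs then xs ! i else 0)"

lemma arg_tl: "arg i (tl xs) = arg (Suc i) xs"
  by (cases xs) (auto simp: arg_def)

lemma arg_Cons [simp]: "arg 0 (x # xs) = x" "arg (Suc i) (x # xs) = arg i xs"
  by (auto simp: arg_def)

lemma recursive_fn_cong:
  assumes "recursive_fn n f" "\<And>xs. length xs = n \<Longrightarrow> f xs = g xs"
  shows "recursive_fn n g"
  using assms unfolding recursive_fn_def by metis

lemma recursive_fn_arg: "recursive_fn n (arg i)"
proof (cases "i < n")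
  case True
  then have "\<forall>xs. length xs = n \<longrightarrow> computes (Proj i) xs (arg i xs)"
    by (auto simp: arg_def intro: computes.Proj)
  then show ?thesis unfolding recursive_fn_def by blast
next
  case False
  then have "\<forall>xs. length xs = n \<longrightarrow> computes Zero xs (arg i xs)"
    by (auto simp: arg_def intro: computes.Zero)
  then show ?thesis unfolding recursive_fn_def by blast
qed

lemma recursive_fn_comp:
  assumes "recursive_fn (length fs) h" "\<forall>f\<in>set fs. recursive_fn n f"
  shows "recursive_fn n (\<lambda>xs. h (map (\<lambda>f. f xs) fs))"
proof -
  obtain g where g: "\<And>xs. length xs = length fs \<Longrightarrow> computes g xs (h xs)"
    using assms(1) unfolding recursive_fn_def by blast
  have "\<forall>f\<in>set fs. \<exists>g. \<forall>xs. length xs = n \<longrightarrow> computes g xs (f xs)"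
    using assms(2) unfolding recursive_fn_def by blast
  from bchoice[OF this] obtain G where G: "\<forall>f\<in>set fs. \<forall>xs. length xs = n \<longrightarrow> computes (G f) xs (f xs)" ..
  have "computes (Comp g (map G fs)) xs (h (map (\<lambda>f. f xs) fs))" if "length xs = n" for xs
    by (rule computes.Comp[of "map (\<lambda>f. f xs) fs"]) (use that G g in auto)
  then show ?thesis unfolding recursive_fn_def by blast
qed

lemma recursive_fn_args:
  assumes "recursive_fn (length js) h"
  shows "recursive_fn n (\<lambda>xs. h (map (\<lambda>i. arg i xs) js))"
  using recursive_fn_comp[of "map arg js" h n] assms by (simp add: recursive_fn_arg o_def)

lemma map_arg: "length xs = n \<Longrightarrow> map (\<lambda>i. arg i xs) [0..<n] = xs"
  by (rule nth_equalityI) (auto simp: arg_def)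

lemma map_arg_tl: "length xs = Suc n \<Longrightarrow> map (\<lambda>i. arg i xs) [Suc 0..<Suc n] = tl xs"
  by (rule nth_equalityI) (simp_all add: arg_def nth_tl del: upt_Suc)

lemma recursive_fn_tl:
  assumes "recursive_fn n f" shows "recursive_fn (Suc n) (\<lambda>xs. f (tl xs))"
  by (rule recursive_fn_cong[OF recursive_fn_args[of "[Suc 0..<Suc n]" f]]) (use assms in \<open>auto simp: map_arg_tl simp del: upt_Suc\<close>)

lemma recursive_fn_subst:
  assumes "recursive_fn (Suc n) h" "recursive_fn n a"
  shows "recursive_fn n (\<lambda>xs. h (a xs # xs))"
proof (rule recursive_fn_cong)
  show "recursive_fn n (\<lambda>xs. h (map (\<lambda>f. f xs) (a # map arg [0..<n])))"
    by (rule recursive_fn_comp) (use assms recursive_fn_arg in auto)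
qed (simp add: o_def map_arg)

lemma recursive_fn_Suc: "recursive_fn n f \<Longrightarrow> recursive_fn n (\<lambda>xs. Suc (f xs))"
proof -
  assume f: "recursive_fn n f"
  have "recursive_fn (length [f]) (\<lambda>xs. Suc (hd xs))"
    unfolding recursive_fn_def by (rule exI[of _ Succ]) (auto simp: length_Suc_conv intro: computes.Succ)
  from recursive_fn_comp[OF this] f show ?thesis by auto
qed

lemma recursive_fn_const: "recursive_fn n (\<lambda>_. c)"
proof (induction c)
  case 0 show ?case unfolding recursive_fn_def by (auto intro: computes.Zero)
qed (rule recursive_fn_Suc)

text \<open>The step is stated through \<open>arg\<close> and \<open>tl\<close> on one list of
  counter, accumulator and parameters, so that the closure rules apply to it again.\<close>

lemma recursive_fn_rec:
  assumes a: "recursive_fn n a" and b: "recursive_fn n b"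
    and s: "recursive_fn (Suc (Suc n)) (\<lambda>ys. s (arg 0 ys) (arg 1 ys) (tl (tl ys)))"
  shows "recursive_fn n (\<lambda>xs. rec_nat (b xs) (\<lambda>i r. s i r xs) (a xs))"
proof -
  obtain gb where gb: "\<And>xs. length xs = n \<Longrightarrow> computes gb xs (b xs)"
    using b unfolding recursive_fn_def by blast
  obtain gs where gs: "\<And>ys. length ys = Suc (Suc n) \<Longrightarrow> computes gs ys (s (arg 0 ys) (arg 1 ys) (tl (tl ys)))"
    using s unfolding recursive_fn_def by blast
  have "computes (PrimRec gb gs) (k # xs) (rec_nat (b xs) (\<lambda>i r. s i r xs) k)" if "length xs = n" for k xs
  proof (induction k)
    case 0 then show ?case using gb[OF that] by (auto intro: computes.PrimRec_0)
  next
    case (Suc k)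
    have "computes gs (k # rec_nat (b xs) (\<lambda>i r. s i r xs) k # xs) (rec_nat (b xs) (\<lambda>i r. s i r xs) (Suc k))"
      using gs[of "k # rec_nat (b xs) (\<lambda>i r. s i r xs) k # xs"] that by simp
    then show ?case using Suc by (rule computes.PrimRec_Suc[rotated])
  qed
  then have "\<forall>ys. length ys = Suc n \<longrightarrow> computes (PrimRec gb gs) ys (rec_nat (b (tl ys)) (\<lambda>i r. s i r (tl ys)) (hd ys))"
    by (auto simp: length_Suc_conv)
  then have "recursive_fn (Suc n) (\<lambda>ys. rec_nat (b (tl ys)) (\<lambda>i r. s i r (tl ys)) (hd ys))"
    unfolding recursive_fn_def by blast
  from recursive_fn_subst[OF this a] show ?thesis by simp
qed

section \<open>Arithmetic\<close>

lemma recursive_fn_add: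
  assumes "recursive_fn n a" "recursive_fn n b" shows "recursive_fn n (\<lambda>xs. a xs + b xs)"
proof -
  have "rec_nat y (\<lambda>_ r. Suc r) x = x + y" for x y :: nat by (induction x) auto
  moreover have "recursive_fn n (\<lambda>xs. rec_nat (b xs) (\<lambda>_ r. Suc r) (a xs))"
    by (rule recursive_fn_rec[OF assms, of "\<lambda>_ r _. Suc r"]) (intro recursive_fn_Suc recursive_fn_arg)
  ultimately show ?thesis by simp
qed

lemma recursive_fn_mult:
  assumes "recursive_fn n a" "recursive_fn n b" shows "recursive_fn n (\<lambda>xs. a xs * b xs)"
proof -
  have "rec_nat 0 (\<lambda>_ r. r + y) x = x * y" for x y :: nat by (induction x) auto
  moreover have "recursive_fn n (\<lambda>xs. rec_nat 0 (\<lambda>_ r. r + b xs) (a xs))"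
    by (rule recursive_fn_rec[OF assms(1) recursive_fn_const, of "\<lambda>_ r xs. r + b xs"])
      (intro recursive_fn_add recursive_fn_arg recursive_fn_tl assms)
  ultimately show ?thesis by simp
qed

lemma recursive_fn_power:
  assumes "recursive_fn n a" "recursive_fn n b" shows "recursive_fn n (\<lambda>xs. a xs ^ b xs)"
proof -
  have "rec_nat 1 (\<lambda>_ r. r * y) x = y ^ x" for x y :: nat by (induction x) auto
  moreover have "recursive_fn n (\<lambda>xs. rec_nat 1 (\<lambda>_ r. r * a xs) (b xs))"
    by (rule recursive_fn_rec[OF assms(2) recursive_fn_const, of "\<lambda>_ r xs. r * a xs"])
      (intro recursive_fn_mult recursive_fn_arg recursive_fn_tl assms)
  ultimately show ?thesis by simp
qed

lemma recursive_fn_diff: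
  assumes "recursive_fn n a" "recursive_fn n b" shows "recursive_fn n (\<lambda>xs. a xs - b xs)"
proof -
  have pred: "recursive_fn m (\<lambda>xs. f xs - 1)" if "recursive_fn m f" for m f
  proof -
    have "rec_nat 0 (\<lambda>i _. i) x = x - 1" for x :: nat by (cases x) auto
    moreover have "recursive_fn m (\<lambda>xs. rec_nat 0 (\<lambda>i _. i) (f xs))"
      by (rule recursive_fn_rec[OF that recursive_fn_const, of "\<lambda>i _ _. i"]) (intro recursive_fn_arg)
    ultimately show ?thesis by simp
  qed
  have "rec_nat y (\<lambda>_ r. r - 1) x = y - x" for x y :: nat by (induction x) auto
  moreover have "recursive_fn n (\<lambda>xs. rec_nat (a xs) (\<lambda>_ r. r - 1) (b xs))"
    by (rule recursive_fn_rec[OF assms(2,1), of "\<lambda>_ r _. r - 1"]) (intro pred recursive_fn_arg)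
  ultimately show ?thesis by simp
qed

section \<open>Connectives, bounded quantifiers and search\<close>

lemma recursive_pred_not: "recursive_pred n P \<Longrightarrow> recursive_pred n (\<lambda>xs. \<not> P xs)"
  unfolding recursive_pred_def
  by (drule recursive_fn_diff[OF recursive_fn_const[of n 1]], erule recursive_fn_cong) simp

lemma recursive_pred_conj: "recursive_pred n P \<Longrightarrow> recursive_pred n Q \<Longrightarrow> recursive_pred n (\<lambda>xs. P xs \<and> Q xs)"
  unfolding recursive_pred_def by (drule (1) recursive_fn_mult, erule recursive_fn_cong) simp

lemma recursive_pred_disj: "recursive_pred n P \<Longrightarrow> recursive_pred n Q \<Longrightarrow> recursive_pred n (\<lambda>xs. P xs \<or> Q xs)"
  using recursive_pred_not[OF recursive_pred_conj[OF recursive_pred_not recursive_pred_not], of n P Q] by simp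

lemma recursive_pred_imp: "recursive_pred n P \<Longrightarrow> recursive_pred n Q \<Longrightarrow> recursive_pred n (\<lambda>xs. P xs \<longrightarrow> Q xs)"
  unfolding imp_conv_disj by (intro recursive_pred_disj recursive_pred_not)

lemma recursive_pred_iff: "recursive_pred n P \<Longrightarrow> recursive_pred n Q \<Longrightarrow> recursive_pred n (\<lambda>xs. P xs \<longleftrightarrow> Q xs)"
  unfolding iff_conv_conj_imp by (intro recursive_pred_conj recursive_pred_imp)

lemma recursive_pred_less:
  assumes "recursive_fn n a" "recursive_fn n b" shows "recursive_pred n (\<lambda>xs. a xs < b xs)"
  unfolding recursive_pred_def
  by (rule recursive_fn_cong[OF recursive_fn_diff[OF recursive_fn_const[of n 1]
        recursive_fn_diff[OF recursive_fn_Suc[OF assms(1)] assms(2)]]]) auto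

lemma recursive_pred_le:
  assumes "recursive_fn n a" "recursive_fn n b" shows "recursive_pred n (\<lambda>xs. a xs \<le> b xs)"
  using recursive_pred_not[OF recursive_pred_less[OF assms(2,1)]] by (simp add: not_less)

lemma recursive_pred_eq:
  assumes "recursive_fn n a" "recursive_fn n b" shows "recursive_pred n (\<lambda>xs. a xs = b xs)"
  unfolding order_eq_iff by (intro recursive_pred_conj recursive_pred_le assms)

lemma recursive_pred_bex:
  assumes b: "recursive_fn n b" and P: "recursive_pred (Suc n) (\<lambda>ys. P (arg 0 ys) (tl ys))"
  shows "recursive_pred n (\<lambda>xs. \<exists>z<b xs. P z xs)"
proof -
  \<comment> \<open>In the recursion the accumulator stands at index 1, between the counter and the
    parameters. These indices leave it out before \<open>P\<close> is evaluated.\<close>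
  let ?js = "0 # [Suc (Suc 0)..<Suc (Suc n)]"
  have js: "map (\<lambda>i. arg i ys) ?js = arg 0 ys # tl (tl ys)" if "length ys = Suc (Suc n)" for ys
    using that by (auto simp: arg_def nth_tl simp del: upt_Suc intro!: nth_equalityI)
  have "recursive_fn (length ?js) (\<lambda>ys. if P (arg 0 ys) (tl ys) then 1 else 0)"
    using P by (simp add: recursive_pred_def Suc_diff_le del: upt_Suc)
  from recursive_fn_args[OF this, of "Suc (Suc n)"]
  have "recursive_fn (Suc (Suc n)) (\<lambda>ys. if P (arg 0 ys) (tl (tl ys)) then 1 else 0)"
    by (rule recursive_fn_cong) (simp only: js arg_Cons list.sel)
  then have "recursive_pred (Suc (Suc n)) (\<lambda>ys. arg 1 ys = 1 \<or> P (arg 0 ys) (tl (tl ys)))"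
    by (intro recursive_pred_disj recursive_pred_eq recursive_fn_arg recursive_fn_const)
      (simp add: recursive_pred_def)
  then have "recursive_fn n (\<lambda>xs. rec_nat 0 (\<lambda>i r. if r = 1 \<or> P i xs then 1 else 0) (b xs))"
    unfolding recursive_pred_def
    by (intro recursive_fn_rec[OF b recursive_fn_const, of "\<lambda>i r xs. if r = 1 \<or> P i xs then 1 else 0"])
  moreover have "rec_nat 0 (\<lambda>i r. if r = 1 \<or> P i xs then 1 else 0) k = (if \<exists>z<k. P z xs then 1 else (0::nat))" for k xs
    by (induction k) (auto simp: less_Suc_eq)
  ultimately show ?thesis unfolding recursive_pred_def by simp
qed

lemma recursive_pred_ball:
  assumes "recursive_fn n b" "recursive_pred (Suc n) (\<lambda>ys. P (arg 0 ys) (tl ys))"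
  shows "recursive_pred n (\<lambda>xs. \<forall>z<b xs. P z xs)"
  using recursive_pred_not[OF recursive_pred_bex[OF assms(1) recursive_pred_not[OF assms(2)]]] by simp

text \<open>Minimisation stops at the value 0, so it is applied to the negated predicate; the
  assumption \<open>ex\<close> makes it terminate.\<close>

lemma recursive_fn_Least:
  assumes P: "recursive_pred (Suc n) (\<lambda>ys. P (arg 0 ys) (tl ys))" and ex: "\<And>xs. length xs = n \<Longrightarrow> \<exists>z. P z xs"
  shows "recursive_fn n (\<lambda>xs. LEAST z. P z xs)"
proof -
  obtain g where g: "\<And>ys. length ys = Suc n \<Longrightarrow> computes g ys (if \<not> P (arg 0 ys) (tl ys) then 1 else 0)"
    using recursive_pred_not[OF P] unfolding recursive_pred_def recursive_fn_def by blast
  have "computes (Mu g) xs (LEAST z. P z xs)" if xs: "length xs = n" for xs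
  proof (rule computes.Mu)
    have *: "computes g (z # xs) (if \<not> P z xs then 1 else 0)" for z using g[of "z # xs"] xs by simp
    have "P (LEAST z. P z xs) xs" using ex[OF xs] by (rule LeastI_ex)
    then show "computes g ((LEAST z. P z xs) # xs) 0" using *[of "LEAST z. P z xs"] by simp
    show "\<forall>y<LEAST z. P z xs. \<exists>v. v \<noteq> 0 \<and> computes g (y # xs) v"
    proof (intro allI impI)
      fix y assume "y < (LEAST z. P z xs)"
      then have "\<not> P y xs" by (rule not_less_Least)
      then show "\<exists>v. v \<noteq> 0 \<and> computes g (y # xs) v" using *[of y] by (intro exI[of _ 1]) simp
    qed
  qed
  then show ?thesis unfolding recursive_fn_def by blast
qed

section \<open>Codes of pairs, lists and sets\<close>

lemma recursive_fn_prod_encode: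
  assumes "recursive_fn n a" "recursive_fn n b" shows "recursive_fn n (\<lambda>xs. prod_encode (a xs, b xs))"
proof -
  have tri: "recursive_fn n (\<lambda>xs. triangle (f xs))" if "recursive_fn n f" for f
  proof -
    have "rec_nat 0 (\<lambda>i r. r + Suc i) x = triangle x" for x by (induction x) auto
    moreover have "recursive_fn n (\<lambda>xs. rec_nat 0 (\<lambda>i r. r + Suc i) (f xs))"
      by (rule recursive_fn_rec[OF that recursive_fn_const, of "\<lambda>i r _. r + Suc i"])
        (intro recursive_fn_add recursive_fn_Suc recursive_fn_arg)
    ultimately show ?thesis by simp
  qed
  show ?thesis unfolding prod_encode_def prod.case by (intro recursive_fn_add tri assms)
qed

lemmas recursive_intros =
  recursive_pred_bex recursive_pred_ball recursive_pred_not recursive_pred_conj recursive_pred_disj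
  recursive_pred_imp recursive_pred_iff recursive_pred_less recursive_pred_le recursive_pred_eq
  recursive_fn_prod_encode recursive_fn_Suc recursive_fn_add recursive_fn_mult recursive_fn_power
  recursive_fn_diff recursive_fn_arg recursive_fn_const

lemma prod_decode_bounded:
  "\<exists>x<Suc k. \<exists>y<Suc k. prod_decode k = (x, y) \<and> prod_encode (x, y) = k"
proof -
  obtain x y where xy: "prod_decode k = (x, y)" by (cases "prod_decode k")
  then have k: "prod_encode (x, y) = k" using prod_decode_inverse[of k] by simp
  then show ?thesis using xy le_prod_encode_1[of x y] le_prod_encode_2[of y x] by auto
qed

text \<open>Decoding is expressed as a search for a preimage under \<open>prod_encode\<close>, which
  is plain arithmetic. Both components are at most \<open>k\<close>, which bounds the inner
  quantifier.\<close>

lemma prod_decode_Least: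
  "fst (prod_decode k) = (LEAST x. \<exists>y<Suc k. prod_encode (x, y) = k)"
  "snd (prod_decode k) = (LEAST y. \<exists>x<Suc k. prod_encode (x, y) = k)"
proof -
  obtain x y where xy: "x < Suc k" "y < Suc k" "prod_decode k = (x, y)" "prod_encode (x, y) = k"
    using prod_decode_bounded by blast
  have uniq: "x' = x \<and> y' = y" if "prod_encode (x', y') = k" for x' y'
    using xy(3) unfolding that[symmetric] prod_encode_inverse by simp
  have "(LEAST x. \<exists>y<Suc k. prod_encode (x, y) = k) = x"
  proof (rule Least_equality)
    show "\<exists>y<Suc k. prod_encode (x, y) = k" using xy(2,4) by blast
    show "x \<le> z" if "\<exists>y<Suc k. prod_encode (z, y) = k" for z using that uniq by blast
  qed
  then show "fst (prod_decode k) = (LEAST x. \<exists>y<Suc k. prod_encode (x, y) = k)"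
    using xy(3) by simp
  have "(LEAST y. \<exists>x<Suc k. prod_encode (x, y) = k) = y"
  proof (rule Least_equality)
    show "\<exists>x<Suc k. prod_encode (x, y) = k" using xy(1,4) by blast
    show "y \<le> z" if "\<exists>x<Suc k. prod_encode (x, z) = k" for z using that uniq by blast
  qed
  then show "snd (prod_decode k) = (LEAST y. \<exists>x<Suc k. prod_encode (x, y) = k)"
    using xy(3) by simp
qed

lemma prod_decode_Least_ex: "\<exists>x. \<exists>y<Suc k. prod_encode (x, y) = k" "\<exists>y. \<exists>x<Suc k. prod_encode (x, y) = k"
  using prod_decode_bounded[of k] by blast+

lemma recursive_fn_fst_prod_decode:
  assumes "recursive_fn n f" shows "recursive_fn n (\<lambda>xs. fst (prod_decode (f xs)))"
  unfolding prod_decode_Least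
proof (rule recursive_fn_Least)
  show "recursive_pred (Suc n) (\<lambda>ys. \<exists>w<Suc (f (tl ys)). prod_encode (arg 0 ys, w) = f (tl ys))"
  proof (rule recursive_pred_bex)
    show "recursive_fn (Suc n) (\<lambda>ys. Suc (f (tl ys)))"
      by (intro recursive_fn_Suc recursive_fn_tl assms)
    show "recursive_pred (Suc (Suc n)) (\<lambda>ys. prod_encode (arg 0 (tl ys), arg 0 ys) = f (tl (tl ys)))"
      unfolding arg_tl
      by (intro recursive_pred_eq recursive_fn_prod_encode recursive_fn_arg assms[THEN recursive_fn_tl, THEN recursive_fn_tl])
  qed
qed (rule prod_decode_Least_ex)

lemma recursive_fn_snd_prod_decode:
  assumes "recursive_fn n f" shows "recursive_fn n (\<lambda>xs. snd (prod_decode (f xs)))"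
  unfolding prod_decode_Least
proof (rule recursive_fn_Least)
  show "recursive_pred (Suc n) (\<lambda>ys. \<exists>w<Suc (f (tl ys)). prod_encode (w, arg 0 ys) = f (tl ys))"
  proof (rule recursive_pred_bex)
    show "recursive_fn (Suc n) (\<lambda>ys. Suc (f (tl ys)))"
      by (intro recursive_fn_Suc recursive_fn_tl assms)
    show "recursive_pred (Suc (Suc n)) (\<lambda>ys. prod_encode (arg 0 ys, arg 0 (tl ys)) = f (tl (tl ys)))"
      unfolding arg_tl
      by (intro recursive_pred_eq recursive_fn_prod_encode recursive_fn_arg assms[THEN recursive_fn_tl, THEN recursive_fn_tl])
  qed
qed (rule prod_decode_Least_ex)

text \<open>The code of a nonempty list is the successor of the code of a pair of head and coded
  tail. On 0, the code of the empty list, truncated subtraction makes the step return 0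
  again.\<close>

definition drop_code :: "nat \<Rightarrow> nat \<Rightarrow> nat" where
  "drop_code c i = rec_nat c (\<lambda>_ r. snd (prod_decode (r - 1))) i"

definition nth_code :: "nat \<Rightarrow> nat \<Rightarrow> nat" where
  "nth_code c i = fst (prod_decode (drop_code c i - 1))"

definition length_code :: "nat \<Rightarrow> nat" where
  "length_code c = (LEAST l. drop_code c l = 0)"

text \<open>This is the code of \<open>l\<close> copies of \<open>n\<close>, the largest code of a
  list of length \<open>l\<close> with entries at most \<open>n\<close>.\<close>

definition code_bound :: "nat \<Rightarrow> nat \<Rightarrow> nat" where
  "code_bound n l = rec_nat 0 (\<lambda>_ r. Suc (prod_encode (n, r))) l"

lemma list_decode_tl: "list_decode (snd (prod_decode (c - 1))) = tl (list_decode c)"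
proof (cases c)
  case 0 then show ?thesis by (simp add: prod_decode_def prod_decode_aux.simps)
qed (simp split: prod.split)

lemma list_decode_drop_code: "list_decode (drop_code c i) = drop i (list_decode c)"
  by (induction i) (simp_all add: drop_code_def list_decode_tl[simplified] drop_Suc tl_drop[symmetric])

lemma list_decode_eq_Nil: "list_decode c = [] \<longleftrightarrow> c = 0"
  by (metis list_decode.simps(1) list_decode_inverse)

lemma nth_code: "i < length (list_decode c) \<Longrightarrow> nth_code c i = list_decode c ! i"
proof -
  assume i: "i < length (list_decode c)"
  then have ne: "list_decode (drop_code c i) \<noteq> []" by (simp add: list_decode_drop_code)
  then obtain k where k: "drop_code c i = Suc k" by (cases "drop_code c i") auto
  then have "fst (prod_decode k) = hd (list_decode (drop_code c i))" by (simp split: prod.split)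
  also have "\<dots> = list_decode c ! i" using i by (simp add: list_decode_drop_code hd_drop_conv_nth)
  finally show ?thesis using k by (simp add: nth_code_def)
qed

lemma drop_code_eq_0: "drop_code c l = 0 \<longleftrightarrow> length (list_decode c) \<le> l"
  unfolding list_decode_eq_Nil[symmetric] list_decode_drop_code by simp

lemma length_code: "length_code c = length (list_decode c)"
  unfolding length_code_def drop_code_eq_0 by (rule Least_equality) auto

lemma list_encode_le_code_bound: "\<forall>v\<in>set vs. v \<le> n \<Longrightarrow> list_encode vs \<le> code_bound n (length vs)"
proof (induction vs)
  case (Cons v vs)
  have mono: "triangle i \<le> triangle j" if "i \<le> j" for i j
    using that by (induction rule: dec_induct) auto
  have "v \<le> n" "list_encode vs \<le> code_bound n (length vs)" using Cons by auto
  then have "prod_encode (v, list_encode vs) \<le> prod_encode (n, code_bound n (length vs))"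
    unfolding prod_encode_def prod.case by (intro add_mono mono)
  then show ?case by (simp add: code_bound_def)
qed simp

lemma recursive_fn_drop_code:
  assumes "recursive_fn n a" "recursive_fn n b" shows "recursive_fn n (\<lambda>xs. drop_code (a xs) (b xs))"
  unfolding drop_code_def
  by (rule recursive_fn_rec[OF assms(2,1), of "\<lambda>_ r _. snd (prod_decode (r - 1))"])
    (intro recursive_fn_snd_prod_decode recursive_fn_diff recursive_fn_arg recursive_fn_const)

lemma recursive_fn_nth_code:
  assumes "recursive_fn n a" "recursive_fn n b" shows "recursive_fn n (\<lambda>xs. nth_code (a xs) (b xs))"
  unfolding nth_code_def
  by (intro recursive_fn_fst_prod_decode recursive_fn_diff recursive_fn_drop_code recursive_fn_const assms)

lemma recursive_fn_length_code:
  assumes "recursive_fn n a" shows "recursive_fn n (\<lambda>xs. length_code (a xs))"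
  unfolding length_code_def
proof (rule recursive_fn_Least)
  show "recursive_pred (Suc n) (\<lambda>ys. drop_code (a (tl ys)) (arg 0 ys) = 0)"
    by (intro recursive_pred_eq recursive_fn_drop_code recursive_fn_tl recursive_fn_arg recursive_fn_const assms)
  show "\<exists>z. drop_code (a xs) z = 0" for xs by (auto simp: drop_code_eq_0)
qed

lemma recursive_fn_code_bound:
  assumes "recursive_fn n a" "recursive_fn n b" shows "recursive_fn n (\<lambda>xs. code_bound (a xs) (b xs))"
  unfolding code_bound_def
  by (rule recursive_fn_rec[OF assms(2) recursive_fn_const, of "\<lambda>_ r xs. Suc (prod_encode (a xs, r))"])
    (intro recursive_fn_Suc recursive_fn_prod_encode recursive_fn_arg recursive_fn_tl assms)

text \<open>Membership is a test of bit \<open>b\<close> of \<open>e\<close>. It is rewritten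
  without division, using only operations that have closure rules.\<close>

lemma mem_set_decode_iff: "b \<in> set_decode e \<longleftrightarrow> (\<exists>q<Suc e. \<exists>r<2 ^ b. e = (2 * q + 1) * 2 ^ b + r)"
proof
  assume "b \<in> set_decode e"
  then have "odd (e div 2 ^ b)" unfolding set_decode_def mem_Collect_eq .
  then obtain q where q: "e div 2 ^ b = 2 * q + 1" by (rule oddE)
  have "e div 2 ^ b \<le> e" by (rule div_le_dividend)
  then have "q < Suc e" using q by linarith
  moreover have "e = (2 * q + 1) * 2 ^ b + e mod 2 ^ b" unfolding q[symmetric] by (rule div_mult_mod_eq[symmetric])
  moreover have "e mod 2 ^ b < 2 ^ b" by simp
  ultimately show "\<exists>q<Suc e. \<exists>r<2 ^ b. e = (2 * q + 1) * 2 ^ b + r" by blast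
next
  assume "\<exists>q<Suc e. \<exists>r<2 ^ b. e = (2 * q + 1) * 2 ^ b + r"
  then obtain q r where "r < 2 ^ b" "e = (2 * q + 1) * 2 ^ b + r" by blast
  then have "e div 2 ^ b = 2 * q + 1" by (metis add.commute add.right_neutral div_less div_mult_self3 power_not_zero zero_neq_numeral)
  then have "odd (e div 2 ^ b)" by simp
  then show "b \<in> set_decode e" unfolding set_decode_def mem_Collect_eq .
qed

lemma recursive_pred_mem_set_decode:
  assumes "recursive_fn n a" "recursive_fn n b" shows "recursive_pred n (\<lambda>xs. b xs \<in> set_decode (a xs))"
  unfolding mem_set_decode_iff
proof (rule recursive_pred_bex)
  show "recursive_fn n (\<lambda>xs. Suc (a xs))" by (intro recursive_fn_Suc assms)
  show "recursive_pred (Suc n) (\<lambda>ys. \<exists>r<2 ^ b (tl ys). a (tl ys) = (2 * arg 0 ys + 1) * 2 ^ b (tl ys) + r)"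
  proof (rule recursive_pred_bex)
    show "recursive_fn (Suc n) (\<lambda>ys. 2 ^ b (tl ys))"
      by (intro recursive_fn_power recursive_fn_const recursive_fn_tl assms)
    show "recursive_pred (Suc (Suc n))
      (\<lambda>ys. a (tl (tl ys)) = (2 * arg 0 (tl ys) + 1) * 2 ^ b (tl (tl ys)) + arg 0 ys)"
      unfolding arg_tl
      by (intro recursive_pred_eq recursive_fn_add recursive_fn_mult recursive_fn_power recursive_fn_const
          recursive_fn_arg assms[THEN recursive_fn_tl, THEN recursive_fn_tl])
  qed
qed

section \<open>The decision procedure\<close>

definition perm_code :: "nat \<Rightarrow> nat \<Rightarrow> bool" where
  "perm_code n p \<longleftrightarrow> length_code p = n \<and> (\<forall>i<n. 1 \<le> nth_code p i \<and> nth_code p i \<le> n) \<and>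
     (\<forall>i<n. \<forall>j<n. i < j \<longrightarrow> \<not> nth_code p i = nth_code p j)"

text \<open>Intervals are ranges of positions, so only ranges are tested, and an outside point can
  separate a range only by value. The excluded range is the whole permutation.\<close>

definition simple_code :: "nat \<Rightarrow> nat \<Rightarrow> bool" where
  "simple_code n p \<longleftrightarrow> (\<forall>a<n. \<forall>b<n. a < b \<longrightarrow> \<not> (a = 0 \<and> Suc b = n) \<longrightarrow>
     (\<exists>v<n. (v < a \<or> b < v) \<and> (\<exists>i<n. \<exists>j<n. a \<le> i \<and> i \<le> b \<and> a \<le> j \<and> j \<le> b \<and>
        nth_code p i < nth_code p v \<and> nth_code p v < nth_code p j)))"

text \<open>The number \<open>t\<close> codes the index map of \<open>perm_contained_iff\<close> as
  a list, which makes the search for an occurrence bounded.\<close>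

definition contains_code :: "nat \<Rightarrow> nat \<Rightarrow> nat \<Rightarrow> bool" where
  "contains_code b n p \<longleftrightarrow> (\<exists>t<Suc (code_bound n (length_code b)).
     (\<forall>i<length_code b. nth_code t i < n) \<and>
     (\<forall>i<length_code b. \<forall>j<length_code b. (i < j \<longrightarrow> nth_code t i < nth_code t j) \<and>
        (nth_code b i < nth_code b j \<longleftrightarrow> nth_code p (nth_code t i) < nth_code p (nth_code t j))))"

definition avoider_code :: "nat \<Rightarrow> nat \<Rightarrow> nat \<Rightarrow> bool" where
  "avoider_code e n p \<longleftrightarrow> perm_code n p \<and> simple_code n p \<and>
     (\<forall>b<e. b \<in> set_decode e \<longrightarrow> \<not> contains_code b n p)"

section \<open>Correctness of the coded predicates\<close>

lemma perm_code_iff: "perm_code n p \<longleftrightarrow> list_decode p \<in> perms \<and> length (list_decode p) = n"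
proof -
  let ?\<pi> = "list_decode p"
  have "(\<forall>i<n. 1 \<le> ?\<pi> ! i \<and> ?\<pi> ! i \<le> n) \<and> (\<forall>i<n. \<forall>j<n. i < j \<longrightarrow> \<not> ?\<pi> ! i = ?\<pi> ! j) \<longleftrightarrow> ?\<pi> \<in> perms"
    if n: "length ?\<pi> = n"
  proof
    assume l: "(\<forall>i<n. 1 \<le> ?\<pi> ! i \<and> ?\<pi> ! i \<le> n) \<and> (\<forall>i<n. \<forall>j<n. i < j \<longrightarrow> \<not> ?\<pi> ! i = ?\<pi> ! j)"
    have "distinct ?\<pi>"
      unfolding distinct_conv_nth
    proof (intro allI impI)
      fix i j assume "i < length ?\<pi>" "j < length ?\<pi>" "i \<noteq> j"
      then show "?\<pi> ! i \<noteq> ?\<pi> ! j" using l n by (cases i j rule: linorder_cases) metis+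
    qed
    moreover have "set ?\<pi> \<subseteq> {1..n}" using l n by (auto simp: in_set_conv_nth)
    ultimately have "set ?\<pi> = {1..n}" using n by (intro card_subset_eq) (auto simp: distinct_card)
    then show "?\<pi> \<in> perms" using \<open>distinct ?\<pi>\<close> n by (simp add: perms_iff)
  next
    assume "?\<pi> \<in> perms"
    then have \<pi>: "distinct ?\<pi>" "set ?\<pi> = {1..n}" using n by (auto simp: perms_iff)
    have "?\<pi> ! i \<in> {1..n}" if "i < n" for i using \<pi>(2) n nth_mem[of i ?\<pi>] that by auto
    then show "(\<forall>i<n. 1 \<le> ?\<pi> ! i \<and> ?\<pi> ! i \<le> n) \<and> (\<forall>i<n. \<forall>j<n. i < j \<longrightarrow> \<not> ?\<pi> ! i = ?\<pi> ! j)"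
      using \<pi>(1) n by (auto simp: nth_eq_iff_index_eq)
  qed
  then show ?thesis unfolding perm_code_def length_code by (auto simp: nth_code)
qed

lemma simple_code_iff:
  assumes "\<pi> \<in> perms" "\<pi> = list_decode p" "n = length \<pi>"
  shows "simple_code n p \<longleftrightarrow> simple_perm \<pi>"
proof -
  let ?V = "{..<n}"
  have nth: "nth_code p i = \<pi> ! i" if "i < n" for i using nth_code that assms(2,3) by simp
  have sc: "simple_code n p \<longleftrightarrow> (\<forall>a<n. \<forall>b<n. a < b \<longrightarrow> \<not> (a = 0 \<and> Suc b = n) \<longrightarrow>
     (\<exists>v<n. (v < a \<or> b < v) \<and> (\<exists>i<n. \<exists>j<n. a \<le> i \<and> i \<le> b \<and> a \<le> j \<and> j \<le> b \<and>
        \<pi> ! i < \<pi> ! v \<and> \<pi> ! v < \<pi> ! j)))"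
    unfolding simple_code_def using nth by (simp cong: conj_cong)
  have "simple_perm \<pi> \<longleftrightarrow> simple_on ?V int (perm_y \<pi>)" using simple_perm_iff[OF assms(1)] assms(3) by simp
  also have "\<dots> \<longleftrightarrow> simple_code n p"
  proof
    assume s: "simple_on ?V int (perm_y \<pi>)"
    show "simple_code n p"
      unfolding sc
    proof (intro allI impI)
      fix a b assume ab: "a < n" "b < n" "a < b" "\<not> (a = 0 \<and> Suc b = n)"
      have "{a..b} \<noteq> ?V"
      proof
        assume eq: "{a..b} = ?V"
        have "0 \<in> ?V" "n - 1 \<in> ?V" using ab by auto
        then have "0 \<in> {a..b}" "n - 1 \<in> {a..b}" using eq by blast+
        then show False using ab by auto
      qed
      moreover have "\<exists>i\<in>{a..b}. \<exists>j\<in>{a..b}. i \<noteq> j" using ab by (intro bexI[of _ a] bexI[of _ b]) auto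
      ultimately have "\<not> interval_in ?V int (perm_y \<pi>) {a..b}" using s unfolding simple_on_def by blast
      moreover have "{a..b} \<subseteq> ?V" using ab by auto
      ultimately obtain v where v: "v \<in> ?V" "v \<notin> {a..b}" "separates int (perm_y \<pi>) v {a..b}"
        unfolding interval_in_def by blast
      then have "\<exists>i\<in>{a..b}. \<exists>j\<in>{a..b}. \<pi> ! i < \<pi> ! v \<and> \<pi> ! v < \<pi> ! j"
        unfolding separates_def by auto
      then obtain i j where ij: "i \<in> {a..b}" "j \<in> {a..b}" "\<pi> ! i < \<pi> ! v" "\<pi> ! v < \<pi> ! j" by blast
      show "\<exists>v<n. (v < a \<or> b < v) \<and> (\<exists>i<n. \<exists>j<n. a \<le> i \<and> i \<le> b \<and> a \<le> j \<and> j \<le> b \<and> \<pi> ! i < \<pi> ! v \<and> \<pi> ! v < \<pi> ! j)"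
        using v(1,2) ij ab by (intro exI[of _ v] conjI exI[of _ i] exI[of _ j]) auto
    qed
  next
    assume s: "simple_code n p"
    show "simple_on ?V int (perm_y \<pi>)"
      unfolding simple_on_def
    proof (intro allI impI)
      fix I assume I: "interval_in ?V int (perm_y \<pi>) I" "\<exists>a\<in>I. \<exists>b\<in>I. a \<noteq> b"
      then have IV: "I \<subseteq> ?V" by (simp add: interval_in_def)
      then have fin: "finite I" using finite_subset by blast
      have ne: "I \<noteq> {}" using I(2) by auto
      define a b where "a = Min I" and "b = Max I"
      have ab: "a \<in> I" "b \<in> I" "\<And>i. i \<in> I \<Longrightarrow> a \<le> i \<and> i \<le> b" using fin ne by (auto simp: a_def b_def)
      have lt: "a < n" "b < n" using ab(1,2) IV by auto
      have mem: "i \<in> I \<longleftrightarrow> a \<le> i \<and> i \<le> b" for i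
      proof
        assume i: "a \<le> i \<and> i \<le> b"
        then have "i \<in> ?V" using lt by auto
        then show "i \<in> I" using interval_in_convex[OF I(1) ab(1,2), of i] i by simp
      qed (use ab(3) in blast)
      obtain c d where "c \<in> I" "d \<in> I" "c \<noteq> d" using I(2) by blast
      then have "a < b" using ab(3)[of c] ab(3)[of d] by linarith
      have "a = 0 \<and> Suc b = n"
      proof (rule ccontr)
        assume "\<not> (a = 0 \<and> Suc b = n)"
        then obtain v i j where v: "v < n" "v < a \<or> b < v" and ij: "a \<le> i" "i \<le> b" "a \<le> j" "j \<le> b"
          "\<pi> ! i < \<pi> ! v" "\<pi> ! v < \<pi> ! j"
          using s[unfolded sc, rule_format, OF lt \<open>a < b\<close>] by blast
        have "i \<in> I" "j \<in> I" using ij mem by auto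
        then have "v \<in> I" using interval_in_between[OF I(1), of v i j] v(1) ij(5,6) by auto
        then show False using v(2) mem by auto
      qed
      then have "i \<in> I \<longleftrightarrow> i \<in> ?V" for i using mem[of i] by auto
      then show "I = ?V" by blast
    qed
  qed
  finally show ?thesis ..
qed

lemma contains_code_iff:
  assumes "\<pi> = list_decode p" "n = length \<pi>" "\<beta> = list_decode b"
  shows "contains_code b n p \<longleftrightarrow> \<beta> \<preceq> \<pi>"
proof -
  have nth: "nth_code p i = \<pi> ! i" if "i < n" for i using nth_code that assms(1,2) by simp
  have nthb: "nth_code b i = \<beta> ! i" if "i < length \<beta>" for i using nth_code that assms(3) by simp
  have len: "length_code b = length \<beta>" using length_code assms(3) by simp
  show ?thesis
  proof
    assume "contains_code b n p"
    then obtain t where t: "\<forall>i<length \<beta>. nth_code t i < n"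
      "\<forall>i<length \<beta>. \<forall>j<length \<beta>. (i < j \<longrightarrow> nth_code t i < nth_code t j) \<and>
        (nth_code b i < nth_code b j \<longleftrightarrow> nth_code p (nth_code t i) < nth_code p (nth_code t j))"
      unfolding contains_code_def len by blast
    show "\<beta> \<preceq> \<pi>" unfolding perm_contained_iff
    proof (intro exI[of _ "nth_code t"] conjI allI impI)
      fix i assume i: "i < length \<beta>"
      show "nth_code t i < length \<pi>" using t(1) i assms(2) by simp
      fix j assume j: "j < length \<beta>"
      show "(\<beta> ! i < \<beta> ! j) = (\<pi> ! nth_code t i < \<pi> ! nth_code t j)"
        using t(2)[rule_format, OF i j] t(1) i j nth nthb by simp
    next
      fix i j assume "i < j" "j < length \<beta>"
      then show "nth_code t i < nth_code t j" using t(2)[rule_format, of i j] by simp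
    qed
  next
    assume "\<beta> \<preceq> \<pi>"
    then obtain h where h: "\<forall>i<length \<beta>. h i < n" "\<forall>i j. i < j \<longrightarrow> j < length \<beta> \<longrightarrow> h i < h j"
      "\<forall>i<length \<beta>. \<forall>j<length \<beta>. (\<beta> ! i < \<beta> ! j) = (\<pi> ! h i < \<pi> ! h j)"
      unfolding perm_contained_iff assms(2)[symmetric] by blast
    let ?t = "list_encode (map h [0..<length \<beta>])"
    have t: "nth_code ?t i = h i" if "i < length \<beta>" for i
      using nth_code[of i ?t] that by simp
    have "?t \<le> code_bound n (length (map h [0..<length \<beta>]))"
      using h(1) by (intro list_encode_le_code_bound) auto
    then have "?t < Suc (code_bound n (length \<beta>))" by simp
    moreover have "(i < j \<longrightarrow> nth_code ?t i < nth_code ?t j) \<and>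
        (nth_code b i < nth_code b j \<longleftrightarrow> nth_code p (nth_code ?t i) < nth_code p (nth_code ?t j))"
      if ij: "i < length \<beta>" "j < length \<beta>" for i j
      using h(2)[rule_format, of i j] h(3)[rule_format, OF ij] h(1)[rule_format, OF ij(1)]
        h(1)[rule_format, OF ij(2)] ij t nth nthb by simp
    moreover have "\<forall>i<length \<beta>. nth_code ?t i < n" using h(1) t by simp
    ultimately show "contains_code b n p"
      unfolding contains_code_def len by (intro exI[of _ ?t] conjI allI impI) blast+
  qed
qed

text \<open>The coded predicates use only constructs with closure rules, so the proof follows their
  syntax; \<open>arg_tl\<close> renumbers variables under a quantifier.\<close>

lemma recursive_avoider_code:
  "recursive_pred (Suc (Suc (Suc 0))) (\<lambda>xs. avoider_code (arg (Suc (Suc 0)) xs) (arg (Suc 0) xs) (arg 0 xs))"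
  unfolding avoider_code_def perm_code_def simple_code_def contains_code_def
  by (intro recursive_intros recursive_pred_mem_set_decode recursive_fn_nth_code recursive_fn_length_code
      recursive_fn_code_bound | simp only: arg_tl)+

text \<open>Every basis element is shorter than the code \<open>e\<close> of the basis, so no
  maximal length has to be computed. The summand 3 provides \<open>3 \<le> m\<close>.\<close>

definition length_threshold :: "nat \<Rightarrow> nat" where
  "length_threshold e = simple_bound (word_length (e + 3))"

definition decision_formula :: "nat \<Rightarrow> bool" where
  "decision_formula e \<longleftrightarrow> (\<exists>n<length_threshold e + 3. length_threshold e \<le> n \<and>
     (\<exists>p<Suc (code_bound n n). avoider_code e n p))"

lemma recursive_length_threshold:
  assumes "recursive_fn n f" shows "recursive_fn n (\<lambda>xs. length_threshold (f xs))"
  unfolding length_threshold_def simple_bound_def word_length_def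
  by (intro recursive_fn_power recursive_fn_mult recursive_fn_add recursive_fn_Suc recursive_fn_const assms)

lemma recursive_decision_formula: "recursive_pred (Suc 0) (\<lambda>xs. decision_formula (arg 0 xs))"
  unfolding decision_formula_def
  by (intro recursive_pred_bex recursive_pred_conj recursive_pred_le recursive_avoider_code
      recursive_length_threshold recursive_fn_code_bound recursive_fn_add recursive_fn_Suc
      recursive_fn_arg recursive_fn_const | simp only: arg_tl)+

lemma length_le_list_encode: "length vs \<le> list_encode vs"
proof (induction vs)
  case (Cons v vs)
  then show ?case using le_prod_encode_2[of "list_encode vs" v] by simp
qed simp

lemma mem_set_decode_less: "b \<in> set_decode e \<Longrightarrow> b < e"
proof -
  assume "b \<in> set_decode e"
  then obtain q r where "e = (2 * q + 1) * 2 ^ b + r" unfolding mem_set_decode_iff by blast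
  then have "2 ^ b \<le> e" by simp
  then show ?thesis using less_exp[of b] by linarith
qed

lemma decision_formula_iff:
  assumes "B \<subseteq> perms" "finite B"
  shows "decision_formula (encode_lists B) \<longleftrightarrow> infinite {\<pi> \<in> Av B. simple_perm \<pi>}"
proof -
  let ?e = "encode_lists B"
  let ?N = "length_threshold ?e"
  have mem: "b \<in> set_decode ?e \<longleftrightarrow> list_decode b \<in> B" for b
  proof -
    have "set_decode ?e = list_encode ` B" using assms(2) by (simp add: encode_lists_def)
    moreover have "b \<in> list_encode ` B \<longleftrightarrow> list_decode b \<in> B" by (metis imageE imageI list_decode_inverse list_encode_inverse)
    ultimately show ?thesis by simp
  qed
  have "\<forall>\<beta>\<in>B. length \<beta> \<le> ?e + 3"
  proof
    fix \<beta> assume "\<beta> \<in> B"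
    then have "list_encode \<beta> < ?e" using mem[of "list_encode \<beta>"] by (intro mem_set_decode_less) simp
    then show "length \<beta> \<le> ?e + 3" using length_le_list_encode[of \<beta>] by linarith
  qed
  then have inf: "infinite {\<pi> \<in> Av B. simple_perm \<pi>} \<longleftrightarrow>
      (\<exists>\<pi>\<in>Av B. simple_perm \<pi> \<and> ?N \<le> length \<pi> \<and> length \<pi> \<le> ?N + 2)"
    by (rule infinite_simple_iff) (simp_all add: length_threshold_def)
  have avoider: "avoider_code ?e n p \<longleftrightarrow> (list_decode p \<in> Av B \<and> simple_perm (list_decode p) \<and> length (list_decode p) = n)"
    for n p
  proof (cases "perm_code n p")
    case True
    let ?\<pi> = "list_decode p"
    have \<pi>: "?\<pi> \<in> perms" "n = length ?\<pi>" using True by (auto simp: perm_code_iff)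
    have "(\<forall>b<?e. b \<in> set_decode ?e \<longrightarrow> \<not> contains_code b n p) \<longleftrightarrow> (\<forall>b. list_decode b \<in> B \<longrightarrow> \<not> list_decode b \<preceq> ?\<pi>)"
      unfolding mem[symmetric] contains_code_iff[OF refl \<pi>(2) refl] using mem_set_decode_less by blast
    also have "\<dots> \<longleftrightarrow> (\<forall>\<beta>\<in>B. \<not> \<beta> \<preceq> ?\<pi>)" by (metis list_encode_inverse)
    finally show ?thesis using True \<pi> simple_code_iff[OF \<pi>(1) refl \<pi>(2)]
      unfolding avoider_code_def Av_def by auto
  next
    case False
    then show ?thesis unfolding avoider_code_def perm_code_iff Av_def by auto
  qed
  have "(\<exists>p<Suc (code_bound n n). avoider_code ?e n p) \<longleftrightarrow> (\<exists>\<pi>\<in>Av B. simple_perm \<pi> \<and> length \<pi> = n)" for n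
  proof
    assume "\<exists>\<pi>\<in>Av B. simple_perm \<pi> \<and> length \<pi> = n"
    then obtain \<pi> where \<pi>: "\<pi> \<in> Av B" "simple_perm \<pi>" "length \<pi> = n" by blast
    then have "\<forall>v\<in>set \<pi>. v \<le> n" by (auto simp: Av_def perms_iff)
    then have "list_encode \<pi> < Suc (code_bound n n)"
      using list_encode_le_code_bound[of \<pi> n] \<pi>(3) by simp
    moreover have "avoider_code ?e n (list_encode \<pi>)" unfolding avoider using \<pi> by simp
    ultimately show "\<exists>p<Suc (code_bound n n). avoider_code ?e n p" by blast
  qed (auto simp: avoider)
  then have "decision_formula ?e \<longleftrightarrow>
      (\<exists>n<?N + 3. ?N \<le> n \<and> (\<exists>\<pi>\<in>Av B. simple_perm \<pi> \<and> length \<pi> = n))"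
    unfolding decision_formula_def by simp
  also have "\<dots> \<longleftrightarrow> (\<exists>\<pi>\<in>Av B. simple_perm \<pi> \<and> ?N \<le> length \<pi> \<and> length \<pi> \<le> ?N + 2)"
  proof
    assume "\<exists>\<pi>\<in>Av B. simple_perm \<pi> \<and> ?N \<le> length \<pi> \<and> length \<pi> \<le> ?N + 2"
    then obtain \<pi> where "\<pi> \<in> Av B" "simple_perm \<pi>" "?N \<le> length \<pi>" "length \<pi> < ?N + 3" by auto
    then show "\<exists>n<?N + 3. ?N \<le> n \<and> (\<exists>\<pi>\<in>Av B. simple_perm \<pi> \<and> length \<pi> = n)" by blast
  qed auto
  finally show ?thesis using inf by simp
qed

theorem theorem1p1:
  shows "decidable_on encode_lists
           {B. B \<subseteq> perms \<and> finite B \<and> perm_antichain B}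
           (\<lambda>B. infinite {\<pi> \<in> Av B. simple_perm \<pi>})"
proof -
  obtain g where g: "\<And>xs. length xs = Suc 0 \<Longrightarrow> computes g xs (if decision_formula (arg 0 xs) then 1 else 0)"
    using recursive_decision_formula unfolding recursive_pred_def recursive_fn_def by blast
  have "computes g [encode_lists B] (if infinite {\<pi> \<in> Av B. simple_perm \<pi>} then 1 else 0)"
    if "B \<subseteq> perms" "finite B" for B
    using g[of "[encode_lists B]"] decision_formula_iff[OF that] by simp
  then show ?thesis unfolding decidable_on_def by blast
qed

end
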